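(* Let $\kappa \le 0$, let $X$ be a CBB$(\kappa)$ space, let $Y$ be a complete CAT$(\kappa)$ space and let $A \subseteq X$ be nonempty. Then there exists a continuous mapping $\alpha_c : \mathcal{N}(A,Y) \to \mathcal{N}(X,Y)$ such that for all $g \in \mathcal{N}(A,Y)$, $\alpha_c(g)(a) = g(a)$ for every $a \in A$ and $\alpha_c(g)(X) \subseteq \overline{\mathrm{co}}(g(A))$.
   Context: For $\kappa\le0$, a geodesic space is CAT$(\kappa)$ (resp. CBB$(\kappa)$) if every geodesic triangle satisfies $\le$ (resp. $\ge$) when comparing distances between points on it with distances between corresponding points of its comparison triangle in the model surface $M^2_\kappa$ of constant curvature $\kappa$. $\mathcal{N}(A,Y)$ is the set of bounded nonexpansive maps $A\to Y$ with the supremum metric. For $C\subseteq Y$, $G_1(C)$ is the union of all geodesic segments with endpoints in $C$, $G_n(C)=G_1(G_{n-1}(C))$, $\mathrm{co}(C)=\bigcup_n G_n(C)$, and $\overline{\mathrm{co}}(C)$ is its closure. *)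

theory Defs
  imports "HOL-Analysis.Analysis"
begin

definition geodesic_in :: "'p set \<Rightarrow> ('p \<Rightarrow> 'p \<Rightarrow> real) \<Rightarrow> (real \<Rightarrow> 'p) \<Rightarrow> 'p \<Rightarrow> 'p \<Rightarrow> bool" where
  "geodesic_in S d \<gamma> x y \<longleftrightarrow>
     \<gamma> 0 = x \<and> \<gamma> (d x y) = y \<and> \<gamma> ` {0..d x y} \<subseteq> S \<and>
     (\<forall>s\<in>{0..d x y}. \<forall>t\<in>{0..d x y}. d (\<gamma> s) (\<gamma> t) = \<bar>s - t\<bar>)"

definition geodesic_space :: "'p set \<Rightarrow> ('p \<Rightarrow> 'p \<Rightarrow> real) \<Rightarrow> bool" where
  "geodesic_space S d \<longleftrightarrow> (\<forall>x\<in>S. \<forall>y\<in>S. \<exists>\<gamma>. geodesic_in S d \<gamma> x y)"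

text \<open>Model surface M^2_kappa for kappa \<le> 0: the Euclidean plane (kappa = 0) and the
  upper half-plane model of the hyperbolic plane rescaled to curvature kappa (kappa < 0).\<close>
definition model_carrier :: "real \<Rightarrow> complex set" where
  "model_carrier \<kappa> = (if \<kappa> = 0 then UNIV else {z. Im z > 0})"

definition model_dist :: "real \<Rightarrow> complex \<Rightarrow> complex \<Rightarrow> real" where
  "model_dist \<kappa> z w = (if \<kappa> = 0 then cmod (z - w)
     else arcosh (1 + (cmod (z - w))\<^sup>2 / (2 * Im z * Im w)) / sqrt (- \<kappa>))"

definition triangle_comparison ::
  "(real \<Rightarrow> real \<Rightarrow> bool) \<Rightarrow> real \<Rightarrow> 'p set \<Rightarrow> ('p \<Rightarrow> 'p \<Rightarrow> real) \<Rightarrow> bool" where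
  "triangle_comparison R \<kappa> S d \<longleftrightarrow>
    (\<forall>p q r g1 g2 g3 p' q' r' h1 h2 h3.
       p \<in> S \<and> q \<in> S \<and> r \<in> S \<and>
       geodesic_in S d g1 p q \<and> geodesic_in S d g2 q r \<and> geodesic_in S d g3 r p \<and>
       p' \<in> model_carrier \<kappa> \<and> q' \<in> model_carrier \<kappa> \<and> r' \<in> model_carrier \<kappa> \<and>
       model_dist \<kappa> p' q' = d p q \<and> model_dist \<kappa> q' r' = d q r \<and> model_dist \<kappa> r' p' = d r p \<and>
       geodesic_in (model_carrier \<kappa>) (model_dist \<kappa>) h1 p' q' \<and>
       geodesic_in (model_carrier \<kappa>) (model_dist \<kappa>) h2 q' r' \<and>
       geodesic_in (model_carrier \<kappa>) (model_dist \<kappa>) h3 r' p' \<longrightarrow>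
       (\<forall>(g, h, L) \<in> set [(g1, h1, d p q), (g2, h2, d q r), (g3, h3, d r p)].
        \<forall>(g', h', L') \<in> set [(g1, h1, d p q), (g2, h2, d q r), (g3, h3, d r p)].
        \<forall>s\<in>{0..L}. \<forall>t\<in>{0..L'}. R (d (g s) (g' t)) (model_dist \<kappa> (h s) (h' t))))"

definition CAT :: "real \<Rightarrow> 'p set \<Rightarrow> ('p \<Rightarrow> 'p \<Rightarrow> real) \<Rightarrow> bool" where
  "CAT \<kappa> S d \<longleftrightarrow> geodesic_space S d \<and> triangle_comparison (\<le>) \<kappa> S d"

definition CBB :: "real \<Rightarrow> 'p set \<Rightarrow> ('p \<Rightarrow> 'p \<Rightarrow> real) \<Rightarrow> bool" where
  "CBB \<kappa> S d \<longleftrightarrow> geodesic_space S d \<and> triangle_comparison (\<ge>) \<kappa> S d"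

text \<open>Bounded nonexpansive maps A \<rightarrow> Y (only values on A matter) and the supremum metric.\<close>
definition NE :: "'a::metric_space set \<Rightarrow> ('a \<Rightarrow> 'b::metric_space) set" where
  "NE A = {g. (\<forall>x\<in>A. \<forall>y\<in>A. dist (g x) (g y) \<le> dist x y) \<and> bounded (g ` A)}"

definition supdist :: "'a set \<Rightarrow> ('a \<Rightarrow> 'b::metric_space) \<Rightarrow> ('a \<Rightarrow> 'b) \<Rightarrow> real" where
  "supdist A g h = (SUP x\<in>A. dist (g x) (h x))"

definition G1 :: "'b::metric_space set \<Rightarrow> 'b set" where
  "G1 C = {\<gamma> s | \<gamma> x y s. x \<in> C \<and> y \<in> C \<and> geodesic_in UNIV dist \<gamma> x y \<and> s \<in> {0..dist x y}}"

definition co :: "'b::metric_space set \<Rightarrow> 'b set" where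
  "co C = (\<Union>n. (G1 ^^ Suc n) C)"

end

theory Submission
  imports Defs
begin

text \<open>All maps \<open>g \<in> NE A\<close> are extended simultaneously. With \<open>K = - \<kappa>\<close> and the gauge \<open>md K\<close>, whose second
  derivative is \<open>1 + K md K\<close>, the evaluation map \<open>(a, g) \<mapsto> g a\<close> becomes nonexpansive on \<open>A \<times> NE A\<close> when the gauge
  of the distance between \<open>(x, g)\<close> and \<open>(x', h)\<close> is \<open>md K (dist x x') + w g h\<close>, where \<open>w\<close> is a suitable metric that
  induces the uniform topology. Kirszbraun's theorem only needs of its domain that, for nonnegative weights \<open>l\<close>, the sums
  \<open>\<Sum>i j. l i * l j * (e p i + e p j + K * e p i * e p j - e i j)\<close> of gauged distances \<open>e\<close> are nonnegative. This is the
  Lang--Schroeder inequality; it holds in CBB(\<open>\<kappa>\<close>) spaces, and it survives adding \<open>w\<close>, simply because \<open>w\<close> satisfies the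
  triangle inequality. The extension over \<open>X \<times> NE A\<close> is therefore nonexpansive in \<open>x\<close> and equicontinuous in \<open>g\<close>.
  Projecting the value at \<open>(x, g)\<close> onto the closed convex hull of \<open>g ` A\<close>, which depends continuously on \<open>g\<close>, gives the
  required map.\<close>

section \<open>Comparison triangles in the model plane\<close>

text \<open>Kirszbraun's theorem rests on Zorn's lemma, so extending the maps one at a time would
  give no control over the dependence on \<open>g\<close>. With \<open>g\<close> as part of the
  index, continuity in \<open>g\<close> becomes one more instance of the distance inequality to be
  preserved. The metric \<open>supdist\<close> itself cannot serve as \<open>w\<close>: moving the
  values by \<delta> changes \<open>md K\<close> of a distance by an amount that grows with that
  distance. So \<open>w\<close> needs a factor measuring the size of the maps, and a second term
  that repairs the triangle inequality which this factor breaks. Slopes in \<open>X\<close> and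
  excesses over balls in \<open>Y\<close> need not attain their extrema, since no local compactness
  is available; near-extremal points are used instead, with a slack that is negligible against the
  step length. Projections depend continuously on the convex set only uniformly for points at
  bounded distance from it, while \<open>X\<close> may be unbounded. Hence the values of the
  extension have to be bounded independently of \<open>x\<close> before they are projected.\<close>

text \<open>For \<open>\<kappa> = - K\<close> the gauge \<open>md\<close> solves \<open>f'' = 1 + K f\<close>, and \<open>sn = md'\<close>.\<close>
definition md :: "real \<Rightarrow> real \<Rightarrow> real" where
  "md K t = (if K = 0 then t\<^sup>2 / 2 else (cosh (sqrt K * t) - 1) / K)"

definition sn :: "real \<Rightarrow> real \<Rightarrow> real" where
  "sn K t = (if K = 0 then t else sinh (sqrt K * t) / sqrt K)"

lemma md_0 [simp]: "md K 0 = 0" and sn_0 [simp]: "sn K 0 = 0"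
  by (simp_all add: md_def sn_def)

lemma md_minus [simp]: "md K (- t) = md K t" and sn_minus [simp]: "sn K (- t) = - sn K t"
  by (simp_all add: md_def sn_def)

lemma md_nonneg: "K \<ge> 0 \<Longrightarrow> md K t \<ge> 0"
  by (simp add: md_def cosh_real_ge_1)

text \<open>Hyperbolic addition theorem, with \<open>1 + K * md K t\<close> as the cosine and
  \<open>sn\<close> as the sine; the form polynomial in \<open>K\<close> includes the flat
  case.\<close>

lemma md_add:
  assumes "K \<ge> 0"
  shows "md K (s + t) = md K s + md K t + K * md K s * md K t + sn K s * sn K t"
proof (cases "K = 0")
  case True
  then show ?thesis by (simp add: md_def sn_def power2_eq_square algebra_simps)
next
  case False
  have "sqrt K * sqrt K = K" using assms by simp
  then have "sinh (sqrt K * s) / sqrt K * (sinh (sqrt K * t) / sqrt K) = sinh (sqrt K * s) * sinh (sqrt K * t) / K"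
    by simp
  then show ?thesis using False
    by (simp add: md_def sn_def cosh_add distrib_left) (simp add: field_simps)
qed

lemma md_diff:
  assumes "K \<ge> 0"
  shows "md K (s - t) = md K s + md K t + K * md K s * md K t - sn K s * sn K t"
  using md_add[OF assms, of s "- t"] by simp

lemma sn_sq: "K \<ge> 0 \<Longrightarrow> (sn K t)\<^sup>2 = 2 * md K t + K * (md K t)\<^sup>2"
  using md_diff[of K t t] by (simp add: power2_eq_square)

lemma sn_nonneg: "K \<ge> 0 \<Longrightarrow> t \<ge> 0 \<Longrightarrow> sn K t \<ge> 0"
  by (simp add: sn_def)

lemma md_strict_mono:
  assumes "K \<ge> 0" "0 \<le> s" "s < t"
  shows "md K s < md K t"
proof (cases "K = 0")
  case True
  then show ?thesis using assms by (simp add: md_def power_strict_mono)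
next
  case False
  then have "cosh (sqrt K * s) < cosh (sqrt K * t)"
    using assms by (intro cosh_real_strict_mono) auto
  then show ?thesis using assms False by (simp add: md_def divide_strict_right_mono)
qed

lemma md_le_iff: "K \<ge> 0 \<Longrightarrow> 0 \<le> s \<Longrightarrow> 0 \<le> t \<Longrightarrow> md K s \<le> md K t \<longleftrightarrow> s \<le> t"
  using md_strict_mono[of K s t] md_strict_mono[of K t s] by (cases s t rule: linorder_cases) auto

lemma md_eq_iff: "K \<ge> 0 \<Longrightarrow> 0 \<le> s \<Longrightarrow> 0 \<le> t \<Longrightarrow> md K s = md K t \<longleftrightarrow> s = t"
  using md_le_iff[of K s t] md_le_iff[of K t s] by auto

lemma continuous_md: "continuous_on A (md K)"
  unfolding md_def by (cases "K = 0") (auto intro!: continuous_intros)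

lemma continuous_sn: "continuous_on A (sn K)"
  unfolding sn_def by (cases "K = 0") (auto intro!: continuous_intros)

text \<open>Points on a side are addressed by \<open>sn\<close> instead of arc length because, at a
  fixed angle, the law of cosines is linear in \<open>sn\<close> of the side.\<close>

lemma sn_surj:
  assumes "K \<ge> 0" "0 \<le> l" "0 \<le> \<nu>" "\<nu> \<le> 1"
  shows "\<exists>s\<in>{0..l}. sn K s = \<nu> * sn K l"
proof -
  have "\<nu> * sn K l \<le> 1 * sn K l" using assms sn_nonneg by (intro mult_right_mono) auto
  then have "\<exists>s\<ge>0. s \<le> l \<and> sn K s = \<nu> * sn K l"
    using assms sn_nonneg by (intro IVT' continuous_sn) auto
  then show ?thesis by auto
qed

section \<open>Distances, geodesics and triangles of the model surface\<close>

lemma model_dist_commute: "model_dist \<kappa> z w = model_dist \<kappa> w z"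
  by (simp add: model_dist_def norm_minus_commute mult_ac)

lemma cosh_model_arg:
  assumes "\<kappa> < 0" "z \<in> model_carrier \<kappa>" "w \<in> model_carrier \<kappa>"
  shows "1 \<le> 1 + (cmod (z - w))\<^sup>2 / (2 * Im z * Im w)"
  using assms by (simp add: model_carrier_def)

lemma model_dist_nonneg:
  assumes "\<kappa> \<le> 0" "z \<in> model_carrier \<kappa>" "w \<in> model_carrier \<kappa>"
  shows "model_dist \<kappa> z w \<ge> 0"
  using assms cosh_model_arg[of \<kappa> z w]
  by (cases "\<kappa> = 0") (auto simp: model_dist_def intro!: divide_nonneg_nonneg)

lemma md_model_dist:
  assumes "\<kappa> < 0" "z \<in> model_carrier \<kappa>" "w \<in> model_carrier \<kappa>"
  shows "md (- \<kappa>) (model_dist \<kappa> z w) = (cmod (z - w))\<^sup>2 / (2 * Im z * Im w) / (- \<kappa>)"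
proof -
  have "sqrt (- \<kappa>) * model_dist \<kappa> z w = arcosh (1 + (cmod (z - w))\<^sup>2 / (2 * Im z * Im w))"
    using assms(1) by (simp add: model_dist_def)
  then show ?thesis using cosh_model_arg[OF assms] assms(1) by (simp add: md_def)
qed

lemma model_dist_eqI:
  assumes "\<kappa> < 0" "t \<ge> 0" "cosh (sqrt (- \<kappa>) * t) = 1 + (cmod (z - w))\<^sup>2 / (2 * Im z * Im w)"
  shows "model_dist \<kappa> z w = t"
  using assms by (simp add: model_dist_def arcosh_cosh_real flip: assms(3))

text \<open>Makes \<open>u\<close> an arc length parameter on vertical lines of the half-plane;
  serves the vertical geodesics and the triangle side on the imaginary axis.\<close>

lemma cosh_vertical:
  "cosh (k * \<bar>u - v\<bar>) = 1 + (cmod (Complex c (exp (k * u)) - Complex c (exp (k * v))))\<^sup>2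
    / (2 * exp (k * u) * exp (k * v))"
proof -
  have "cosh (k * \<bar>u - v\<bar>) = cosh (k * u - k * v)"
    by (cases "u \<ge> v") (simp_all add: algebra_simps cosh_diff)
  also have "\<dots> = (exp (k * u) / exp (k * v) + exp (k * v) / exp (k * u)) / 2"
    by (simp add: cosh_def exp_diff)
  also have "\<dots> = 1 + (exp (k * u) - exp (k * v))\<^sup>2 / (2 * exp (k * u) * exp (k * v))"
    by (simp add: field_simps power2_eq_square)
  finally show ?thesis unfolding cmod_power2 by simp
qed

text \<open>A segment of an isometrically embedded line is a geodesic; \<open>sgn (v - u)\<close>
  sets the direction of travel.\<close>

lemma geodesic_in_line:
  assumes P: "\<And>u. P u \<in> S" "\<And>u v. d (P u) (P v) = \<bar>u - v\<bar>"
  shows "\<exists>h. geodesic_in S d h (P u) (P v)"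
proof (intro exI[of _ "\<lambda>s. P (u + sgn (v - u) * s)"])
  have "\<bar>sgn (v - u) * s - sgn (v - u) * t\<bar> = \<bar>s - t\<bar>"
    if "0 \<le> s" "s \<le> \<bar>u - v\<bar>" "0 \<le> t" "t \<le> \<bar>u - v\<bar>" for s t
    using that by (auto simp: sgn_if abs_if)
  moreover have "u + sgn (v - u) * \<bar>u - v\<bar> = v" by (simp add: sgn_if abs_if)
  ultimately show "geodesic_in S d (\<lambda>s. P (u + sgn (v - u) * s)) (P u) (P v)"
    using P by (auto simp: geodesic_in_def)
qed

lemma model_geodesic_exists:
  assumes \<kappa>: "\<kappa> \<le> 0" and zw: "z \<in> model_carrier \<kappa>" "w \<in> model_carrier \<kappa>"
  shows "\<exists>h. geodesic_in (model_carrier \<kappa>) (model_dist \<kappa>) h z w"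
proof -
  consider "\<kappa> = 0" | "\<kappa> < 0" "Re z = Re w" | "\<kappa> < 0" "Re z \<noteq> Re w" using \<kappa> by linarith
  then show ?thesis
  proof cases
    case 1
    \<comment> \<open>\<open>sgn 0 = 0\<close>, so the value 1 for \<open>z = w\<close> is needed
      for \<open>P\<close> to have unit speed.\<close>
    define e where "e = (if z = w then 1 else sgn (w - z))"
    have e: "cmod e = 1" by (simp add: e_def norm_sgn)
    define P where "P = (\<lambda>u. z + of_real u * e)"
    have "\<exists>h. geodesic_in (model_carrier \<kappa>) (model_dist \<kappa>) h (P 0) (P (cmod (w - z)))"
    proof (rule geodesic_in_line)
      fix u v :: real
      have "P u - P v = of_real (u - v) * e" by (simp add: P_def algebra_simps)
      then show "model_dist \<kappa> (P u) (P v) = \<bar>u - v\<bar>"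
        unfolding model_dist_def using 1 e by (simp add: norm_mult del: of_real_diff)
    qed (use 1 in \<open>auto simp: model_carrier_def\<close>)
    moreover have "P (cmod (w - z)) = w"
      by (simp add: P_def e_def sgn_div_norm scaleR_conv_of_real flip: mult.assoc)
    ultimately show ?thesis by (simp add: P_def)
  next
    case 2
    define k where "k = sqrt (- \<kappa>)"
    have k: "k > 0" using 2 by (simp add: k_def)
    define P where "P = (\<lambda>u. Complex (Re z) (exp (k * u)))"
    have pos: "Im z > 0" "Im w > 0" using zw 2 by (auto simp: model_carrier_def)
    have "\<exists>h. geodesic_in (model_carrier \<kappa>) (model_dist \<kappa>) h (P (ln (Im z) / k)) (P (ln (Im w) / k))"
    proof (rule geodesic_in_line)
      fix u v :: real
      show "P u \<in> model_carrier \<kappa>" using 2 by (simp add: P_def model_carrier_def)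
      show "model_dist \<kappa> (P u) (P v) = \<bar>u - v\<bar>"
      proof (rule model_dist_eqI)
        show "cosh (sqrt (- \<kappa>) * \<bar>u - v\<bar>) = 1 + (cmod (P u - P v))\<^sup>2 / (2 * Im (P u) * Im (P v))"
          unfolding k_def[symmetric] P_def complex.sel by (rule cosh_vertical)
      qed (use 2 in auto)
    qed
    moreover have "P (ln (Im z) / k) = z" "P (ln (Im w) / k) = w"
      using k pos 2 by (simp_all add: P_def complex_eq_iff)
    ultimately show ?thesis by simp
  next
    case 3
    define k where "k = sqrt (- \<kappa>)"
    have k: "k > 0" using 3 by (simp add: k_def)
    have pos: "Im z > 0" "Im w > 0" using zw 3 by (auto simp: model_carrier_def)
    \<comment> \<open>The geodesic is a semicircle centred on the real axis; \<open>m\<close> is the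
      real point equidistant from \<open>z\<close> and \<open>w\<close> in the Euclidean
      sense.\<close>
    define m where "m = ((cmod w)\<^sup>2 - (cmod z)\<^sup>2) / (2 * (Re w - Re z))"
    define R where "R = sqrt ((Re z - m)\<^sup>2 + (Im z)\<^sup>2)"
    have R: "R > 0" using pos by (simp add: R_def add_nonneg_pos)
    have R2: "R\<^sup>2 = (Re z - m)\<^sup>2 + (Im z)\<^sup>2" by (simp add: R_def)
    have "m * (2 * (Re w - Re z)) = (cmod w)\<^sup>2 - (cmod z)\<^sup>2"
      by (rule iffD1[OF nonzero_eq_divide_eq m_def]) (use 3 in simp)
    then have R2': "R\<^sup>2 = (Re w - m)\<^sup>2 + (Im w)\<^sup>2"
      unfolding R2 cmod_power2 by (simp add: power2_eq_square algebra_simps)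
    \<comment> \<open>Arc length parametrisation of the semicircle. The ratio of
      \<open>Re x - m\<close> to \<open>Im x\<close> is \<open>sinh (k * u)\<close>, which gives the
      parameter of a point.\<close>
    define P where "P = (\<lambda>u. Complex (m + R * tanh (k * u)) (R / cosh (k * u)))"
    have onP: "P (arsinh ((Re x - m) / Im x) / k) = x" if x: "Im x > 0" "R\<^sup>2 = (Re x - m)\<^sup>2 + (Im x)\<^sup>2" for x
    proof -
      have "1 + ((Re x - m) / Im x)\<^sup>2 = (R / Im x)\<^sup>2"
        using x by (simp add: power_divide field_simps)
      then have ch: "cosh (arsinh ((Re x - m) / Im x)) = R / Im x"
        using x(1) R by (simp add: cosh_arsinh_real add.commute)
      show ?thesis using k x(1) R
        by (simp add: P_def complex_eq_iff ch tanh_def)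
    qed
    have "\<exists>h. geodesic_in (model_carrier \<kappa>) (model_dist \<kappa>) h
        (P (arsinh ((Re z - m) / Im z) / k)) (P (arsinh ((Re w - m) / Im w) / k))"
    proof (rule geodesic_in_line)
      fix u v :: real
      show "P u \<in> model_carrier \<kappa>" using 3 R by (simp add: P_def model_carrier_def)
      show "model_dist \<kappa> (P u) (P v) = \<bar>u - v\<bar>"
      proof (rule model_dist_eqI)
        define C S where "C = (\<lambda>u. cosh (k * u))" and "S = (\<lambda>u. sinh (k * u))"
        have CS: "(C u)\<^sup>2 = 1 + (S u)\<^sup>2" "C u > 0" for u
          by (simp_all add: C_def S_def cosh_square_eq)
        have nz: "C u \<noteq> 0" for u using CS(2)[of u] by simp
        have "cosh (k * \<bar>u - v\<bar>) = cosh (k * u - k * v)"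
          by (cases "u \<ge> v") (simp_all add: algebra_simps cosh_diff)
        then have 1: "cosh (k * \<bar>u - v\<bar>) = C u * C v - S u * S v" by (simp add: cosh_diff C_def S_def)
        have "(cmod (P u - P v))\<^sup>2 / (2 * Im (P u) * Im (P v))
            = ((R * (S u / C u) - R * (S v / C v))\<^sup>2 + (R / C u - R / C v)\<^sup>2) / (2 * (R / C u) * (R / C v))"
          by (simp add: P_def cmod_power2 tanh_def C_def S_def)
        also have "\<dots> = ((S u * C v - S v * C u)\<^sup>2 + (C v - C u)\<^sup>2) / (2 * C u * C v)"
          using nz R by (simp add: field_simps power2_eq_square)
        also have "(S u * C v - S v * C u)\<^sup>2 + (C v - C u)\<^sup>2 = 2 * C u * C v * (C u * C v - S u * S v - 1)"
          using CS(1)[of u] CS(1)[of v] by algebra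
        finally show "cosh (sqrt (- \<kappa>) * \<bar>u - v\<bar>) = 1 + (cmod (P u - P v))\<^sup>2 / (2 * Im (P u) * Im (P v))"
          unfolding k_def[symmetric] 1 using nz by simp
      qed (use 3 in auto)
    qed
    then show ?thesis using onP[of z] onP[of w] R2 R2' pos by simp
  qed
qed

text \<open>The side from \<open>p\<close> to \<open>z\<close> is placed on the imaginary axis: the hyperbolic cosine of the rescaled distance from
  \<open>y\<close> to the point \<open>exp (k * s) * \<i>\<close> is \<open>\<alpha> * exp (- k * s) + \<beta> * exp (k * s)\<close>.\<close>
lemma model_triangle_hyperbolic:
  assumes \<kappa>: "\<kappa> < 0" and l: "l > 0" and tri: "\<bar>a - l\<bar> \<le> b" "b \<le> a + l" and a: "a \<ge> 0"
  shows "\<exists>p z y h. p \<in> model_carrier \<kappa> \<and> z \<in> model_carrier \<kappa> \<and> y \<in> model_carrier \<kappa> \<and>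
    model_dist \<kappa> p z = l \<and> model_dist \<kappa> z y = b \<and> model_dist \<kappa> y p = a \<and>
    geodesic_in (model_carrier \<kappa>) (model_dist \<kappa>) h p z \<and>
    (\<forall>s\<in>{0..l}. sn (- \<kappa>) l * (md (- \<kappa>) s + md (- \<kappa>) a + (- \<kappa>) * md (- \<kappa>) s * md (- \<kappa>) a
        - md (- \<kappa>) (model_dist \<kappa> (h s) y))
      = sn (- \<kappa>) s * (md (- \<kappa>) l + md (- \<kappa>) a + (- \<kappa>) * md (- \<kappa>) l * md (- \<kappa>) a - md (- \<kappa>) b))"
proof -
  define k where "k = sqrt (- \<kappa>)"
  have k: "k > 0" using \<kappa> by (simp add: k_def)
  have k2: "k * k = - \<kappa>" using \<kappa> by (simp add: k_def)
  have b: "b \<ge> 0" using tri by linarith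
  have sl: "sinh (k * l) > 0" using k l by simp
  \<comment> \<open>\<alpha> and \<beta> solve the linear system that prescribes the distances
    \<open>a\<close> at \<open>s = 0\<close> and \<open>b\<close> at \<open>s = l\<close>, stated as
    \<open>ca\<close> and \<open>cb\<close>.\<close>
  define \<beta> where "\<beta> = (cosh (k * b) - exp (- (k * l)) * cosh (k * a)) / (2 * sinh (k * l))"
  define \<alpha> where "\<alpha> = cosh (k * a) - \<beta>"
  have sl2: "2 * sinh (k * l) = exp (k * l) - exp (- (k * l))" by (simp add: sinh_def)
  have ca: "\<alpha> + \<beta> = cosh (k * a)" by (simp add: \<alpha>_def)
  have cb: "\<alpha> * exp (- (k * l)) + \<beta> * exp (k * l) = cosh (k * b)"
  proof -
    have "\<beta> * (2 * sinh (k * l)) = cosh (k * b) - exp (- (k * l)) * cosh (k * a)"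
      using sl by (intro iffD1[OF nonzero_eq_divide_eq \<beta>_def]) linarith
    then show ?thesis unfolding sl2 \<alpha>_def by (simp add: algebra_simps)
  qed
  \<comment> \<open>The triangle inequalities confine \<beta> to the interval between
    \<open>exp (- (k * a)) / 2\<close> and \<open>exp (k * a) / 2\<close>. Its ends are the roots of
    \<open>4 * \<alpha> * \<beta> = 1\<close> for the given sum \<alpha> + \<beta>, so
    \<open>ab\<close> holds, and this makes \<open>x\<close> below a real number.\<close>
  have lo: "exp (- (k * a)) / 2 \<le> \<beta>"
  proof -
    have "cosh (k * \<bar>a - l\<bar>) \<le> cosh (k * b)"
      using k tri by (subst cosh_real_nonneg_le_iff) auto
    moreover have "cosh (k * \<bar>a - l\<bar>) = cosh (k * a - k * l)"
      by (cases "a \<ge> l") (simp_all add: algebra_simps cosh_diff)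
    moreover have "cosh (k * a - k * l) - exp (- (k * l)) * cosh (k * a) = (exp (- (k * a)) / 2) * (2 * sinh (k * l))"
      unfolding cosh_diff cosh_minus_sinh[symmetric] by (simp add: algebra_simps)
    ultimately show ?thesis using sl by (simp add: \<beta>_def pos_le_divide_eq)
  qed
  have up: "\<beta> \<le> exp (k * a) / 2"
  proof -
    have "cosh (k * b) \<le> cosh (k * (a + l))"
      using k tri b by (subst cosh_real_nonneg_le_iff) auto
    moreover have "cosh (k * (a + l)) - exp (- (k * l)) * cosh (k * a) = (exp (k * a) / 2) * (2 * sinh (k * l))"
      unfolding distrib_left cosh_add cosh_minus_sinh[symmetric] cosh_plus_sinh[symmetric]
      by (simp add: algebra_simps)
    ultimately show ?thesis using sl by (simp add: \<beta>_def pos_divide_le_eq)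
  qed
  have \<beta>: "\<beta> > 0" using lo by (smt (verit) exp_gt_zero half_gt_zero)
  have "0 \<le> (\<beta> - exp (- (k * a)) / 2) * (exp (k * a) / 2 - \<beta>)" using lo up by simp
  also have "\<dots> = \<alpha> * \<beta> - 1 / 4"
    by (simp add: \<alpha>_def cosh_def exp_minus field_simps)
  finally have ab: "4 * (\<alpha> * \<beta>) \<ge> 1" by simp
  \<comment> \<open>For \<open>y = Complex x t\<close> the distance formula has the coefficient
    \<open>1 / (2 * t)\<close> at \<open>exp (k * s)\<close> and the sum of the squares of
    \<open>x\<close> and \<open>t\<close>, divided by \<open>2 * t\<close>, at
    \<open>exp (- (k * s))\<close>. Matching them with \<beta> and \<alpha> determines
    \<open>t\<close> and \<open>x\<close>.\<close>
  define t where "t = 1 / (2 * \<beta>)"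
  have t: "t > 0" using \<beta> by (simp add: t_def)
  define x where "x = sqrt (2 * t * \<alpha> - t\<^sup>2)"
  have "2 * t * \<alpha> - t\<^sup>2 = (4 * (\<alpha> * \<beta>) - 1) * t\<^sup>2"
    using \<beta> by (simp add: t_def power2_eq_square field_simps)
  then have x2: "x\<^sup>2 = 2 * t * \<alpha> - t\<^sup>2" using ab by (simp add: x_def)
  define y where "y = Complex x t"
  define h where "h = (\<lambda>s. Complex 0 (exp (k * s)))"
  have carr: "h s \<in> model_carrier \<kappa>" "y \<in> model_carrier \<kappa>" for s
    using \<kappa> t by (auto simp: model_carrier_def y_def h_def)
  have hy: "(cmod (h s - y))\<^sup>2 / (2 * Im (h s) * Im y) = \<alpha> * exp (- (k * s)) + \<beta> * exp (k * s) - 1" for s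
  proof -
    have "(cmod (h s - y))\<^sup>2 = 2 * exp (k * s) * t * (\<alpha> * exp (- (k * s)) + \<beta> * exp (k * s) - 1)"
    proof -
      have "(cmod (h s - y))\<^sup>2 = 2 * t * \<alpha> - 2 * t * exp (k * s) + exp (k * s) * exp (k * s)"
        unfolding cmod_power2 h_def y_def using x2 by (simp add: power2_eq_square algebra_simps)
      also have "\<dots> = 2 * exp (k * s) * t * (\<alpha> * exp (- (k * s)) + \<beta> * exp (k * s) - 1)"
        using \<beta> by (simp add: t_def exp_minus field_simps)
      finally show ?thesis .
    qed
    then show ?thesis using t by (simp add: h_def y_def)
  qed
  have hh: "model_dist \<kappa> (h u) (h v) = \<bar>u - v\<bar>" for u v
  proof (rule model_dist_eqI)
    show "cosh (sqrt (- \<kappa>) * \<bar>u - v\<bar>) = 1 + (cmod (h u - h v))\<^sup>2 / (2 * Im (h u) * Im (h v))"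
      unfolding k_def[symmetric] h_def complex.sel by (rule cosh_vertical)
  qed (use \<kappa> in auto)
  have "model_dist \<kappa> (h l) y = b" "model_dist \<kappa> (h 0) y = a"
    using \<kappa> a b hy[of l] hy[of 0] ca cb by (auto intro!: model_dist_eqI simp flip: k_def)
  moreover have "geodesic_in (model_carrier \<kappa>) (model_dist \<kappa>) h (h 0) (h l)"
    using carr hh l by (auto simp: geodesic_in_def)
  moreover have "sn (- \<kappa>) l * (md (- \<kappa>) s + md (- \<kappa>) a + (- \<kappa>) * md (- \<kappa>) s * md (- \<kappa>) a
        - md (- \<kappa>) (model_dist \<kappa> (h s) y))
      = sn (- \<kappa>) s * (md (- \<kappa>) l + md (- \<kappa>) a + (- \<kappa>) * md (- \<kappa>) l * md (- \<kappa>) a - md (- \<kappa>) b)" for s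
  proof -
    define c where "c = 1 / (k * k)"
    have mdc: "md (- \<kappa>) r = (cosh (k * r) - 1) * c" and snc: "sn (- \<kappa>) r = sinh (k * r) / k" for r
      using \<kappa> by (simp_all add: md_def sn_def k_def c_def)
    have hyc: "md (- \<kappa>) (model_dist \<kappa> (h s) y) = (\<alpha> * exp (- (k * s)) + \<beta> * exp (k * s) - 1) * c"
      unfolding md_model_dist[OF \<kappa> carr] hy c_def k2 by simp
    have kc: "- \<kappa> * c * c = c" using k2 k by (simp add: c_def flip: k2)
    have split: "(u - 1) * c + (v - 1) * c + - \<kappa> * ((u - 1) * c) * ((v - 1) * c) - (w - 1) * c = (u * v - w) * c" for u v w
    proof -
      have "- \<kappa> * ((u - 1) * c) * ((v - 1) * c) = (u - 1) * (v - 1) * (- \<kappa> * c * c)" by simp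
      then show ?thesis unfolding kc by (simp add: algebra_simps)
    qed
    \<comment> \<open>The factor \<alpha> - \<beta> does not depend on \<open>r\<close>: it is
      \<open>sinh (k * a)\<close> times the cosine of the angle at \<open>h 0\<close>, which all
      points of the side share.\<close>
    have id: "cosh (k * r) * (\<alpha> + \<beta>) - (\<alpha> * exp (- (k * r)) + \<beta> * exp (k * r)) = sinh (k * r) * (\<alpha> - \<beta>)" for r
      by (simp add: cosh_def sinh_def field_simps)
    show ?thesis
      unfolding hyc unfolding mdc snc split ca[symmetric] cb[symmetric] id by simp
  qed
  ultimately show ?thesis
    using carr hh[of 0 l] l
    by (intro exI[of _ "h 0"] exI[of _ "h l"] exI[of _ y] exI[of _ h]) (auto simp: model_dist_commute)
qed

lemma model_triangle_flat:
  assumes l: "l > 0" and tri: "\<bar>a - l\<bar> \<le> b" "b \<le> a + l" and a: "a \<ge> 0"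
  shows "\<exists>p z y h. p \<in> model_carrier 0 \<and> z \<in> model_carrier 0 \<and> y \<in> model_carrier 0 \<and>
    model_dist 0 p z = l \<and> model_dist 0 z y = b \<and> model_dist 0 y p = a \<and>
    geodesic_in (model_carrier 0) (model_dist 0) h p z \<and>
    (\<forall>s\<in>{0..l}. sn 0 l * (md 0 s + md 0 a - md 0 (model_dist 0 (h s) y))
      = sn 0 s * (md 0 l + md 0 a - md 0 b))"
proof -
  \<comment> \<open>Abscissa of \<open>y\<close> by the law of cosines, with the side
    \<open>l\<close> on the real axis; its bound by \<open>a\<close> makes the ordinate
    real.\<close>
  define \<xi> where "\<xi> = (a\<^sup>2 + l\<^sup>2 - b\<^sup>2) / (2 * l)"
  have \<xi>: "2 * l * \<xi> = a\<^sup>2 + l\<^sup>2 - b\<^sup>2" using l by (simp add: \<xi>_def)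
  have "(a - l)\<^sup>2 \<le> b\<^sup>2" "b\<^sup>2 \<le> (a + l)\<^sup>2"
    using tri by (simp_all flip: abs_le_square_iff)
  then have "2 * l * \<xi> \<le> 2 * l * a" "2 * l * (- a) \<le> 2 * l * \<xi>"
    unfolding \<xi> power2_diff power2_sum by (simp_all add: algebra_simps)
  from this[THEN mult_left_le_imp_le] have "\<xi> \<le> a" "- a \<le> \<xi>" using l by auto
  then have "\<bar>\<xi>\<bar> \<le> \<bar>a\<bar>" using a by linarith
  then have \<xi>a: "\<xi>\<^sup>2 \<le> a\<^sup>2" by (simp add: abs_le_square_iff)
  define y where "y = Complex \<xi> (sqrt (a\<^sup>2 - \<xi>\<^sup>2))"
  define h where "h = (\<lambda>s::real. complex_of_real s)"
  have hy: "(cmod (h s - y))\<^sup>2 = a\<^sup>2 - 2 * s * \<xi> + s\<^sup>2" for s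
    unfolding cmod_power2 h_def y_def using \<xi>a by (simp add: power2_eq_square algebra_simps)
  have "(cmod (h l - y))\<^sup>2 = b\<^sup>2" "(cmod (h 0 - y))\<^sup>2 = a\<^sup>2" unfolding hy using \<xi> by simp_all
  then have hly: "cmod (h l - y) = b" "cmod (h 0 - y) = a"
    using tri a by (auto intro: power2_eq_imp_eq)
  have hh: "cmod (h s - h t) = \<bar>s - t\<bar>" for s t
    unfolding h_def of_real_diff[symmetric] by (rule norm_of_real)
  have "geodesic_in (model_carrier 0) (model_dist 0) h (h 0) (h l)"
    using l by (auto simp: geodesic_in_def model_carrier_def model_dist_def hh)
  moreover have "sn 0 l * (md 0 s + md 0 a - md 0 (model_dist 0 (h s) y)) = sn 0 s * (md 0 l + md 0 a - md 0 b)" for s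
  proof -
    have "l * (s\<^sup>2 + a\<^sup>2 - (a\<^sup>2 - 2 * s * \<xi> + s\<^sup>2)) = s * (2 * l * \<xi>)" by simp
    also have "\<dots> = s * (l\<^sup>2 + a\<^sup>2 - b\<^sup>2)" unfolding \<xi> by simp
    finally show ?thesis unfolding sn_def md_def model_dist_def by (simp add: hy field_simps)
  qed
  moreover have "cmod (h 0 - h l) = l" using l by (simp add: hh)
  ultimately show ?thesis using hly
    by (intro exI[of _ "h 0"] exI[of _ "h l"] exI[of _ y] exI[of _ h])
      (auto simp: model_carrier_def model_dist_def norm_minus_commute)
qed

text \<open>The law of cosines solved for the angle term: in the model plane this is
  \<open>sn\<close> of one side times \<open>sn\<close> of the other times the cosine of the angle
  at \<open>p\<close>.\<close>

definition gip :: "real \<Rightarrow> 'a::metric_space \<Rightarrow> 'a \<Rightarrow> 'a \<Rightarrow> real" where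
  "gip K p x y = md K (dist p x) + md K (dist p y) + K * md K (dist p x) * md K (dist p y) - md K (dist x y)"

lemma sqrt_md: "K \<ge> 0 \<Longrightarrow> t \<ge> 0 \<Longrightarrow> sqrt (2 * md K t + K * (md K t)\<^sup>2) = sn K t"
  using sn_sq[of K t, symmetric] sn_nonneg[of K t] by simp

text \<open>The triangle inequality says that the cosine of a comparison angle is at least
  -1.\<close>

lemma gip_lower:
  assumes "K \<ge> 0"
  shows "- sn K (dist p x) * sn K (dist p y) \<le> gip K p x y"
proof -
  have "md K (dist x y) \<le> md K (dist p x + dist p y)"
    using assms dist_triangle3[of x y p] by (simp add: md_le_iff)
  then show ?thesis using assms by (simp add: gip_def md_add)
qed

lemma model_triangle:
  assumes "\<kappa> \<le> 0" "l > 0" "\<bar>a - l\<bar> \<le> b" "b \<le> a + l" "a \<ge> 0"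
  shows "\<exists>p z y h. p \<in> model_carrier \<kappa> \<and> z \<in> model_carrier \<kappa> \<and> y \<in> model_carrier \<kappa> \<and>
    model_dist \<kappa> p z = l \<and> model_dist \<kappa> z y = b \<and> model_dist \<kappa> y p = a \<and>
    geodesic_in (model_carrier \<kappa>) (model_dist \<kappa>) h p z \<and>
    (\<forall>s\<in>{0..l}. sn (- \<kappa>) l * (md (- \<kappa>) s + md (- \<kappa>) a + (- \<kappa>) * md (- \<kappa>) s * md (- \<kappa>) a
        - md (- \<kappa>) (model_dist \<kappa> (h s) y))
      = sn (- \<kappa>) s * (md (- \<kappa>) l + md (- \<kappa>) a + (- \<kappa>) * md (- \<kappa>) l * md (- \<kappa>) a - md (- \<kappa>) b))"
  using model_triangle_hyperbolic[of \<kappa> l a b] model_triangle_flat[of l a b] assms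
  by (cases "\<kappa> = 0") auto

text \<open>\<open>D\<close> is the model distance from the point at \<open>s\<close> to the third
  vertex; the equation expresses that the angle at \<open>p\<close> in the model triangle does not
  depend on \<open>s\<close>. The relation \<open>R\<close> lets one proof serve both curvature
  bounds, and its reflexivity settles the degenerate side.\<close>

lemma comparison:
  fixes p z y :: "'a::metric_space"
  assumes \<kappa>: "\<kappa> \<le> 0" and gs: "geodesic_space (UNIV :: 'a set) dist"
    and tc: "triangle_comparison R \<kappa> (UNIV :: 'a set) dist" and R: "\<And>x. R x x"
    and \<gamma>: "geodesic_in UNIV dist \<gamma> p z" and s: "s \<in> {0..dist p z}"
  obtains D where "D \<ge> 0" "R (dist (\<gamma> s) y) D"
    "sn (- \<kappa>) (dist p z) * (md (- \<kappa>) s + md (- \<kappa>) (dist p y) + (- \<kappa>) * md (- \<kappa>) s * md (- \<kappa>) (dist p y) - md (- \<kappa>) D)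
      = sn (- \<kappa>) s * gip (- \<kappa>) p z y"
proof (cases "dist p z = 0")
  case True
  then have "\<gamma> s = p" "s = 0" using \<gamma> s by (auto simp: geodesic_in_def)
  then show ?thesis using that[of "dist p y"] R True by simp
next
  case False
  then have l: "dist p z > 0" by simp
  have "\<bar>dist p y - dist p z\<bar> \<le> dist z y" "dist z y \<le> dist p y + dist p z"
    using dist_triangle[of p y z] dist_triangle[of p z y] dist_triangle3[of z y p]
    by (auto simp: dist_commute abs_le_iff)
  from model_triangle[OF \<kappa> l this] obtain p' z' y' h where c: "p' \<in> model_carrier \<kappa>"
    "z' \<in> model_carrier \<kappa>" "y' \<in> model_carrier \<kappa>"
    and d: "model_dist \<kappa> p' z' = dist p z" "model_dist \<kappa> z' y' = dist z y" "model_dist \<kappa> y' p' = dist p y"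
    and h: "geodesic_in (model_carrier \<kappa>) (model_dist \<kappa>) h p' z'"
    and eq: "\<And>s. s \<in> {0..dist p z} \<Longrightarrow> sn (- \<kappa>) (dist p z) * (md (- \<kappa>) s + md (- \<kappa>) (dist p y)
        + (- \<kappa>) * md (- \<kappa>) s * md (- \<kappa>) (dist p y) - md (- \<kappa>) (model_dist \<kappa> (h s) y'))
      = sn (- \<kappa>) s * gip (- \<kappa>) p z y"
    unfolding gip_def by auto
  obtain h2 where h2: "geodesic_in (model_carrier \<kappa>) (model_dist \<kappa>) h2 z' y'"
    using model_geodesic_exists[OF \<kappa> c(2,3)] by blast
  obtain h3 where h3: "geodesic_in (model_carrier \<kappa>) (model_dist \<kappa>) h3 y' p'"
    using model_geodesic_exists[OF \<kappa> c(3,1)] by blast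
  obtain g2 where g2: "geodesic_in UNIV dist g2 z y" using gs by (auto simp: geodesic_space_def)
  obtain g3 where g3: "geodesic_in UNIV dist g3 y p" using gs by (auto simp: geodesic_space_def)
  \<comment> \<open>The vertex \<open>y\<close> enters as the endpoint of the second side, at
    parameter \<open>dist z y\<close>.\<close>
  have "R (dist (\<gamma> s) (g2 (dist z y))) (model_dist \<kappa> (h s) (h2 (dist z y)))"
    using tc[unfolded triangle_comparison_def, THEN spec[of _ p], THEN spec[of _ z], THEN spec[of _ y],
        THEN spec[of _ \<gamma>], THEN spec[of _ g2], THEN spec[of _ g3], THEN spec[of _ p'], THEN spec[of _ z'],
        THEN spec[of _ y'], THEN spec[of _ h], THEN spec[of _ h2], THEN spec[of _ h3]]
      \<gamma> g2 g3 c d h h2 h3 s by (simp add: dist_commute)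
  moreover have "g2 (dist z y) = y" "h2 (dist z y) = y'"
    using g2 h2 d by (auto simp: geodesic_in_def)
  moreover have "h s \<in> model_carrier \<kappa>" using h s d by (auto simp: geodesic_in_def)
  ultimately show ?thesis
    using that[of "model_dist \<kappa> (h s) y'"] eq[OF s] model_dist_nonneg[OF \<kappa> _ c(3)] by simp
qed

text \<open>\<open>w\<close> lies on a geodesic from \<open>p\<close> to \<open>z\<close>. In the
  model the inner product with \<open>y\<close> would scale exactly by \<nu>; distances at least as
  large as in the model can only lower it. Between \<open>w\<close> and \<open>z\<close> the angle
  is zero, hence the equation.\<close>

lemma CBB_contract:
  fixes p z :: "'a::metric_space"
  assumes \<kappa>: "\<kappa> \<le> 0" and X: "CBB \<kappa> (UNIV :: 'a set) dist" and \<nu>: "0 \<le> \<nu>" "\<nu> \<le> 1"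
  defines "K \<equiv> - \<kappa>"
  shows "\<exists>w. sn K (dist p w) = \<nu> * sn K (dist p z) \<and> gip K p w z = \<nu> * (sn K (dist p z))\<^sup>2 \<and>
    (\<forall>y. gip K p w y \<le> \<nu> * gip K p z y)"
proof -
  have K: "K \<ge> 0" using \<kappa> by (simp add: K_def)
  obtain \<gamma> where \<gamma>: "geodesic_in UNIV dist \<gamma> p z"
    using X by (auto simp: CBB_def geodesic_space_def)
  obtain s where s: "s \<in> {0..dist p z}" "sn K s = \<nu> * sn K (dist p z)"
    using sn_surj[OF K zero_le_dist \<nu>] by blast
  have dw: "dist p (\<gamma> s) = s" "dist (\<gamma> s) z = dist p z - s"
  proof -
    have "\<forall>s\<in>{0..dist p z}. \<forall>t\<in>{0..dist p z}. dist (\<gamma> s) (\<gamma> t) = \<bar>s - t\<bar>"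
      using \<gamma> unfolding geodesic_in_def by blast
    from this[rule_format, of 0 s] this[rule_format, of s "dist p z"]
    have "dist (\<gamma> 0) (\<gamma> s) = \<bar>0 - s\<bar>" "dist (\<gamma> s) (\<gamma> (dist p z)) = \<bar>s - dist p z\<bar>"
      using s by auto
    moreover have e: "\<gamma> 0 = p" "\<gamma> (dist p z) = z" using \<gamma> by (auto simp: geodesic_in_def)
    ultimately show "dist p (\<gamma> s) = s" "dist (\<gamma> s) z = dist p z - s" using s unfolding e by auto
  qed
  have "gip K p (\<gamma> s) y \<le> \<nu> * gip K p z y" for y
  proof (cases "dist p z = 0")
    case True
    then have "\<gamma> s = p" "z = p" using \<gamma> s by (auto simp: geodesic_in_def)
    then show ?thesis by (simp add: gip_def)
  next
    case False
    then have "sn K 0 < sn K (dist p z)" using K by (auto simp: sn_def)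
    then have pos: "sn K (dist p z) > 0" by simp
    obtain D where D: "D \<ge> 0" "dist (\<gamma> s) y \<ge> D"
      "sn K (dist p z) * (md K s + md K (dist p y) + K * md K s * md K (dist p y) - md K D) = sn K s * gip K p z y"
      using comparison[OF \<kappa> _ _ _ \<gamma> s(1), of "(\<ge>)" y] X unfolding CBB_def K_def by auto
    have "md K D \<le> md K (dist (\<gamma> s) y)" using D K by (simp add: md_le_iff)
    then have "gip K p (\<gamma> s) y \<le> md K s + md K (dist p y) + K * md K s * md K (dist p y) - md K D"
      unfolding gip_def dw by simp
    then have "sn K (dist p z) * gip K p (\<gamma> s) y \<le> sn K (dist p z) * (\<nu> * gip K p z y)"
      using D(3) pos s(2) by (smt (verit) mult.assoc mult.commute mult_left_mono)
    then show ?thesis using pos by simp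
  qed
  moreover have "gip K p (\<gamma> s) z = \<nu> * (sn K (dist p z))\<^sup>2"
    unfolding gip_def dw using md_diff[OF K, of "dist p z" s] s(2)
    by (simp add: power2_eq_square mult_ac)
  ultimately show ?thesis using s(2) dw by (intro exI[of _ "\<gamma> s"]) auto
qed

text \<open>Same point as in \<open>CBB_contract\<close>; distances at most as large as in the model
  raise the inner product.\<close>

lemma CAT_expand:
  fixes p z :: "'a::metric_space"
  assumes \<kappa>: "\<kappa> \<le> 0" and X: "CAT \<kappa> (UNIV :: 'a set) dist" and \<nu>: "0 \<le> \<nu>" "\<nu> \<le> 1"
  defines "K \<equiv> - \<kappa>"
  shows "\<exists>w. sn K (dist p w) = \<nu> * sn K (dist p z) \<and> (\<forall>y. \<nu> * gip K p z y \<le> gip K p w y)"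
proof -
  have K: "K \<ge> 0" using \<kappa> by (simp add: K_def)
  obtain \<gamma> where \<gamma>: "geodesic_in UNIV dist \<gamma> p z"
    using X by (auto simp: CAT_def geodesic_space_def)
  obtain s where s: "s \<in> {0..dist p z}" "sn K s = \<nu> * sn K (dist p z)"
    using sn_surj[OF K zero_le_dist \<nu>] by blast
  have dw: "dist p (\<gamma> s) = s"
    using \<gamma> s by (auto simp: geodesic_in_def)
  have "\<nu> * gip K p z y \<le> gip K p (\<gamma> s) y" for y
  proof (cases "dist p z = 0")
    case True
    then have "\<gamma> s = p" "z = p" using \<gamma> s by (auto simp: geodesic_in_def)
    then show ?thesis by (simp add: gip_def)
  next
    case False
    then have "sn K 0 < sn K (dist p z)" using K by (auto simp: sn_def)
    then have pos: "sn K (dist p z) > 0" by simp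
    obtain D where D: "D \<ge> 0" "dist (\<gamma> s) y \<le> D"
      "sn K (dist p z) * (md K s + md K (dist p y) + K * md K s * md K (dist p y) - md K D) = sn K s * gip K p z y"
      using comparison[OF \<kappa> _ _ _ \<gamma> s(1), of "(\<le>)" y] X unfolding CAT_def K_def by auto
    have "md K (dist (\<gamma> s) y) \<le> md K D" using D K by (simp add: md_le_iff)
    then have "md K s + md K (dist p y) + K * md K s * md K (dist p y) - md K D \<le> gip K p (\<gamma> s) y"
      unfolding gip_def dw by simp
    then have "sn K (dist p z) * (\<nu> * gip K p z y) \<le> sn K (dist p z) * gip K p (\<gamma> s) y"
      using D(3) pos s(2) by (smt (verit) mult.assoc mult.commute mult_left_mono)
    then show ?thesis using pos by simp
  qed
  then show ?thesis using s(2) dw by (intro exI[of _ "\<gamma> s"]) auto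
qed

section \<open>The CN inequality from curvature bounded above\<close>

lemma power_sum_mono_spread:
  fixes x y u v :: real
  assumes "x + y = u + v" "u \<le> x" "v \<le> x" "0 \<le> y" "0 \<le> u" "0 \<le> v"
  shows "u ^ n + v ^ n \<le> x ^ n + y ^ n"
proof -
  \<comment> \<open>The hypotheses give \<open>x - u = v - y\<close>, \<open>y \<le> u\<close> and
    \<open>v \<le> x\<close>, so the factored differences of powers compare term by term.\<close>
  have "(v - y) * (\<Sum>i<n. y ^ (n - Suc i) * v ^ i) \<le> (x - u) * (\<Sum>i<n. u ^ (n - Suc i) * x ^ i)"
    using assms by (intro mult_mono sum_mono power_mono sum_nonneg) auto
  then show ?thesis unfolding power_diff_sumr2[symmetric] by simp
qed

text \<open>\<open>cosh \<circ> sqrt\<close> is convex, as its power series has nonnegative coefficients.\<close>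
lemma cosh_sum_mono_spread:
  fixes x y u v :: real
  assumes "x\<^sup>2 + y\<^sup>2 = u\<^sup>2 + v\<^sup>2" "u\<^sup>2 \<le> x\<^sup>2" "v\<^sup>2 \<le> x\<^sup>2"
  shows "cosh u + cosh v \<le> cosh x + cosh y"
proof (rule sums_le)
  show "(\<lambda>n. (if even n then u ^ n /\<^sub>R fact n else 0) + (if even n then v ^ n /\<^sub>R fact n else 0)) sums (cosh u + cosh v)"
    by (intro sums_add cosh_converges)
  show "(\<lambda>n. (if even n then x ^ n /\<^sub>R fact n else 0) + (if even n then y ^ n /\<^sub>R fact n else 0)) sums (cosh x + cosh y)"
    by (intro sums_add cosh_converges)
  fix n
  have "u ^ n + v ^ n \<le> x ^ n + y ^ n" if "even n"
  proof -
    from that obtain k where "n = 2 * k" by (elim evenE)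
    then show ?thesis using power_sum_mono_spread[OF assms, of k] by (simp add: power_mult)
  qed
  then show "(if even n then u ^ n /\<^sub>R fact n else 0) + (if even n then v ^ n /\<^sub>R fact n else 0)
      \<le> (if even n then x ^ n /\<^sub>R fact n else 0) + (if even n then y ^ n /\<^sub>R fact n else 0)"
    by (simp add: mult_left_mono flip: distrib_left)
qed

text \<open>Transfers the hyperbolic bound on the median \<open>M\<close> of a triangle with sides
  \<open>a\<close>, \<open>b\<close>, \<open>2 * h\<close> to the Euclidean one. If \<open>M\<close>
  exceeded the Euclidean median \<open>w\<close>, convexity of \<open>cosh \<circ> sqrt\<close>
  would contradict \<open>le\<close>.\<close>

lemma hyperbolic_median:
  fixes a b h M :: real
  assumes le: "cosh M * cosh h \<le> (cosh a + cosh b) / 2" and h: "\<bar>a - b\<bar> \<le> 2 * h" "2 * h \<le> a + b" and M: "M \<ge> 0"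
  shows "M\<^sup>2 + h\<^sup>2 \<le> (a\<^sup>2 + b\<^sup>2) / 2"
proof (rule ccontr)
  assume neg: "\<not> ?thesis"
  define w where "w = sqrt ((a\<^sup>2 + b\<^sup>2) / 2 - h\<^sup>2)"
  have h0: "h \<ge> 0" using h by linarith
  have "0 \<le> ((a + b) - 2 * h) * ((a + b) + 2 * h)" using h h0 by simp
  then have "4 * h\<^sup>2 \<le> (a + b)\<^sup>2" by (simp add: power2_eq_square algebra_simps)
  moreover have "(a - b)\<^sup>2 \<le> (2 * h)\<^sup>2" using abs_le_square_iff[of "a - b" "2 * h"] h h0 by simp
  then have "(a - b)\<^sup>2 \<le> 4 * h\<^sup>2" by (simp add: power_mult_distrib)
  \<comment> \<open>By Heron's formula the product is 16 times the squared area of the Euclidean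
    triangle with sides \<open>a\<close>, \<open>b\<close>, \<open>2 * h\<close>.\<close>
  ultimately have pr: "0 \<le> ((a + b)\<^sup>2 - 4 * h\<^sup>2) * (4 * h\<^sup>2 - (a - b)\<^sup>2)" by simp
  have "(a\<^sup>2 + b\<^sup>2) / 2 - h\<^sup>2 = ((a + b)\<^sup>2 - 4 * h\<^sup>2) / 4 + (a - b)\<^sup>2 / 4"
    by (simp add: power2_eq_square field_simps)
  also have "\<dots> \<ge> 0" using \<open>4 * h\<^sup>2 \<le> (a + b)\<^sup>2\<close> by simp
  finally have w: "w\<^sup>2 = (a\<^sup>2 + b\<^sup>2) / 2 - h\<^sup>2" "w \<ge> 0" by (simp_all add: w_def)
  have "(a\<^sup>2 - b\<^sup>2)\<^sup>2 = 8 * h\<^sup>2 * (a\<^sup>2 + b\<^sup>2) - 16 * (h\<^sup>2)\<^sup>2 - ((a + b)\<^sup>2 - 4 * h\<^sup>2) * (4 * h\<^sup>2 - (a - b)\<^sup>2)"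
    by algebra
  also have "\<dots> \<le> 8 * h\<^sup>2 * (a\<^sup>2 + b\<^sup>2) - 16 * (h\<^sup>2)\<^sup>2" using pr by simp
  also have "\<dots> = 16 * h\<^sup>2 * w\<^sup>2" unfolding w(1) by (simp add: power2_eq_square algebra_simps)
  also have "\<dots> = (4 * w * h)\<^sup>2" by (simp add: power_mult_distrib)
  finally have "\<bar>a\<^sup>2 - b\<^sup>2\<bar> \<le> 4 * w * h" using w(2) h0 by (simp flip: abs_le_square_iff)
  then have 1: "a\<^sup>2 \<le> (w + h)\<^sup>2" "b\<^sup>2 \<le> (w + h)\<^sup>2" unfolding power2_sum w(1) by (simp_all add: field_simps abs_le_iff)
  \<comment> \<open>The pair \<open>w + h\<close>, \<open>w - h\<close> has the same sum of squares
    as \<open>a\<close>, \<open>b\<close> but is spread further apart, and its hyperbolic cosines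
    add up to \<open>2 * cosh w * cosh h\<close>.\<close>
  have "(w + h)\<^sup>2 + (w - h)\<^sup>2 = a\<^sup>2 + b\<^sup>2" unfolding power2_sum power2_diff w(1) by simp
  from cosh_sum_mono_spread[OF this 1] have "cosh a + cosh b \<le> 2 * (cosh w * cosh h)"
    by (simp add: cosh_add cosh_diff mult_ac)
  moreover have "w\<^sup>2 < M\<^sup>2" using neg w(1) by linarith
  then have "w < M" using M by (rule power2_less_imp_less)
  then have "cosh w * cosh h < cosh M * cosh h" using w by (simp add: cosh_real_nonneg_less_iff)
  moreover have "2 * (cosh M * cosh h) \<le> cosh a + cosh b" using le by simp
  ultimately show False by linarith
qed

text \<open>The CN inequality has the same form for all \<kappa>, so projections and weak
  compactness can be treated without reference to the curvature.\<close>

lemma CAT_midpoint: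
  fixes x z :: "'a::metric_space"
  assumes \<kappa>: "\<kappa> \<le> 0" and X: "CAT \<kappa> (UNIV :: 'a set) dist"
  shows "\<exists>m. \<forall>y. (dist y m)\<^sup>2 \<le> (dist y x)\<^sup>2 / 2 + (dist y z)\<^sup>2 / 2 - (dist x z)\<^sup>2 / 4"
proof -
  define K where "K = - \<kappa>"
  have K: "K \<ge> 0" using \<kappa> by (simp add: K_def)
  obtain \<gamma> where \<gamma>: "geodesic_in UNIV dist \<gamma> x z"
    using X by (auto simp: CAT_def geodesic_space_def)
  define l where "l = dist x z"
  have "(dist (\<gamma> (l/2)) y)\<^sup>2 \<le> (dist x y)\<^sup>2 / 2 + (dist z y)\<^sup>2 / 2 - l\<^sup>2 / 4" for y
  proof (cases "l = 0")
    case True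
    then show ?thesis using \<gamma> by (auto simp: l_def geodesic_in_def)
  next
    case False
    then have l: "l > 0" by (simp add: l_def)
    then have l2: "l/2 \<in> {0..dist x z}" by (simp add: l_def)
    obtain D where D: "D \<ge> 0" "dist (\<gamma> (l/2)) y \<le> D"
      "sn K l * (md K (l/2) + md K (dist x y) + K * md K (l/2) * md K (dist x y) - md K D) = sn K (l/2) * gip K x z y"
      using comparison[OF \<kappa> _ _ _ \<gamma> l2, of "(\<le>)" y] X unfolding CAT_def K_def l_def by auto
    have "D\<^sup>2 + (l/2)\<^sup>2 \<le> ((dist x y)\<^sup>2 + (dist z y)\<^sup>2) / 2"
    proof (cases "K = 0")
      case True
      then have "l * ((l/2)\<^sup>2/2 + (dist x y)\<^sup>2/2 - D\<^sup>2/2) = l * ((l\<^sup>2/2 + (dist x y)\<^sup>2/2 - (dist z y)\<^sup>2/2)/2)"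
        using D(3) by (simp add: sn_def md_def gip_def l_def)
      then have "(l/2)\<^sup>2/2 + (dist x y)\<^sup>2/2 - D\<^sup>2/2 = (l\<^sup>2/2 + (dist x y)\<^sup>2/2 - (dist z y)\<^sup>2/2)/2"
        using l unfolding mult_cancel_left by simp
      then show ?thesis by (simp add: power_divide)
    next
      case False
      define k where "k = sqrt K"
      have k: "k > 0" "k * k = K" using K False by (auto simp: k_def)
      define A B where "A = cosh (k * dist x y)" and "B = cosh (k * dist z y)"
      define c s where "c = cosh (k * (l/2))" and "s = sinh (k * (l/2))"
      have s: "s > 0" using k l by (simp add: s_def)
      have cs: "cosh (k * l) = 2 * c\<^sup>2 - 1" "sinh (k * l) = 2 * s * c"
        using cosh_double[of "k * (l/2)"] sinh_double[of "k * (l/2)"]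
        by (simp_all add: c_def s_def cosh_square_eq)
      have split: "(u - 1) / K + (v - 1) / K + K * ((u - 1) / K) * ((v - 1) / K) - (w - 1) / K = (u * v - w) / K" for u v w
        using False by (simp add: field_simps)
      have "(sinh (k * l) / k) * ((c * A - cosh (k * D)) / K) = (s / k) * ((cosh (k * l) * A - B) / K)"
        using D(3) False unfolding gip_def md_def sn_def
        by (simp only: if_False split k_def[symmetric] A_def B_def c_def s_def l_def[symmetric])
      then have "2 * s * c * (c * A - cosh (k * D)) = s * ((2 * c\<^sup>2 - 1) * A - B)"
        unfolding cs using k False by simp
      then have "2 * c * (c * A - cosh (k * D)) = (2 * c\<^sup>2 - 1) * A - B" using s by simp
      then have "cosh (k * D) * cosh (k * (l/2)) \<le> (cosh (k * dist x y) + cosh (k * dist z y)) / 2"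
        unfolding A_def[symmetric] B_def[symmetric] c_def[symmetric] by (simp add: power2_eq_square algebra_simps)
      moreover have "\<bar>k * dist x y - k * dist z y\<bar> \<le> 2 * (k * (l/2))" "2 * (k * (l/2)) \<le> k * dist x y + k * dist z y"
      proof -
        have "\<bar>dist x y - dist z y\<bar> \<le> l" "l \<le> dist x y + dist z y"
          using dist_triangle[of x y z] dist_triangle3[of z y x] dist_triangle2[of x z y]
          by (auto simp: l_def abs_le_iff)
        then have "k * \<bar>dist x y - dist z y\<bar> \<le> k * l" "k * l \<le> k * (dist x y + dist z y)"
          using k by (auto intro: mult_left_mono)
        moreover have "\<bar>k * dist x y - k * dist z y\<bar> = k * \<bar>dist x y - dist z y\<bar>"
          using k by (simp add: abs_mult flip: right_diff_distrib)
        ultimately show "\<bar>k * dist x y - k * dist z y\<bar> \<le> 2 * (k * (l/2))" "2 * (k * (l/2)) \<le> k * dist x y + k * dist z y"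
          by (auto simp: distrib_left)
      qed
      ultimately have "(k * D)\<^sup>2 + (k * (l/2))\<^sup>2 \<le> ((k * dist x y)\<^sup>2 + (k * dist z y)\<^sup>2) / 2"
        using k D(1) by (intro hyperbolic_median) auto
      then have "k\<^sup>2 * (D\<^sup>2 + (l/2)\<^sup>2) \<le> k\<^sup>2 * (((dist x y)\<^sup>2 + (dist z y)\<^sup>2) / 2)"
        unfolding power_mult_distrib by (simp add: algebra_simps)
      then show ?thesis using k(1) by simp
    qed
    moreover have "(dist (\<gamma> (l/2)) y)\<^sup>2 \<le> D\<^sup>2" using D by (intro power_mono) auto
    ultimately show ?thesis by (simp add: power_divide add_divide_distrib)
  qed
  then show ?thesis unfolding l_def by (intro exI[of _ "\<gamma> (dist x z / 2)"]) (simp add: dist_commute)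
qed

section \<open>The Lang--Schroeder inequality in CBB spaces\<close>

text \<open>Upper bound for \<open>au = c p u\<close> in \<open>gradient_step\<close>, where
  \<open>a = c p z\<close>, \<open>a' = c p z'\<close> and \<open>cc = c z y\<close>.
  \<open>F3\<close> compares \<open>u\<close> with the halved point \<open>z\<close>,
  \<open>F4\<close> bounds \<open>cz'u\<close> from below; eliminating \<open>cz'u\<close> leaves
  \<open>au\<close> with the coefficient \<omega> / 2.\<close>

lemma gradient_step_algebra:
  fixes K :: real
  assumes K: "K \<ge> 0" and a: "a \<ge> 0" and a': "a' \<ge> 0"
    and F1: "czz' = a + K*a*a' - K*a'^2/2"
    and F2: "2*a' + K*a'^2 = 4*(2*a + K*a^2)"
    and F3: "a + au + K*a*au - czu \<le> (a' + au + K*a'*au - cz'u)/2"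
    and F4: "cz'u \<ge> czz' - \<theta> * (cc + czz' + K*cc*czz' - cz'x)"
    and F5: "czu \<le> \<theta>^2*B"
    and F6: "e = (a' + ax + K*a'*ax - cz'x) - 2 * (a + ax + K*a*ax - cc)"
  defines "\<omega> \<equiv> 1 + 2*K*a - K*a'"
  shows "\<omega> > 0" and "au - a + \<theta> * (cc + a + K*cc*a - ax) \<le> (2*\<theta>^2*B + \<theta>*e) / \<omega>"
proof -
  \<comment> \<open>\<omega> is the difference of \<open>2 * (1 + K * a)\<close> and
    \<open>1 + K * a'\<close>. \<open>F2\<close> says that the difference of their squares is
    3.\<close>
  have "\<omega> * (2*(1+K*a) + (1+K*a')) = 4*(1+K*a)^2 - (1+K*a')^2"
    unfolding \<omega>_def by (simp add: power2_eq_square algebra_simps)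
  also have "\<dots> = 3 + K*(4*(2*a + K*a^2) - (2*a' + K*a'^2))"
    by (simp add: power2_eq_square algebra_simps)
  also have "\<dots> = 3" using F2 by simp
  finally have *: "\<omega> * (2*(1+K*a) + (1+K*a')) = 3" .
  have "2*(1+K*a) + (1+K*a') > 0" using K a a' by (smt (verit) mult_nonneg_nonneg)
  with * show w: "\<omega> > 0" by (metis mult_le_0_iff not_le order_less_imp_le zero_less_numeral)
  have ident: "cc + czz' + K*cc*czz' - cz'x = - \<omega> * (cc + a + K*cc*a - ax) + e"
    using F1 F2 F6 unfolding \<omega>_def by algebra
  have ident2: "a'/2 - a - czz'/2 = a * \<omega> / 2"
  proof -
    have "2*(a' - 2*a - czz') = 2*(a * \<omega>)" using F1 F2 unfolding \<omega>_def by algebra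
    then show ?thesis by simp
  qed
  have "au * \<omega> / 2 \<le> czu + a'/2 - a - cz'u/2"
    using F3 unfolding \<omega>_def by (simp add: field_simps)
  also have "\<dots> \<le> \<theta>^2*B + (a'/2 - a - czz'/2) + \<theta> * (cc + czz' + K*cc*czz' - cz'x)/2"
    using F4 F5 by (simp add: field_simps)
  also have "\<dots> = \<theta>^2*B + a * \<omega> / 2 + \<theta> * (- \<omega> * (cc + a + K*cc*a - ax) + e)/2"
    unfolding ident ident2 ..
  finally have "(au - a + \<theta> * (cc + a + K*cc*a - ax)) * \<omega> \<le> 2*\<theta>^2*B + \<theta>*e"
    by (simp add: field_simps)
  then show "au - a + \<theta> * (cc + a + K*cc*a - ax) \<le> (2*\<theta>^2*B + \<theta>*e) / \<omega>"
    using w by (simp add: pos_le_divide_eq)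
qed

text \<open>In the model plane, \<open>ip p x y\<close> is the product of \<open>nrm p x\<close>, \<open>nrm p y\<close> and the cosine of the angle at \<open>p\<close>.\<close>
locale cbb_gauge =
  fixes K :: real and c :: "'p \<Rightarrow> 'p \<Rightarrow> real" and ip :: "'p \<Rightarrow> 'p \<Rightarrow> 'p \<Rightarrow> real"
    and nrm :: "'p \<Rightarrow> 'p \<Rightarrow> real"
  defines "ip \<equiv> \<lambda>p x y. c p x + c p y + K * c p x * c p y - c x y"
    and "nrm \<equiv> \<lambda>p x. sqrt (2 * c p x + K * (c p x)\<^sup>2)"
  assumes K: "K \<ge> 0" and c_nonneg: "c x y \<ge> 0" and c_sym: "c x y = c y x" and c_self: "c x x = 0"
    and c_pos: "c x y = 0 \<Longrightarrow> x = y"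
    and ip_lower: "ip p x y \<ge> - nrm p x * nrm p y"
    and contract: "0 \<le> \<nu> \<Longrightarrow> \<nu> \<le> 1 \<Longrightarrow>
      \<exists>w. nrm p w = \<nu> * nrm p z \<and> ip p w z = \<nu> * (nrm p z)\<^sup>2 \<and> (\<forall>y. ip p w y \<le> \<nu> * ip p z y)"
begin

lemma nrm_sq: "(nrm p x)\<^sup>2 = 2 * c p x + K * (c p x)\<^sup>2"
  unfolding nrm_def using K c_nonneg[of p x] by simp

lemma nrm_nonneg: "nrm p x \<ge> 0"
  unfolding nrm_def using K c_nonneg[of p x] by simp

lemma c_le_nrm: "2 * c p x \<le> (nrm p x)\<^sup>2"
  unfolding nrm_sq using K by simp

lemma nrm_eq_0: "nrm p x = 0 \<Longrightarrow> x = p"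
  using c_le_nrm[of p x] c_nonneg[of p x] c_pos[of p x] by simp

lemma ip_self [simp]: "ip p p y = 0"
  unfolding ip_def using c_self by simp

text \<open>If \<open>z\<close> nearly maximises the slope \<open>- L z / nrm p z\<close>, then up to errors \<open>L\<close> dominates the linear
  functional \<open>- (s / N) * ip p z\<close>: otherwise points close to \<open>z\<close> on a geodesic from \<open>z\<close> to \<open>y\<close> would have a
  steeper slope. The point \<open>z'\<close>, which prolongs the geodesic from \<open>p\<close> to \<open>z\<close>, is needed to bound the distance of such
  points to \<open>p\<close> from above.\<close>
lemma gradient_step:
  fixes I :: "'i set" and l :: "'i \<Rightarrow> real" and x :: "'i \<Rightarrow> 'p" and p z z' y :: 'p and s \<eta> \<tau> N :: real
  assumes I: "finite I" and l: "\<And>i. i \<in> I \<Longrightarrow> l i \<ge> 0"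
  defines "L \<equiv> \<lambda>y. \<Sum>j\<in>I. l j * ip p y (x j)"
  assumes s: "s \<ge> 0" and sL: "\<And>y. L y \<ge> - s * nrm p y"
    and half: "nrm p z = nrm p z' / 2" "ip p z z' = (nrm p z')\<^sup>2 / 2" "\<And>y. ip p z y \<le> ip p z' y / 2"
    and N: "N = nrm p z" "N > 0" and opt: "L z \<le> - (s - \<eta>) * N"
    and \<tau>: "\<tau> > 0" "\<tau> * N \<le> 1"
  defines "E \<equiv> ((2*\<tau>*N*((nrm z y)\<^sup>2/2) + (ip p z' y - 2 * ip p z y)) / (1 + 2*K*c p z - K*c p z'))"
  defines "W \<equiv> (\<Sum>j\<in>I. l j) + K * (\<Sum>j\<in>I. l j * c p (x j))"
  shows "0 \<le> L y + s * (ip p z y / N) + E * W + s * (E/N) * (1 + K * c p z) + s * K * \<tau> * (\<bar>ip z y p\<bar> + \<bar>E\<bar>)\<^sup>2/2 + \<eta>/\<tau>"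
proof -
  \<comment> \<open>A step proportional to \<open>N\<close> turns the slack \<eta> * N, after
    division by \<theta>, into \<eta> / \<tau>, which does not blow up as \<open>z\<close>
    approaches \<open>p\<close>.\<close>
  define \<theta> where "\<theta> = \<tau> * N"
  have \<theta>: "\<theta> > 0" "\<theta> \<le> 1" using \<tau> N by (auto simp: \<theta>_def)
  obtain u where u: "nrm z u = \<theta> * nrm z y" "\<And>v. ip z u v \<le> \<theta> * ip z y v"
    using contract[of \<theta> z y] \<theta> by auto
  define H where "H = (\<lambda>v. \<Sum>j\<in>I. l j * c v (x j))"
  define \<Lambda> where "\<Lambda> = (\<Sum>j\<in>I. l j)"
  have \<Lambda>: "\<Lambda> \<ge> 0" unfolding \<Lambda>_def by (intro sum_nonneg l)
  have Hp: "H p \<ge> 0" unfolding H_def by (intro sum_nonneg mult_nonneg_nonneg l c_nonneg)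
  have W: "W = \<Lambda> + K * H p" by (simp add: W_def \<Lambda>_def H_def)
  have W0: "W \<ge> 0" using W \<Lambda> Hp K by simp
  have HL: "(\<Sum>j\<in>I. l j * ip b v (x j)) = \<Lambda> * c b v + H b + K * c b v * H b - H v" for b v
    unfolding ip_def \<Lambda>_def H_def
    by (simp add: algebra_simps sum.distrib sum_subtractf sum_distrib_left sum_distrib_right)
  have Hv: "H v = H p + c p v * W - L v" for v
    unfolding L_def HL W by (simp add: algebra_simps)
  \<comment> \<open>First variation along the geodesic from \<open>z\<close> towards
    \<open>y\<close>, obtained by dropping the nonnegative terms that contain
    \<open>c z u\<close>.\<close>
  have lowu: "c u v \<ge> c z v - \<theta> * ip z y v" for v
  proof -
    have "c z u * (1 + K * c z v) \<ge> 0" using K c_nonneg by simp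
    then show ?thesis using u(2)[of v] unfolding ip_def by (simp add: algebra_simps)
  qed
  define a where "a = c p z"
  define a' where "a' = c p z'"
  define au where "au = c p u"
  define q where "q = ip z y p"
  have qeq: "q = c z y + a + K * c z y * a - c p y"
    unfolding q_def ip_def a_def using c_sym by metis
  define e where "e = ip p z' y - 2 * ip p z y"
  define \<omega> where "\<omega> = 1 + 2*K*a - K*a'"
  have F5: "c z u \<le> \<theta>^2 * ((nrm z y)\<^sup>2/2)"
    using c_le_nrm[of z u] unfolding u(1) by (simp add: power_mult_distrib)
  have F2: "2*a' + K*a'^2 = 4*(2*a + K*a^2)"
  proof -
    have "(nrm p z')\<^sup>2 = 4 * (nrm p z)\<^sup>2" unfolding half(1) by (simp add: power_divide)
    then show ?thesis unfolding nrm_sq a_def a'_def .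
  qed
  have F1: "c z z' = a + K*a*a' - K*a'^2/2"
    using half(2) unfolding nrm_sq ip_def a_def a'_def by (simp add: field_simps)
  have F3: "a + au + K*a*au - c z u \<le> (a' + au + K*a'*au - c z' u)/2"
    using half(3)[of u] unfolding ip_def a_def a'_def au_def by simp
  have F4: "c z' u \<ge> c z z' - \<theta> * (c z y + c z z' + K*c z y*c z z' - c z' y)"
    using lowu[of z'] unfolding ip_def using c_sym by metis
  have F6: "e = (a' + c p y + K*a'*c p y - c z' y) - 2 * (a + c p y + K*a*c p y - c z y)"
    unfolding e_def ip_def a_def a'_def by simp
  have aa: "a \<ge> 0" "a' \<ge> 0" using c_nonneg by (auto simp: a_def a'_def)
  note alg = gradient_step_algebra[OF K aa F1 F2 F3 F4 F5 F6]
  have w: "\<omega> > 0" using alg(1) unfolding \<omega>_def .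
  have E: "E = (2*\<theta>*((nrm z y)\<^sup>2/2) + e) / \<omega>"
    unfolding E_def e_def \<omega>_def a_def a'_def \<theta>_def by (simp add: mult_ac)
  have up: "au - a \<le> \<theta> * (E - q)"
  proof -
    have "au - a + \<theta> * q \<le> \<theta> * E"
      using alg(2) unfolding E qeq \<omega>_def[symmetric] by (simp add: power2_eq_square algebra_simps)
    then show ?thesis by (simp add: algebra_simps)
  qed
  have lo: "au - a \<ge> - \<theta> * q"
    using lowu[of p] c_sym[of u p] c_sym[of z p] by (simp add: au_def a_def q_def)
  have sq: "(au - a)\<^sup>2 \<le> (\<theta> * (\<bar>q\<bar> + \<bar>E\<bar>))\<^sup>2"
  proof (rule power2_le_iff_abs_le[THEN iffD2])
    show "0 \<le> \<theta> * (\<bar>q\<bar> + \<bar>E\<bar>)" using \<theta> by simp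
    have "\<theta> * (E - q) \<le> \<theta> * (\<bar>q\<bar> + \<bar>E\<bar>)" "\<theta> * q \<le> \<theta> * (\<bar>q\<bar> + \<bar>E\<bar>)"
      using \<theta>(1) by (intro mult_left_mono; simp)+
    then show "\<bar>au - a\<bar> \<le> \<theta> * (\<bar>q\<bar> + \<bar>E\<bar>)" using up lo by simp
  qed
  have N2: "N\<^sup>2 = 2*a + K*a\<^sup>2" unfolding N a_def nrm_sq ..
  have nu: "nrm p u \<le> N + (au - a)*(1+K*a)/N + K*(au-a)\<^sup>2/(2*N)"
  proof -
    \<comment> \<open>Linearises the square root in \<open>nrm p u\<close> at
      \<open>N\<close>.\<close>
    have "0 \<le> (nrm p u - N)\<^sup>2" by simp
    then have "2*N*nrm p u \<le> (nrm p u)\<^sup>2 + N\<^sup>2" by (simp add: power2_diff mult_ac)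
    also have "\<dots> = 2*N\<^sup>2 + 2*((au-a)*(1+K*a)) + K*(au-a)\<^sup>2"
      unfolding nrm_sq N2 au_def[symmetric] by (simp add: power2_eq_square algebra_simps)
    finally have "nrm p u \<le> (2*N\<^sup>2 + 2*((au-a)*(1+K*a)) + K*(au-a)\<^sup>2) / (2*N)"
      using N(2) by (subst pos_le_divide_eq) (simp_all only: mult_pos_pos zero_less_numeral mult.commute)
    also have "\<dots> = N + (au - a)*(1+K*a)/N + K*(au-a)\<^sup>2/(2*N)"
      using N(2) by (simp add: add_divide_distrib power2_eq_square)
    finally show ?thesis .
  qed
  have "H u \<ge> H z - \<theta> * (\<Sum>j\<in>I. l j * ip z y (x j))"
  proof -
    have "H z - \<theta> * (\<Sum>j\<in>I. l j * ip z y (x j)) = (\<Sum>j\<in>I. l j * (c z (x j) - \<theta> * ip z y (x j)))"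
      unfolding H_def by (simp add: algebra_simps sum_subtractf sum_distrib_left)
    also have "\<dots> \<le> H u" unfolding H_def by (intro sum_mono mult_left_mono lowu l)
    finally show ?thesis .
  qed
  then have "H p + a * W - L z - \<theta> * (\<Lambda> * c z y + H z + K * c z y * H z - H y) \<le> H p + au * W - L u"
    unfolding HL Hv[of z] Hv[of u] a_def au_def by simp
  \<comment> \<open>\<open>sL\<close> bounds \<open>L u\<close> from below and \<open>opt\<close>
    bounds \<open>L z\<close> from above. The terms of order zero cancel up to \<eta> * N, so that
    division by \<theta> yields a first-order inequality.\<close>
  then have 1: "0 \<le> (au - a)*W + s * nrm p u - (s - \<eta>) * N + \<theta> * (\<Lambda> * c z y + H z + K * c z y * H z - H y)"
    using sL[of u] opt by (simp add: algebra_simps)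
  have Lz: "\<Lambda> * c z y + H z + K * c z y * H z - H y \<le> q * W + s * N * (1 + K * c z y) + L y"
  proof -
    have "H z \<le> H p + a * W + s * N" using Hv[of z] sL[of z] N a_def by simp
    then have "H z * (1 + K * c z y) \<le> (H p + a * W + s * N) * (1 + K * c z y)"
      using K c_nonneg by (intro mult_right_mono) auto
    then show ?thesis unfolding Hv[of y] qeq W by (simp add: algebra_simps)
  qed
  have M: "N\<^sup>2 * (1 + K * c z y) - q * (1 + K*a) = ip p z y"
    unfolding N2 qeq ip_def a_def[symmetric] by (simp add: power2_eq_square algebra_simps)
  have 2: "s * nrm p u \<le> s * (N + \<theta> * (E - q)*(1+K*a)/N + K*(\<theta> * (\<bar>q\<bar> + \<bar>E\<bar>))\<^sup>2/(2*N))"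
  proof (rule mult_left_mono[OF order_trans[OF nu] s], intro add_mono divide_right_mono mult_right_mono mult_left_mono sq up)
  qed (use K aa N in auto)
  have 3: "(au - a)*W \<le> \<theta> * (E - q) * W" using up W0 by (intro mult_right_mono)
  have 4: "\<theta> * (\<Lambda> * c z y + H z + K * c z y * H z - H y) \<le> \<theta> * (q * W + s * N * (1 + K * c z y) + L y)"
    using Lz \<theta> by (intro mult_left_mono) auto
  have 5: "0 \<le> \<theta> * (E - q) * W + s * (N + \<theta> * (E - q)*(1+K*a)/N + K*(\<theta> * (\<bar>q\<bar> + \<bar>E\<bar>))\<^sup>2/(2*N))
      - (s - \<eta>) * N + \<theta> * (q * W + s * N * (1 + K * c z y) + L y)"
    using 1 2 3 4 by linarith
  also have "\<dots> = \<theta> * (E * W + s * (E/N) * (1+K*a) + s * K * (\<theta>/N) * (\<bar>q\<bar> + \<bar>E\<bar>)\<^sup>2/2 + \<eta> * (N/\<theta>)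
      + s * ((N\<^sup>2 * (1 + K * c z y) - q * (1 + K*a))/N) + L y)"
    using N(2) \<theta> by (simp add: field_simps power2_eq_square)
  finally have "0 \<le> E * W + s * (E/N) * (1+K*a) + s * K * (\<theta>/N) * (\<bar>q\<bar> + \<bar>E\<bar>)\<^sup>2/2 + \<eta> * (N/\<theta>)
      + s * (ip p z y/N) + L y"
    unfolding M using \<theta>(1) by (simp add: zero_le_mult_iff)
  moreover have "\<theta>/N = \<tau>" "N/\<theta> = 1/\<tau>" using N(2) \<tau> by (auto simp: \<theta>_def)
  ultimately show ?thesis unfolding a_def q_def by (simp add: algebra_simps)
qed

text \<open>The double sum is \<open>\<Sum>i\<in>I. l i * L (x i)\<close>; by \<open>gradient_step\<close> it is at least
  \<open>- (s / nrm p z) * L z \<ge> s * (s - \<eta>)\<close> up to errors that vanish as \<open>z\<close> tends to \<open>p\<close>.\<close>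
theorem lang_schroeder:
  fixes I :: "'i set" and l :: "'i \<Rightarrow> real" and x :: "'i \<Rightarrow> 'p"
  assumes I: "finite I" and l: "\<And>i. i \<in> I \<Longrightarrow> l i \<ge> 0"
  shows "0 \<le> (\<Sum>i\<in>I. \<Sum>j\<in>I. l i * l j * ip p (x i) (x j))"
proof -
  define L where "L = (\<lambda>y. \<Sum>j\<in>I. l j * ip p y (x j))"
  have goal_eq: "(\<Sum>i\<in>I. \<Sum>j\<in>I. l i * l j * ip p (x i) (x j)) = (\<Sum>i\<in>I. l i * L (x i))"
    unfolding L_def by (simp add: sum_distrib_left mult_ac)
  show ?thesis
  proof (cases "\<forall>y. L y \<ge> 0")
    case True
    then show ?thesis unfolding goal_eq by (intro sum_nonneg mult_nonneg_nonneg l) auto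
  next
    case False
    then obtain y0 where y0: "L y0 < 0" by (auto simp: not_le)
    have L0: "L p = 0" unfolding L_def by simp
    have pos: "nrm p y > 0" if "L y < 0" for y
      using that L0 nrm_eq_0[of p y] nrm_nonneg[of p y] by (cases "nrm p y = 0") auto
    define Y where "Y = {y. nrm p y > 0}"
    have Lb: "- L y \<le> (\<Sum>j\<in>I. l j * nrm p (x j)) * nrm p y" for y
    proof -
      have "- L y = (\<Sum>j\<in>I. l j * (- ip p y (x j)))" unfolding L_def by (simp add: sum_negf)
      also have "\<dots> \<le> (\<Sum>j\<in>I. l j * (nrm p y * nrm p (x j)))"
        by (intro sum_mono mult_left_mono l) (use ip_lower[of p y] in \<open>auto simp: minus_le_iff\<close>)
      finally show ?thesis by (simp add: sum_distrib_left mult_ac)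
    qed
    have bdd: "bdd_above ((\<lambda>y. - L y / nrm p y) ` Y)"
    proof (rule bdd_aboveI2)
      fix y assume "y \<in> Y"
      then show "- L y / nrm p y \<le> (\<Sum>j\<in>I. l j * nrm p (x j))"
        unfolding Y_def mem_Collect_eq by (simp only: pos_divide_le_eq Lb)
    qed
    have y0Y: "y0 \<in> Y" using pos[OF y0] by (simp add: Y_def)
    define s where "s = (SUP y\<in>Y. - L y / nrm p y)"
    have "- L y0 / nrm p y0 \<le> s" unfolding s_def by (rule cSUP_upper[OF y0Y bdd])
    then have s: "s > 0" using y0 pos[OF y0] by (smt (verit) divide_pos_pos)
    have sL: "L y \<ge> - s * nrm p y" for y
    proof (cases "y \<in> Y")
      case True
      then have "- L y / nrm p y \<le> s" unfolding s_def by (intro cSUP_upper bdd)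
      moreover have "nrm p y > 0" using True by (simp add: Y_def)
      ultimately show ?thesis by (simp only: pos_divide_le_eq minus_mult_left[symmetric] neg_le_iff_le minus_le_iff)
    next
      case False
      then have "nrm p y = 0" using nrm_nonneg[of p y] by (simp add: Y_def)
      then show ?thesis using nrm_eq_0 L0 by force
    qed
    define B where "B = (\<Sum>i\<in>I. l i * (nrm p (x i))\<^sup>2)"
    have key: "(\<Sum>i\<in>I. l i * L (x i)) \<ge> - s * \<eta> - s * \<tau> * B - (\<Sum>i\<in>I. l i) * (\<eta>/\<tau>)"
      if \<eta>: "\<eta> > 0" and \<tau>: "\<tau> > 0" for \<eta> \<tau> :: real
    proof -
      \<comment> \<open>The steepest descent slope \<open>s\<close> need not be attained, hence the
        slack \<eta>.\<close>
      obtain z0 where z0: "z0 \<in> Y" "s - \<eta> < - L z0 / nrm p z0"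
        using less_cSUP_iff[THEN iffD1, OF _ bdd, of "s - \<eta>"] y0Y \<eta> unfolding s_def by auto
      have "\<forall>z. \<exists>w. nrm p w = nrm p z / 2 \<and> ip p w z = (nrm p z)\<^sup>2 / 2 \<and> (\<forall>y. ip p w y \<le> ip p z y / 2)"
        using contract[of "1/2" p] by auto
      then obtain h where h: "\<And>z. nrm p (h z) = nrm p z / 2" "\<And>z. ip p (h z) z = (nrm p z)\<^sup>2 / 2"
          "\<And>z y. ip p (h z) y \<le> ip p z y / 2" by metis
      \<comment> \<open>Repeated halving moves \<open>z0\<close> towards \<open>p\<close>. By
        \<open>contract\<close> no inner product divided by the norm increases, so near-optimality
        of the slope persists.\<close>
      define z where "z = (\<lambda>k. (h ^^ k) z0)"
      have zS: "z (Suc k) = h (z k)" for k by (simp add: z_def)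
      define N where "N = (\<lambda>k. nrm p (z k))"
      have Neq: "N k = nrm p z0 * (1/2)^k" for k
        by (induction k) (simp_all add: N_def z_def h(1))
      have Npos: "N k > 0" for k using z0(1) by (simp add: Neq Y_def)
      have N0: "N \<longlonglongrightarrow> 0" unfolding Neq[abs_def] by (rule tendsto_mult_right_zero) (simp add: LIMSEQ_realpow_zero)
      have NS: "N (Suc k) = N k / 2" for k by (simp add: Neq)
      \<comment> \<open>The limit \<open>G y\<close> acts as the inner product of \<open>y\<close>
        with the unit direction at \<open>p\<close> along which the points \<open>z k\<close>
        approach.\<close>
      define g where "g = (\<lambda>y k. ip p (z k) y / N k)"
      have ipg: "ip p (z k) y = g y k * N k" for y k using Npos[of k] by (simp add: g_def)
      have gdec: "decseq (g y)" for y
      proof (rule decseq_SucI)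
        fix k
        have "ip p (z (Suc k)) y \<le> ip p (z k) y / 2" unfolding zS by (rule h)
        then show "g y (Suc k) \<le> g y k"
          unfolding g_def NS using Npos[of k] by (simp add: field_simps)
      qed
      have glow: "g y k \<ge> - nrm p y" for y k
        using ip_lower[of p "z k" y] Npos[of k] by (simp add: g_def pos_le_divide_eq N_def mult_ac)
      have "\<forall>y. \<exists>G. g y \<longlonglongrightarrow> G"
      proof
        fix y
        show "\<exists>G. g y \<longlonglongrightarrow> G"
          by (rule decseq_convergent[of "g y" "- nrm p y", OF gdec]) (use glow in auto)
      qed
      then obtain G where G: "\<And>y. g y \<longlonglongrightarrow> G y" by metis
      note GS = LIMSEQ_Suc[OF G] note NS0 = LIMSEQ_Suc[OF N0]
      have Lz: "L (z k) / N k = (\<Sum>j\<in>I. l j * g (x j) k)" for k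
        unfolding L_def g_def by (simp add: sum_divide_distrib)
      have opt: "L (z k) / N k \<le> - (s - \<eta>)" for k
      proof -
        have "L (z k) / N k \<le> L (z 0) / N 0"
          unfolding Lz using gdec l by (intro sum_mono mult_left_mono) (auto simp: decseq_def)
        also have "\<dots> \<le> - (s - \<eta>)" using z0(2) by (simp add: z_def N_def)
        finally show ?thesis .
      qed
      have GL: "(\<Sum>j\<in>I. l j * G (x j)) \<le> - (s - \<eta>)"
      proof (rule LIMSEQ_le_const2)
        show "(\<lambda>k. \<Sum>j\<in>I. l j * g (x j) k) \<longlonglongrightarrow> (\<Sum>j\<in>I. l j * G (x j))"
          by (intro tendsto_intros G)
      qed (use opt Lz in auto)
      have c0: "(\<lambda>k. c p (z k)) \<longlonglongrightarrow> 0"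
      proof (rule tendsto_sandwich[where f = "\<lambda>_. 0" and h = "\<lambda>k. (N k)\<^sup>2"])
        show "\<forall>\<^sub>F k in sequentially. c p (z k) \<le> (N k)\<^sup>2"
          using c_le_nrm[of p] c_nonneg[of p] by (intro always_eventually allI) (smt (verit) N_def)
        show "(\<lambda>k. (N k)\<^sup>2) \<longlonglongrightarrow> 0" using tendsto_power[OF N0, of 2] by simp
      qed (use c_nonneg in auto)
      note cS0 = LIMSEQ_Suc[OF c0]
      have grad: "0 \<le> L y + s * G y + s * \<tau> * (nrm p y)\<^sup>2 + \<eta>/\<tau>" for y
      proof -
        have czy: "c (z k) y = c p (z k) + c p y + K * c p (z k) * c p y - g y k * N k" for k
          unfolding ipg[symmetric] ip_def by simp
        have cy: "(\<lambda>k. c (z (Suc k)) y) \<longlonglongrightarrow> c p y"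
        proof -
          have "(\<lambda>k. c (z (Suc k)) y) \<longlonglongrightarrow> 0 + c p y + K * 0 * c p y - G y * 0"
            unfolding czy by (intro tendsto_intros cS0 GS NS0)
          then show ?thesis by simp
        qed
        define W where "W = (\<Sum>j\<in>I. l j) + K * (\<Sum>j\<in>I. l j * c p (x j))"
        \<comment> \<open>The error \<open>E\<close> of \<open>gradient_step\<close> is
          \<open>N (Suc k) * R k\<close>: as \<open>N k\<close> is twice \<open>N (Suc k)\<close>,
          its second summand becomes a difference of consecutive values of \<open>g y\<close>, which
          vanishes in the limit.\<close>
        define R where "R = (\<lambda>k. (2*\<tau>*((2 * c (z (Suc k)) y + K * (c (z (Suc k)) y)\<^sup>2)/2) + 2 * (g y k - g y (Suc k)))
            / (1 + 2*K*c p (z (Suc k)) - K*c p (z k)))"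
        have RE: "((2*\<tau>*N (Suc k)*((nrm (z (Suc k)) y)\<^sup>2/2) + (ip p (z k) y - 2 * ip p (z (Suc k)) y))
            / (1 + 2*K*c p (z (Suc k)) - K*c p (z k))) = N (Suc k) * R k" for k
          unfolding R_def nrm_sq ipg times_divide_eq_right
          by (rule arg_cong2[where f = "(/)"]) (simp_all add: NS algebra_simps)
        have R: "R \<longlonglongrightarrow> (2*\<tau>*((2 * c p y + K * (c p y)\<^sup>2)/2) + 2 * (G y - G y)) / (1 + 2*K*0 - K*0)"
          unfolding R_def by (intro tendsto_intros cy G GS c0 cS0) simp_all
        then have R: "R \<longlonglongrightarrow> \<tau> * (nrm p y)\<^sup>2" by (simp add: nrm_sq)
        have q: "(\<lambda>k. ip (z (Suc k)) y p) \<longlonglongrightarrow> 0"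
        proof -
          have "(\<lambda>k. c (z (Suc k)) y + c p (z (Suc k)) + K * c (z (Suc k)) y * c p (z (Suc k)) - c p y)
              \<longlonglongrightarrow> c p y + 0 + K * c p y * 0 - c p y"
            by (intro tendsto_intros cy cS0)
          then show ?thesis unfolding ip_def by (simp add: c_sym[of _ p])
        qed
        have lim: "(\<lambda>k. L y + s * g y (Suc k) + N (Suc k) * R k * W + s * R k * (1 + K * c p (z (Suc k)))
            + s * K * \<tau> * (\<bar>ip (z (Suc k)) y p\<bar> + \<bar>N (Suc k) * R k\<bar>)\<^sup>2/2 + \<eta>/\<tau>) \<longlonglongrightarrow>
            L y + s * G y + 0 * (\<tau> * (nrm p y)\<^sup>2) * W + s * (\<tau> * (nrm p y)\<^sup>2) * (1 + K * 0)
            + s * K * \<tau> * (\<bar>0\<bar> + \<bar>0 * (\<tau> * (nrm p y)\<^sup>2)\<bar>)\<^sup>2/2 + \<eta>/\<tau>"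
          by (intro tendsto_intros GS NS0 R cS0 q) simp_all
        have "\<forall>\<^sub>F k in sequentially. \<tau> * N (Suc k) < 1"
          using tendsto_mult[OF tendsto_const NS0, of \<tau>] by (intro order_tendstoD(2)) auto
        then have "\<forall>\<^sub>F k in sequentially. 0 \<le> L y + s * g y (Suc k) + N (Suc k) * R k * W + s * R k * (1 + K * c p (z (Suc k)))
            + s * K * \<tau> * (\<bar>ip (z (Suc k)) y p\<bar> + \<bar>N (Suc k) * R k\<bar>)\<^sup>2/2 + \<eta>/\<tau>"
        proof eventually_elim
          case (elim k)
          have "L (z (Suc k)) \<le> - (s - \<eta>) * N (Suc k)"
            using opt[of "Suc k"] Npos[of "Suc k"] by (simp add: pos_divide_le_eq)
          have "0 \<le> L y + s * (ip p (z (Suc k)) y / N (Suc k)) + N (Suc k) * R k * W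
              + s * (N (Suc k) * R k / N (Suc k)) * (1 + K * c p (z (Suc k)))
              + s * K * \<tau> * (\<bar>ip (z (Suc k)) y p\<bar> + \<bar>N (Suc k) * R k\<bar>)\<^sup>2/2 + \<eta>/\<tau>"
          unfolding L_def
          proof (rule gradient_step[OF I l less_imp_le[OF s] sL[unfolded L_def],
              of "z (Suc k)" "z k" "N (Suc k)" \<eta> \<tau> y, folded W_def, unfolded RE])
            show "\<tau> * N (Suc k) \<le> 1" using elim by simp
            show "nrm p (z (Suc k)) = nrm p (z k) / 2" "ip p (z (Suc k)) (z k) = (nrm p (z k))\<^sup>2 / 2"
              "ip p (z (Suc k)) v \<le> ip p (z k) v / 2" for v unfolding zS by (rule h)+
          qed (use Npos \<tau> \<open>L (z (Suc k)) \<le> _\<close>[unfolded L_def] in \<open>auto simp: N_def\<close>)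
          then show ?case using Npos[of "Suc k"] by (simp add: g_def)
        qed
        from tendsto_lowerbound[OF lim this] show ?thesis by (simp add: mult_ac)
      qed
      have "0 \<le> (\<Sum>i\<in>I. l i * (L (x i) + s * G (x i) + s * \<tau> * (nrm p (x i))\<^sup>2 + \<eta>/\<tau>))"
        by (intro sum_nonneg mult_nonneg_nonneg l grad)
      also have "\<dots> = (\<Sum>i\<in>I. l i * L (x i)) + s * (\<Sum>i\<in>I. l i * G (x i)) + s * \<tau> * B + (\<Sum>i\<in>I. l i) * (\<eta>/\<tau>)"
        unfolding B_def by (simp add: algebra_simps sum.distrib sum_distrib_left sum_distrib_right sum_divide_distrib)
      also have "s * (\<Sum>i\<in>I. l i * G (x i)) \<le> s * (- (s - \<eta>))"
        using GL s by (intro mult_left_mono) auto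
      \<comment> \<open>Inserting the direction functional into itself returns the near-maximal
        slope; this is where the sign of the double sum comes from.\<close>
      also have "s * (- (s - \<eta>)) \<le> s * \<eta>" using s by (simp add: algebra_simps)
      finally show ?thesis by simp
    qed
    have "(\<Sum>i\<in>I. l i * L (x i)) \<ge> 0"
    \<comment> \<open>Taking the square of \<open>t\<close> for \<eta> and \<open>t\<close> for
      \<tau> makes all errors, including the quotient \<eta> / \<tau>, vanish together.\<close>
    proof (rule tendsto_upperbound)
      show "((\<lambda>t. - s * t\<^sup>2 - s * t * B - (\<Sum>i\<in>I. l i) * t) \<longlongrightarrow> 0) (at_right 0)"
        by (rule tendsto_eq_intros refl | simp)+
      show "\<forall>\<^sub>F t in at_right 0. - s * t\<^sup>2 - s * t * B - (\<Sum>i\<in>I. l i) * t \<le> (\<Sum>i\<in>I. l i * L (x i))"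
        unfolding eventually_at_right_field
      proof (intro exI[of _ 1] conjI allI impI)
        fix t :: real assume "0 < t" "t < 1"
        then show "- s * t\<^sup>2 - s * t * B - (\<Sum>i\<in>I. l i) * t \<le> (\<Sum>i\<in>I. l i * L (x i))"
          using key[of "t\<^sup>2" t] by (simp add: power2_eq_square)
      qed simp
    qed simp
    then show ?thesis unfolding goal_eq .
  qed
qed

end

section \<open>Projections and weak compactness in spaces with the CN inequality\<close>

lemma infdist_almost_attain:
  assumes "infdist x C < r" "C \<noteq> {}"
  shows "\<exists>y\<in>C. dist x y < r"
proof -
  have "bdd_below (dist x ` C)" by (rule bdd_belowI2[of _ 0]) simp
  then show ?thesis using assms cINF_less_iff[of C "dist x" r] by (simp add: infdist_notempty)
qed

text \<open>The assumption is the CN inequality of Bruhat and Tits, a parallelogram law with an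
  inequality sign.\<close>

locale cn_space =
  fixes mid :: "'b::complete_space \<Rightarrow> 'b \<Rightarrow> 'b"
  assumes cn: "(dist z (mid x y))\<^sup>2 \<le> (dist z x)\<^sup>2 / 2 + (dist z y)\<^sup>2 / 2 - (dist x y)\<^sup>2 / 4"
begin

lemma dist_mid: "dist x (mid x y) \<le> dist x y / 2" "dist (mid x y) y \<le> dist x y / 2"
proof -
  have "(dist x (mid x y))\<^sup>2 \<le> (dist x y / 2)\<^sup>2" "(dist (mid x y) y)\<^sup>2 \<le> (dist x y / 2)\<^sup>2"
    using cn[of x x y] cn[of y x y] by (simp_all add: dist_commute power_divide)
  then show "dist x (mid x y) \<le> dist x y / 2" "dist (mid x y) y \<le> dist x y / 2"
    by (auto intro: power2_le_imp_le)
qed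

text \<open>Identifies \<open>mid\<close> with the midpoint of any geodesic.\<close>

lemma mid_unique:
  assumes "dist x m \<le> dist x y / 2" "dist m y \<le> dist x y / 2"
  shows "mid x y = m"
proof -
  have "(dist m x)\<^sup>2 \<le> (dist x y / 2)\<^sup>2" "(dist m y)\<^sup>2 \<le> (dist x y / 2)\<^sup>2"
    using assms by (auto intro!: power_mono simp: dist_commute)
  then have "(dist m x)\<^sup>2 \<le> (dist x y)\<^sup>2 / 4" "(dist m y)\<^sup>2 \<le> (dist x y)\<^sup>2 / 4"
    by (simp_all add: power_divide)
  then have "(dist m (mid x y))\<^sup>2 \<le> 0" using cn[of m x y] by linarith
  then show ?thesis by simp
qed

lemma mid_commute: "mid x y = mid y x"
  by (rule mid_unique) (use dist_mid[of y x] in \<open>auto simp: dist_commute\<close>)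

text \<open>Sum of two CN inequalities, one seen from \<open>mid x z\<close> and one from
  \<open>y\<close>; all terms but the distance of \<open>y\<close> and \<open>z\<close>
  cancel.\<close>

lemma dist_mid_mid1: "dist (mid x y) (mid x z) \<le> dist y z / 2"
proof -
  have "(dist x (mid x z))\<^sup>2 \<le> (dist x z / 2)\<^sup>2" using dist_mid(1)[of x z] by (intro power_mono) auto
  then have "(dist x (mid x z))\<^sup>2 \<le> (dist x z)\<^sup>2 / 4" by (simp add: power_divide)
  then have "(dist (mid x z) (mid x y))\<^sup>2 \<le> (dist y z)\<^sup>2 / 4"
    using cn[of "mid x z" x y] cn[of y x z]
    unfolding dist_commute[of y x] dist_commute[of x "mid x z"] dist_commute[of y "mid x z"] by linarith
  also have "\<dots> = (dist y z / 2)\<^sup>2" by (simp add: power_divide)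
  finally show ?thesis unfolding dist_commute[of "mid x y"] by (rule power2_le_imp_le) simp
qed

lemma dist_mid_mid: "dist (mid x y) (mid x' y') \<le> dist x x' / 2 + dist y y' / 2"
proof -
  have "dist (mid x y) (mid x' y') \<le> dist (mid x y) (mid x y') + dist (mid x y') (mid x' y')"
    by (rule dist_triangle)
  also have "dist (mid x y) (mid x y') \<le> dist y y' / 2" by (rule dist_mid_mid1)
  also have "dist (mid x y') (mid x' y') \<le> dist x x' / 2"
    unfolding mid_commute[of _ y'] by (rule dist_mid_mid1)
  finally show ?thesis by simp
qed

lemma tendsto_mid:
  assumes "(f \<longlongrightarrow> x) F" "(g \<longlongrightarrow> y) F"
  shows "((\<lambda>n. mid (f n) (g n)) \<longlongrightarrow> mid x y) F"
proof (rule metric_tendsto_imp_tendsto)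
  have "((\<lambda>n. dist (f n) x / 2 + dist (g n) y / 2) \<longlongrightarrow> dist x x / 2 + dist y y / 2) F"
    by (intro tendsto_add tendsto_divide tendsto_dist assms tendsto_const) auto
  then show "((\<lambda>n. dist (f n) x / 2 + dist (g n) y / 2) \<longlongrightarrow> 0) F" by simp
next
  have "dist (mid u v) (mid x y) \<le> dist (dist u x / 2 + dist v y / 2) 0" for u v
    using dist_mid_mid[of u v x y] by (simp add: dist_real_def)
  then show "\<forall>\<^sub>F n in F. dist (mid (f n) (g n)) (mid x y) \<le> dist (dist (f n) x / 2 + dist (g n) y / 2) 0"
    by simp
qed

definition mid_convex :: "'b set \<Rightarrow> bool" where
  "mid_convex C \<longleftrightarrow> (\<forall>x\<in>C. \<forall>y\<in>C. mid x y \<in> C)"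

lemma mid_convexD: "mid_convex C \<Longrightarrow> x \<in> C \<Longrightarrow> y \<in> C \<Longrightarrow> mid x y \<in> C"
  by (auto simp: mid_convex_def)

lemma mid_convex_Int: "mid_convex C \<Longrightarrow> mid_convex D \<Longrightarrow> mid_convex (C \<inter> D)"
  by (auto simp: mid_convex_def)

lemma dist_mid_le_max: "dist z (mid x y) \<le> max (dist z x) (dist z y)"
proof (rule power2_le_imp_le)
  have "(dist z x)\<^sup>2 \<le> (max (dist z x) (dist z y))\<^sup>2" "(dist z y)\<^sup>2 \<le> (max (dist z x) (dist z y))\<^sup>2"
    by (auto intro!: power_mono)
  then show "(dist z (mid x y))\<^sup>2 \<le> (max (dist z x) (dist z y))\<^sup>2"
    using cn[of z x y] zero_le_power2[of "dist x y"] by linarith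
qed (simp add: le_max_iff_disj)

lemma mid_convex_cball: "mid_convex (cball z r)"
  unfolding mid_convex_def mem_cball by (auto intro!: order_trans[OF dist_mid_le_max])

lemma mid_convex_closure: "mid_convex C \<Longrightarrow> mid_convex (closure C)"
  unfolding mid_convex_def[of "closure C"]
proof (intro ballI)
  fix x y
  assume C: "mid_convex C" and "x \<in> closure C" "y \<in> closure C"
  then obtain f g where f: "\<And>n. f n \<in> C" "f \<longlonglongrightarrow> x" and g: "\<And>n. g n \<in> C" "g \<longlonglongrightarrow> y"
    unfolding closure_sequential by blast
  then have "\<forall>n. mid (f n) (g n) \<in> C" using mid_convexD[OF C] by blast
  then show "mid x y \<in> closure C"
    unfolding closure_sequential using tendsto_mid[OF f(2) g(2)]
    by (intro exI[of _ "\<lambda>n. mid (f n) (g n)"] conjI)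
qed

lemma mid_convex_infdist_le:
  assumes C: "mid_convex C" "C \<noteq> {}"
  shows "mid_convex {y. infdist y C \<le> r}"
  unfolding mid_convex_def
proof (intro ballI CollectI)
  fix x y assume xy: "x \<in> {y. infdist y C \<le> r}" "y \<in> {y. infdist y C \<le> r}"
  show "infdist (mid x y) C \<le> r"
  proof (rule field_le_epsilon)
    fix e :: real assume e: "e > 0"
    obtain x' where x': "x' \<in> C" "dist x x' < r + e"
      using infdist_almost_attain[of x C "r + e"] xy e C(2) by auto
    obtain y' where y': "y' \<in> C" "dist y y' < r + e"
      using infdist_almost_attain[of y C "r + e"] xy e C(2) by auto
    have "infdist (mid x y) C \<le> dist (mid x y) (mid x' y')"
      using mid_convexD[OF C(1)] x' y' by (intro infdist_le) auto
    also have "\<dots> \<le> r + e" using dist_mid_mid[of x y x' y'] x' y' by simp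
    finally show "infdist (mid x y) C \<le> r + e" .
  qed
qed

text \<open>The midpoint of two almost nearest points lies in \<open>C\<close> and cannot beat
  \<open>infdist\<close>, so the negative term of CN has to be small.\<close>

lemma almost_nearest_close:
  assumes "mid_convex C" "x \<in> C" "y \<in> C" "dist o' x \<le> u" "dist o' y \<le> u"
  shows "(dist x y)\<^sup>2 \<le> 4 * (u\<^sup>2 - (infdist o' C)\<^sup>2)"
proof -
  have "infdist o' C \<le> dist o' (mid x y)"
    using assms mid_convexD infdist_le by metis
  then have "(infdist o' C)\<^sup>2 \<le> (dist o' (mid x y))\<^sup>2" using infdist_nonneg by (intro power_mono) auto
  moreover have "(dist o' x)\<^sup>2 \<le> u\<^sup>2" "(dist o' y)\<^sup>2 \<le> u\<^sup>2"
    using assms by (auto intro!: power_mono)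
  ultimately have "(dist x y)\<^sup>2 / 4 \<le> u\<^sup>2 - (infdist o' C)\<^sup>2" using cn[of o' x y] by linarith
  then show ?thesis by simp
qed

text \<open>Weak compactness: the points of the sets nearest to a fixed base point form a Cauchy net.\<close>
lemma directed_Inter_nonempty:
  assumes ne: "\<C> \<noteq> {}" "\<And>C. C \<in> \<C> \<Longrightarrow> C \<noteq> {}"
    and cl: "\<And>C. C \<in> \<C> \<Longrightarrow> closed C" and conv: "\<And>C. C \<in> \<C> \<Longrightarrow> mid_convex C"
    and dir: "\<And>C D. C \<in> \<C> \<Longrightarrow> D \<in> \<C> \<Longrightarrow> \<exists>E\<in>\<C>. E \<subseteq> C \<inter> D"
    and bd: "\<And>C. C \<in> \<C> \<Longrightarrow> infdist o' C \<le> b"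
  shows "\<Inter>\<C> \<noteq> {}"
proof -
  define r where "r = (SUP C\<in>\<C>. infdist o' C)"
  have bdd: "bdd_above ((infdist o') ` \<C>)" using bd by (intro bdd_aboveI2)
  have le_r: "infdist o' C \<le> r" if "C \<in> \<C>" for C unfolding r_def using that bdd by (rule cSUP_upper)
  define e where "e = (\<lambda>n. 1 / real (Suc n))"
  have e: "e n > 0" for n by (simp add: e_def)
  have e0: "e \<longlonglongrightarrow> 0" unfolding e_def using LIMSEQ_inverse_real_of_nat by (simp add: inverse_eq_divide)
  have "\<exists>C\<in>\<C>. r - e n < infdist o' C" for n
    using less_cSUP_iff[OF ne(1) bdd, of "r - e n"] e[of n] unfolding r_def by auto
  then obtain D where D: "\<And>n. D n \<in> \<C>" "\<And>n. r - e n < infdist o' (D n)" by metis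
  \<comment> \<open>Bounds the diameter of the part of \<open>D n\<close> within
    \<open>r + e n\<close> of the base point; it tends to 0 because \<open>infdist\<close> of
    \<open>D n\<close> tends to \<open>r\<close>.\<close>
  define \<delta> where "\<delta> = (\<lambda>n. sqrt (4 * ((r + e n)\<^sup>2 - (infdist o' (D n))\<^sup>2)))"
  have "(\<lambda>n. infdist o' (D n)) \<longlonglongrightarrow> r"
  proof (rule tendsto_sandwich)
    show "(\<lambda>n. r - e n) \<longlonglongrightarrow> r" using tendsto_diff[OF tendsto_const e0, of r] by simp
    show "(\<lambda>n. r) \<longlonglongrightarrow> r" by simp
  qed (use D le_r in \<open>auto intro!: always_eventually simp: less_imp_le\<close>)
  then have "\<delta> \<longlonglongrightarrow> sqrt (4 * ((r + 0)\<^sup>2 - r\<^sup>2))"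
    unfolding \<delta>_def by (intro tendsto_intros e0)
  then have \<delta>0: "\<delta> \<longlonglongrightarrow> 0" by simp
  have pick: "\<exists>x. x \<in> C \<and> dist o' x < r + a" if "C \<in> \<C>" "a > 0" for C a
    using infdist_almost_attain[of o' C "r + a"] le_r[OF that(1)] ne(2)[OF that(1)] that(2) by auto
  have one: "dist x y \<le> \<delta> n"
    if "x \<in> D n" "dist o' x \<le> r + e n" "y \<in> D n" "dist o' y \<le> r + e n" for x y n
    unfolding \<delta>_def using that D(1) conv by (intro real_le_rsqrt almost_nearest_close) auto
  have "\<exists>x. x \<in> D n \<and> dist o' x < r + e n" for n using pick D(1) e by blast
  then obtain p where p: "\<And>n. p n \<in> D n" "\<And>n. dist o' (p n) < r + e n" by metis
  have pp: "dist (p n) (p m) \<le> \<delta> n + \<delta> m" for n m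
  proof -
    \<comment> \<open>Points of different sets are compared through an almost nearest point of a
      common subset.\<close>
    obtain E where E: "E \<in> \<C>" "E \<subseteq> D n \<inter> D m" using dir[OF D(1) D(1), of n m] by blast
    obtain w where w: "w \<in> E" "dist o' w < r + min (e n) (e m)" using pick[OF E(1), of "min (e n) (e m)"] e by auto
    have "dist (p n) w \<le> \<delta> n" "dist (p m) w \<le> \<delta> m"
      using E w p[of n] p[of m] by (auto intro!: one)
    then show ?thesis using dist_triangle2[of "p n" "p m" w] by linarith
  qed
  have "Cauchy p"
  proof (rule metric_CauchyI)
    fix \<epsilon> :: real assume "\<epsilon> > 0"
    then have "\<forall>\<^sub>F n in sequentially. \<delta> n < \<epsilon>/2" by (intro order_tendstoD(2)[OF \<delta>0]) simp
    then obtain M where "\<forall>n\<ge>M. \<delta> n < \<epsilon>/2" by (auto simp: eventually_sequentially)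
    then have "dist (p m) (p n) < \<epsilon>" if "m \<ge> M" "n \<ge> M" for m n
      using pp[of m n] that by (smt (verit) field_sum_of_halves)
    then show "\<exists>M. \<forall>m\<ge>M. \<forall>n\<ge>M. dist (p m) (p n) < \<epsilon>" by blast
  qed
  then obtain P where P: "p \<longlonglongrightarrow> P" using Cauchy_convergent_iff convergent_def by metis
  have "P \<in> C" if C: "C \<in> \<C>" for C
  proof -
    \<comment> \<open>The limit comes from the sequence \<open>D\<close> alone; it reaches an
      arbitrary \<open>C\<close> since \<open>C \<inter> D n\<close> contains almost nearest points,
      all \<delta>-close to \<open>p n\<close>.\<close>
    have "\<exists>q. q \<in> C \<and> dist (p n) q \<le> \<delta> n" for n
    proof -
      obtain E where E: "E \<in> \<C>" "E \<subseteq> C \<inter> D n" using dir[OF C D(1), of n] by blast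
      obtain w where w: "w \<in> E" "dist o' w < r + e n" using pick[OF E(1) e] by blast
      have "dist (p n) w \<le> \<delta> n" using E w p[of n] by (auto intro!: one)
      then show ?thesis using E w by auto
    qed
    then obtain q where q: "\<And>n. q n \<in> C" "\<And>n. dist (p n) (q n) \<le> \<delta> n" by metis
    have lim: "(\<lambda>n. \<delta> n + dist (p n) P) \<longlonglongrightarrow> 0"
      using tendsto_add[OF \<delta>0 iffD1[OF tendsto_dist_iff P]] by simp
    have "dist (q n) P \<le> \<delta> n + dist (p n) P" for n
      using dist_triangle3[of "q n" P "p n"] q(2)[of n] by linarith
    then have "(\<lambda>n. dist (q n) P) \<longlonglongrightarrow> 0"
      by (intro tendsto_sandwich[OF always_eventually always_eventually tendsto_const lim] allI) auto
    then have "q \<longlonglongrightarrow> P" by (rule iffD2[OF tendsto_dist_iff])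
    then show "P \<in> C" using cl[OF C] q(1) unfolding closed_sequential_limits by blast
  qed
  then show ?thesis by blast
qed

section \<open>Nearest-point projections onto closed convex sets\<close>

definition proj :: "'b set \<Rightarrow> 'b \<Rightarrow> 'b" where
  "proj C p = (SOME u. u \<in> C \<and> (\<forall>z\<in>C. dist p u \<le> dist p z))"

context
  fixes C :: "'b set"
  assumes C: "C \<noteq> {}" "closed C" "mid_convex C"
begin

lemma proj: "proj C p \<in> C" "z \<in> C \<Longrightarrow> dist p (proj C p) \<le> dist p z"
proof -
  \<comment> \<open>Nested nonempty near-minimal slices; any common point attains the distance to
    \<open>C\<close>.\<close>
  define F where "F = (\<lambda>n::nat. C \<inter> cball p (infdist p C + 1 / real (Suc n)))"
  have "\<Inter>(range F) \<noteq> {}"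
  proof (rule directed_Inter_nonempty[where o' = p and b = "infdist p C + 1"])
    fix A assume "A \<in> range F"
    then obtain n where A: "A = F n" by auto
    show "A \<noteq> {}"
      using infdist_almost_attain[of p C "infdist p C + 1 / real (Suc n)"] C(1) by (force simp: A F_def)
    then obtain u where u: "u \<in> A" by auto
    then have "infdist p A \<le> dist p u" by (rule infdist_le)
    also have "\<dots> \<le> infdist p C + 1 / real (Suc n)" using u by (simp add: A F_def)
    also have "1 / real (Suc n) \<le> 1" by simp
    finally show "infdist p A \<le> infdist p C + 1" by simp
    show "closed A" using C(2) by (auto simp: A F_def)
    show "mid_convex A" unfolding A F_def by (intro mid_convex_Int mid_convex_cball C)
  next
    fix A B assume "A \<in> range F" "B \<in> range F"
    then obtain n m where nm: "A = F n" "B = F m" by auto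
    have "F (max n m) \<subseteq> F n \<inter> F m"
      unfolding F_def by (intro Int_greatest Int_mono order_refl subset_cball) (auto simp: frac_le)
    then show "\<exists>E\<in>range F. E \<subseteq> A \<inter> B" unfolding nm by blast
  qed simp
  then obtain u where u: "\<And>n. u \<in> F n" by blast
  have "dist p u \<le> infdist p C"
  proof (rule LIMSEQ_le_const)
    show "(\<lambda>n. infdist p C + 1 / real (Suc n)) \<longlonglongrightarrow> infdist p C"
      using tendsto_add[OF tendsto_const LIMSEQ_inverse_real_of_nat, of "infdist p C"]
      by (simp add: inverse_eq_divide)
  qed (use u in \<open>auto simp: F_def\<close>)
  then have "u \<in> C \<and> (\<forall>z\<in>C. dist p u \<le> dist p z)"
    using u infdist_le order_trans unfolding F_def by blast
  then have "proj C p \<in> C \<and> (\<forall>z\<in>C. dist p (proj C p) \<le> dist p z)"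
    unfolding proj_def by (rule someI)
  then show "proj C p \<in> C" "z \<in> C \<Longrightarrow> dist p (proj C p) \<le> dist p z" by auto
qed

lemma proj_fixed: "p \<in> C \<Longrightarrow> proj C p = p"
  using proj(2)[of p p] by simp

text \<open>Bisecting \<open>[proj C p, z]\<close> improves the factor \<open>\<theta>\<close> of the second term to \<open>(1 + \<theta>) / 2\<close>.\<close>
lemma proj_obtuse:
  assumes "z \<in> C"
  shows "(dist p (proj C p))\<^sup>2 + (dist (proj C p) z)\<^sup>2 \<le> (dist p z)\<^sup>2"
proof -
  let ?u = "proj C p"
  have *: "(dist p ?u)\<^sup>2 + (1 - (1/2)^n) * (dist ?u z)\<^sup>2 \<le> (dist p z)\<^sup>2" if "z \<in> C" for n z
    using that
  proof (induction n arbitrary: z)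
    case 0
    then show ?case using proj(2) by (simp add: power_mono)
  next
    case (Suc n)
    let ?m = "mid ?u z"
    have "dist ?u z \<le> dist ?u ?m + dist ?m z" by (rule dist_triangle)
    then have "dist ?u z / 2 = dist ?u ?m" using dist_mid[of ?u z] by linarith
    moreover have "(dist p ?u)\<^sup>2 + (1 - (1/2)^n) * (dist ?u ?m)\<^sup>2 \<le> (dist p ?m)\<^sup>2"
      using Suc proj(1) mid_convexD[OF C(3)] by blast
    ultimately have "(dist p ?u)\<^sup>2 + (1 - (1/2)^n) * (dist ?u z / 2)\<^sup>2
        \<le> (dist p ?u)\<^sup>2 / 2 + (dist p z)\<^sup>2 / 2 - (dist ?u z)\<^sup>2 / 4"
      using cn[of p ?u z] by simp
    then show ?case by (simp add: power_divide field_simps)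
  qed
  show ?thesis
  proof (rule LIMSEQ_le_const2)
    have "(\<lambda>n. (dist p ?u)\<^sup>2 + (1 - (1/2)^n) * (dist ?u z)\<^sup>2) \<longlonglongrightarrow> (dist p ?u)\<^sup>2 + (1 - 0) * (dist ?u z)\<^sup>2"
      by (intro tendsto_intros LIMSEQ_realpow_zero) auto
    then show "(\<lambda>n. (dist p ?u)\<^sup>2 + (1 - (1/2)^n) * (dist ?u z)\<^sup>2) \<longlonglongrightarrow> (dist p ?u)\<^sup>2 + (dist ?u z)\<^sup>2"
      by simp
  qed (use * assms in auto)
qed

text \<open>CN at the midpoint of a diagonal gives the quadrilateral inequality for
  \<open>p\<close>, \<open>q\<close> and their projections; the two obtuse angles at the projections
  turn it into the claim.\<close>

lemma proj_nonexpansive: "dist (proj C p) (proj C q) \<le> dist p q"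
proof -
  let ?u = "proj C p" and ?v = "proj C q"
  have 1: "(dist p ?u)\<^sup>2 + (dist ?u ?v)\<^sup>2 \<le> (dist p ?v)\<^sup>2" "(dist q ?v)\<^sup>2 + (dist ?v ?u)\<^sup>2 \<le> (dist q ?u)\<^sup>2"
    by (intro proj_obtuse proj(1))+
  let ?m = "mid p ?v"
  have "dist q ?u \<le> dist q ?m + dist ?u ?m" by (rule dist_triangle2)
  then have "(dist q ?u)\<^sup>2 \<le> (dist q ?m + dist ?u ?m)\<^sup>2" by (intro power_mono) auto
  also have "\<dots> \<le> 2 * (dist q ?m)\<^sup>2 + 2 * (dist ?u ?m)\<^sup>2"
    using sum_squares_bound[of "dist q ?m" "dist ?u ?m"] by (simp add: power2_sum)
  finally have "(dist ?u ?v)\<^sup>2 \<le> (dist p q)\<^sup>2"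
    using cn[of q p ?v] cn[of ?u p ?v] 1
    unfolding dist_commute[of q p] dist_commute[of ?u p] dist_commute[of ?v ?u] by linarith
  then show ?thesis by (rule power2_le_imp_le) simp
qed

end

text \<open>A point of \<open>C\<close> close to \<open>proj D p\<close> is almost as near to
  \<open>p\<close> as \<open>proj C p\<close> is, and \<open>proj_obtuse\<close> then forces the two
  together. The radius \<open>r\<close> enters because squared distances are compared.\<close>

lemma proj_perturb:
  assumes C: "C \<noteq> {}" "closed C" "mid_convex C" and D: "D \<noteq> {}" "closed D" "mid_convex D"
    and CD: "\<And>y. y \<in> C \<Longrightarrow> infdist y D \<le> e" and DC: "\<And>y. y \<in> D \<Longrightarrow> infdist y C \<le> e"
    and r: "dist p (proj C p) \<le> r" and e: "e \<ge> 0"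
  shows "dist (proj C p) (proj D p) \<le> e + 2 * sqrt (e * r + e\<^sup>2)"
proof -
  let ?u = "proj C p" and ?v = "proj D p"
  have att: "\<exists>y'\<in>S. dist y y' \<le> e" if "S \<noteq> {}" "closed S" "mid_convex S" "infdist y S \<le> e" for y S
  proof -
    have "dist y (proj S y) \<le> infdist y S"
      unfolding infdist_notempty[OF that(1)]
      by (rule cINF_greatest[OF that(1)]) (rule proj(2)[OF that(1-3)])
    then show ?thesis using that(4) by (intro bexI[OF _ proj(1)[OF that(1-3), of y]]) linarith
  qed
  obtain u' where u': "u' \<in> D" "dist ?u u' \<le> e" using att[OF D CD[OF proj(1)[OF C]]] by blast
  obtain v' where v': "v' \<in> C" "dist ?v v' \<le> e" using att[OF C DC[OF proj(1)[OF D]]] by blast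
  have "dist p ?v \<le> dist p ?u + e"
    using proj(2)[OF D u'(1), of p] dist_triangle[of p u' ?u] u'(2) by linarith
  then have "dist p v' \<le> dist p ?u + 2 * e" using dist_triangle[of p v' ?v] v'(2) by linarith
  then have "(dist p v')\<^sup>2 \<le> (dist p ?u + 2 * e)\<^sup>2" by (intro power_mono) auto
  then have "(dist ?u v')\<^sup>2 \<le> 4 * (e * dist p ?u + e\<^sup>2)"
    using proj_obtuse[OF C v'(1), of p] by (simp add: power2_sum power_mult_distrib algebra_simps)
  also have "\<dots> \<le> 4 * (e * r + e\<^sup>2)" using r e by (simp add: mult_left_mono)
  finally have "dist ?u v' \<le> sqrt (4 * (e * r + e\<^sup>2))" by (rule real_le_rsqrt)
  then have "dist ?u v' \<le> 2 * sqrt (e * r + e\<^sup>2)" unfolding real_sqrt_mult by simp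
  then show ?thesis using dist_triangle2[of ?u ?v v'] v'(2) by linarith
qed

end

section \<open>Intersections of balls in CAT spaces\<close>

locale cat_gauge =
  fixes K :: real and c :: "'p \<Rightarrow> 'p \<Rightarrow> real" and ip :: "'p \<Rightarrow> 'p \<Rightarrow> 'p \<Rightarrow> real"
    and nrm :: "'p \<Rightarrow> 'p \<Rightarrow> real"
  defines "ip \<equiv> \<lambda>p x y. c p x + c p y + K * c p x * c p y - c x y"
    and "nrm \<equiv> \<lambda>p x. sqrt (2 * c p x + K * (c p x)\<^sup>2)"
  assumes K: "K \<ge> 0" and c_nonneg: "c x y \<ge> 0"
    and expand: "0 \<le> \<nu> \<Longrightarrow> \<nu> \<le> 1 \<Longrightarrow>
      \<exists>w. nrm p w = \<nu> * nrm p z \<and> (\<forall>y. \<nu> * ip p z y \<le> ip p w y)"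
begin

text \<open>First variation in the direction opposite to the CBB case, an upper bound. The quadratic
  error is uniform over all \<open>y\<close> within gauge \<open>b\<close> of
  \<open>q\<close>.\<close>

lemma move_towards:
  assumes "0 \<le> \<nu>" "\<nu> \<le> 1" "c q z \<le> b"
  shows "\<exists>w. \<forall>y. c q y \<le> b \<longrightarrow> c w y \<le> c q y - \<nu> * ip q z y + \<nu>\<^sup>2 * ((b + K * b\<^sup>2 / 2) * (1 + K * b))"
proof -
  obtain w where w: "nrm q w = \<nu> * nrm q z" "\<And>y. \<nu> * ip q z y \<le> ip q w y"
    using expand[OF assms(1,2)] by blast
  have sq: "(nrm q v)\<^sup>2 = 2 * c q v + K * (c q v)\<^sup>2" for v
    unfolding nrm_def using K c_nonneg[of q v] by simp
  have "2 * c q w \<le> (nrm q w)\<^sup>2" unfolding sq using K by simp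
  also have "\<dots> = \<nu>\<^sup>2 * (2 * c q z + K * (c q z)\<^sup>2)" unfolding w(1) power_mult_distrib sq ..
  also have "\<dots> \<le> \<nu>\<^sup>2 * (2 * b + K * b\<^sup>2)"
    using assms(3) K c_nonneg by (intro mult_left_mono add_mono power_mono) auto
  finally have cw: "c q w \<le> \<nu>\<^sup>2 * (b + K * b\<^sup>2 / 2)" by (simp add: algebra_simps)
  show ?thesis
  proof (intro exI[of _ w] allI impI)
    fix y assume y: "c q y \<le> b"
    have "c w y = c q y + c q w * (1 + K * c q y) - ip q w y"
      unfolding ip_def by (simp add: algebra_simps)
    also have "\<dots> \<le> c q y + (\<nu>\<^sup>2 * (b + K * b\<^sup>2 / 2)) * (1 + K * b) - \<nu> * ip q z y"
      using cw y K c_nonneg w(2)[of y] assms(3) order_trans[OF c_nonneg assms(3)]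
      by (intro diff_mono add_mono mult_mono mult_left_mono order_refl) auto
    finally show "c w y \<le> c q y - \<nu> * ip q z y + \<nu>\<^sup>2 * ((b + K * b\<^sup>2 / 2) * (1 + K * b))"
      by (simp add: mult.assoc)
  qed
qed

text \<open>Near a minimiser of the squared excess \<open>\<Sum>i\<in>S. (max 0 (c q (y i) - a i))\<^sup>2\<close>, moving towards each
  \<open>y j\<close> gives a first-order inequality; summing these with the excesses as weights contradicts
  the inequality between the \<open>a i\<close> and the \<open>d i j\<close> unless the minimum is zero.\<close>
theorem finite_ball_intersection:
  fixes S :: "'i set" and y :: "'i \<Rightarrow> 'p" and a :: "'i \<Rightarrow> real"
  assumes S: "finite S" and a: "\<And>i. i \<in> S \<Longrightarrow> a i \<ge> 0"
    and d: "\<And>i j. i \<in> S \<Longrightarrow> j \<in> S \<Longrightarrow> c (y i) (y j) \<le> d i j"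
    and LS: "\<And>l. (\<And>i. i \<in> S \<Longrightarrow> l i \<ge> 0) \<Longrightarrow>
      0 \<le> (\<Sum>i\<in>S. \<Sum>j\<in>S. l i * l j * (a i + a j + K * a i * a j - d i j))"
    and \<epsilon>: "\<epsilon> > 0"
  shows "\<exists>q. \<forall>i\<in>S. c q (y i) \<le> a i + \<epsilon>"
proof -
  define f where "f = (\<lambda>q i. max 0 (c q (y i) - a i))"
  define \<Phi> where "\<Phi> = (\<lambda>q. \<Sum>i\<in>S. (f q i)\<^sup>2)"
  have f0: "f q i \<ge> 0" for q i by (simp add: f_def)
  have \<Phi>0: "\<Phi> q \<ge> 0" for q unfolding \<Phi>_def by (intro sum_nonneg) simp
  have f_le: "f q i \<le> sqrt (\<Phi> q)" if "i \<in> S" for q i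
    unfolding \<Phi>_def by (intro real_le_rsqrt member_le_sum that S) auto
  define m where "m = (INF q. \<Phi> q)"
  have m_le: "m \<le> \<Phi> q" for q unfolding m_def by (intro cINF_lower bdd_belowI2[of _ 0] \<Phi>0) simp
  have m_att: "\<exists>q. \<Phi> q < m + r" if "r > 0" for r
  proof -
    have "bdd_below (range \<Phi>)" by (intro bdd_belowI2[of _ 0] \<Phi>0)
    then show ?thesis using cINF_less_iff[of UNIV \<Phi> "m + r"] that by (simp add: m_def)
  qed
  show ?thesis
  proof (cases "m < \<epsilon>\<^sup>2")
    case True
    then obtain q where "\<Phi> q < \<epsilon>\<^sup>2" using m_att[of "\<epsilon>\<^sup>2 - m"] by auto
    then have "sqrt (\<Phi> q) \<le> \<epsilon>" using \<epsilon> by (intro real_le_lsqrt) auto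
    then have "f q i \<le> \<epsilon>" if "i \<in> S" for i using f_le[OF that, of q] by simp
    moreover have "c q (y i) - a i \<le> f q i" for i by (simp add: f_def)
    ultimately show ?thesis by (intro exI[of _ q]) (smt (verit))
  next
    case False
    then have m: "m > 0" using \<epsilon> by (smt (verit) zero_less_power)
    define s where "s = sqrt (m + 1)"
    define b where "b = (\<Sum>i\<in>S. a i) + s"
    define C where "C = (\<Sum>i\<in>S. \<Sum>j\<in>S. c (y i) (y j))"
    define B where "B = (b + K * b\<^sup>2 / 2) * (1 + K * b)"
    define T where "T = 2 * b + K * b\<^sup>2 + C + B"
    define n where "n = real (card S)"
    define D where "D = (1 + 2 * B * (n * s) + n * T\<^sup>2) / 2"
    have s: "s \<ge> 0" using m by (simp add: s_def)
    have b: "b \<ge> 0" unfolding b_def using a s by (simp add: sum_nonneg)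
    have B: "B \<ge> 0" unfolding B_def using b K by simp
    have D: "D \<ge> 0" unfolding D_def using B s by (simp add: n_def)
    \<comment> \<open>Small enough that the first-order error \<nu> * D, weighted with the excesses,
      stays below the lower bound \<open>2 * (m * sqrt m)\<close> reached at the end.\<close>
    define \<nu> where "\<nu> = min 1 (m * sqrt m / (D * (n * s) + 1))"
    have nsD: "D * (n * s) \<ge> 0" using D s by (simp add: n_def)
    have \<nu>: "\<nu> > 0" "\<nu> \<le> 1" using m nsD by (auto simp: \<nu>_def)
    \<comment> \<open>The slack is of the same order as the quadratic error of a step of size \<nu>,
      so it does not spoil the first-order inequality.\<close>
    obtain q where q: "\<Phi> q < m + \<nu>\<^sup>2" using m_att[of "\<nu>\<^sup>2"] \<nu> by auto
    have "\<nu>\<^sup>2 \<le> 1" using \<nu> by (simp add: power_le_one)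
    then have "sqrt (\<Phi> q) \<le> s" unfolding s_def using q by simp
    then have fs: "f q i \<le> s" if "i \<in> S" for i using f_le[OF that, of q] by simp
    have cb: "c q (y i) \<le> b" if "i \<in> S" for i
    proof -
      have "a i \<le> (\<Sum>i\<in>S. a i)" using that S a by (intro member_le_sum) auto
      then show ?thesis using fs[OF that] by (simp add: f_def b_def)
    qed
    have cC: "c (y i) (y j) \<le> C" if "i \<in> S" "j \<in> S" for i j
    proof -
      have "c (y i) (y j) \<le> (\<Sum>j\<in>S. c (y i) (y j))"
        using that S c_nonneg by (intro member_le_sum) auto
      also have "\<dots> \<le> C" unfolding C_def
        using that S c_nonneg by (intro member_le_sum[of i S "\<lambda>i. \<Sum>j\<in>S. c (y i) (y j)"]) (auto intro: sum_nonneg)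
      finally show ?thesis .
    qed
    define \<Lambda> where "\<Lambda> = (\<Sum>i\<in>S. f q i)"
    have \<Lambda>ns: "\<Lambda> \<le> n * s" unfolding \<Lambda>_def n_def using sum_bounded_above[of S "f q" s] fs by simp
    have \<Lambda>0: "\<Lambda> \<ge> 0" unfolding \<Lambda>_def using f0 by (intro sum_nonneg)
    have first_order: "(\<Sum>i\<in>S. f q i * ip q (y j) (y i)) \<le> \<nu> * D" if j: "j \<in> S" for j
    proof -
      obtain w where w: "\<And>v. c q v \<le> b \<Longrightarrow> c w v \<le> c q v - \<nu> * ip q (y j) v + \<nu>\<^sup>2 * B"
        using move_towards[of \<nu> q "y j" b] \<nu> cb[OF j] unfolding B_def by auto
      define t where "t = (\<lambda>i. \<nu>\<^sup>2 * B - \<nu> * ip q (y j) (y i))"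
      have t: "(t i)\<^sup>2 \<le> \<nu>\<^sup>2 * T\<^sup>2" if i: "i \<in> S" for i
      proof -
        have "\<bar>ip q (y j) (y i)\<bar> \<le> 2 * b + K * b\<^sup>2 + C"
        proof -
          have "0 \<le> K * c q (y j) * c q (y i)" using K c_nonneg by simp
          moreover have "K * c q (y j) * c q (y i) \<le> K * b * b"
            using cb[OF i] cb[OF j] K c_nonneg b by (intro mult_mono) auto
          ultimately show ?thesis
            using cb[OF i] cb[OF j] cC[OF j i] c_nonneg[of q "y i"] c_nonneg[of q "y j"] c_nonneg[of "y j" "y i"]
            unfolding ip_def power2_eq_square by linarith
        qed
        then have "\<bar>\<nu> * B - ip q (y j) (y i)\<bar> \<le> T"
          unfolding T_def using mult_right_mono[OF \<nu>(2) B] \<nu>(1) B mult_nonneg_nonneg[of \<nu> B] by linarith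
        then have "(\<nu> * B - ip q (y j) (y i))\<^sup>2 \<le> T\<^sup>2" by (simp add: abs_le_square_iff[symmetric])
        then have "\<nu>\<^sup>2 * (\<nu> * B - ip q (y j) (y i))\<^sup>2 \<le> \<nu>\<^sup>2 * T\<^sup>2" by (intro mult_left_mono) auto
        then show ?thesis unfolding t_def power_mult_distrib[symmetric] by (simp add: power2_eq_square algebra_simps)
      qed
      have step: "(f w i)\<^sup>2 \<le> (f q i)\<^sup>2 + 2 * f q i * t i + \<nu>\<^sup>2 * T\<^sup>2" if i: "i \<in> S" for i
      proof -
        have "c w (y i) \<le> c q (y i) + t i" using w[OF cb[OF i]] by (simp add: t_def)
        then have "f w i \<le> \<bar>f q i + t i\<bar>" by (auto simp: f_def max_def)
        then have "(f w i)\<^sup>2 \<le> (f q i + t i)\<^sup>2" using f0[of w i] by (simp add: abs_le_square_iff[symmetric])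
        then show ?thesis using t[OF i] by (simp add: power2_sum)
      qed
      have "m \<le> \<Phi> w" by (rule m_le)
      also have "\<dots> \<le> (\<Sum>i\<in>S. (f q i)\<^sup>2 + 2 * f q i * t i + \<nu>\<^sup>2 * T\<^sup>2)"
        unfolding \<Phi>_def by (intro sum_mono step)
      also have "\<dots> = \<Phi> q + 2 * (\<nu>\<^sup>2 * B * \<Lambda> - \<nu> * (\<Sum>i\<in>S. f q i * ip q (y j) (y i))) + n * (\<nu>\<^sup>2 * T\<^sup>2)"
      proof -
        have "(\<Sum>i\<in>S. f q i * t i) = \<nu>\<^sup>2 * B * \<Lambda> - \<nu> * (\<Sum>i\<in>S. f q i * ip q (y j) (y i))"
          unfolding t_def \<Lambda>_def by (simp add: right_diff_distrib sum_subtractf sum_distrib_left sum_distrib_right mult_ac)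
        then show ?thesis
          unfolding \<Phi>_def n_def by (simp add: sum.distrib mult.assoc flip: sum_distrib_left)
      qed
      also have "\<dots> \<le> m + \<nu>\<^sup>2 + 2 * (\<nu>\<^sup>2 * B * (n * s) - \<nu> * (\<Sum>i\<in>S. f q i * ip q (y j) (y i))) + n * (\<nu>\<^sup>2 * T\<^sup>2)"
        using q mult_left_mono[OF \<Lambda>ns, of "\<nu>\<^sup>2 * B"] B by simp
      finally have "\<nu> * (\<Sum>i\<in>S. f q i * ip q (y j) (y i)) \<le> \<nu> * (\<nu> * D)"
        unfolding D_def by (simp add: power2_eq_square algebra_simps)
      then show ?thesis using \<nu>(1) by simp
    qed
    have "(\<Sum>j\<in>S. f q j * (\<Sum>i\<in>S. f q i * ip q (y j) (y i))) \<le> (\<Sum>j\<in>S. f q j * (\<nu> * D))"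
      by (intro sum_mono mult_left_mono first_order f0)
    also have "\<dots> = \<nu> * (D * \<Lambda>)" by (simp add: \<Lambda>_def sum_distrib_left sum_distrib_right mult_ac)
    also have "\<dots> \<le> \<nu> * (D * (n * s))" using \<nu> D \<Lambda>ns by (intro mult_left_mono) auto
    also have "\<dots> \<le> (m * sqrt m / (D * (n * s) + 1)) * (D * (n * s))"
      using nsD by (intro mult_right_mono) (simp_all add: \<nu>_def)
    also have "\<dots> < m * sqrt m + m * sqrt m"
    proof -
      have "(m * sqrt m) * (D * (n * s)) \<le> (m * sqrt m) * (D * (n * s) + 1)"
        using m by (intro mult_left_mono) auto
      then have "(m * sqrt m / (D * (n * s) + 1)) * (D * (n * s)) \<le> m * sqrt m"
        using nsD by (simp add: field_simps)
      moreover have "m * sqrt m > 0" using m by simp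
      ultimately show ?thesis by linarith
    qed
    finally have upper: "(\<Sum>j\<in>S. f q j * (\<Sum>i\<in>S. f q i * ip q (y j) (y i))) < 2 * (m * sqrt m)" by simp
    define u where "u = (\<Sum>i\<in>S. f q i * c q (y i))"
    define \<rho> where "\<rho> = (\<Sum>i\<in>S. f q i * a i)"
    have "u - \<rho> = \<Phi> q"
      unfolding u_def \<rho>_def \<Phi>_def sum_subtractf[symmetric]
      by (intro sum.cong refl) (auto simp: f_def max_def power2_eq_square algebra_simps)
    then have um: "u - \<rho> \<ge> m" using m_le[of q] by simp
    have \<rho>0: "\<rho> \<ge> 0" unfolding \<rho>_def by (intro sum_nonneg mult_nonneg_nonneg f0 a)
    have "sqrt m \<le> sqrt (\<Phi> q)" using m_le by simp
    also have "\<dots> \<le> \<Lambda>" using L2_set_le_sum[of S "f q"] f0 unfolding \<Phi>_def \<Lambda>_def L2_set_def by simp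
    finally have \<Lambda>m: "sqrt m \<le> \<Lambda>" .
    have expand2: "(\<Sum>i\<in>S. \<Sum>j\<in>S. f q i * f q j * (g i + g j + K * g i * g j - e i j))
        = 2 * \<Lambda> * (\<Sum>i\<in>S. f q i * g i) + K * (\<Sum>i\<in>S. f q i * g i)\<^sup>2 - (\<Sum>i\<in>S. \<Sum>j\<in>S. f q i * f q j * e i j)"
      for g :: "'i \<Rightarrow> real" and e :: "'i \<Rightarrow> 'i \<Rightarrow> real"
    proof -
      have 1: "(\<Sum>i\<in>S. \<Sum>j\<in>S. f q i * f q j * g i) = \<Lambda> * (\<Sum>i\<in>S. f q i * g i)"
        unfolding \<Lambda>_def sum_product by (subst sum.swap) (simp add: mult_ac)
      have 2: "(\<Sum>i\<in>S. \<Sum>j\<in>S. f q i * f q j * g j) = \<Lambda> * (\<Sum>i\<in>S. f q i * g i)"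
        unfolding \<Lambda>_def sum_product by (simp add: mult_ac)
      have 3: "(\<Sum>i\<in>S. \<Sum>j\<in>S. f q i * f q j * (K * g i * g j)) = K * (\<Sum>i\<in>S. f q i * g i)\<^sup>2"
        unfolding power2_eq_square sum_product by (simp add: sum_distrib_left mult_ac)
      show ?thesis
        unfolding ring_distribs sum.distrib sum_subtractf 1 2 3 by simp
    qed
    \<comment> \<open>With the excesses as weights, \<open>LS\<close> concerns \<rho>, the weighted
      sum of the \<open>a i\<close>, and \<open>upper\<close> concerns \<open>u\<close>, that of the
      actual gauges. The difference \<open>u - \<rho>\<close> is the total squared excess, at least
      \<open>m\<close>.\<close>
    have "(u - \<rho>) * (2 * \<Lambda> + K * (u + \<rho>)) = (2 * \<Lambda> * u + K * u\<^sup>2) - (2 * \<Lambda> * \<rho> + K * \<rho>\<^sup>2)"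
      by (simp add: power2_eq_square algebra_simps)
    also have "\<dots> \<le> (2 * \<Lambda> * u + K * u\<^sup>2) - (\<Sum>i\<in>S. \<Sum>j\<in>S. f q i * f q j * d i j)"
      using LS[of "f q"] f0 unfolding expand2 \<rho>_def by simp
    also have "\<dots> \<le> (2 * \<Lambda> * u + K * u\<^sup>2) - (\<Sum>i\<in>S. \<Sum>j\<in>S. f q i * f q j * c (y i) (y j))"
      by (intro diff_left_mono sum_mono mult_left_mono d mult_nonneg_nonneg f0)
    also have "\<dots> = (\<Sum>j\<in>S. f q j * (\<Sum>i\<in>S. f q i * ip q (y j) (y i)))"
      unfolding u_def expand2[symmetric] ip_def by (simp add: sum_distrib_left mult_ac)
    finally have "(u - \<rho>) * (2 * \<Lambda> + K * (u + \<rho>)) < 2 * (m * sqrt m)" using upper by simp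
    moreover have "m * (2 * sqrt m) \<le> (u - \<rho>) * (2 * \<Lambda> + K * (u + \<rho>))"
    proof (intro mult_mono)
      have "K * (u + \<rho>) \<ge> 0" using K um m \<rho>0 by (intro mult_nonneg_nonneg) auto
      then show "2 * sqrt m \<le> 2 * \<Lambda> + K * (u + \<rho>)" using \<Lambda>m by linarith
    qed (use um m in auto)
    ultimately show ?thesis by simp
  qed
qed

end

section \<open>Hulls and the abstract extension theorem\<close>

lemma md_unbounded:
  assumes "K \<ge> 0" "v \<ge> 0"
  shows "\<exists>b\<ge>0. v \<le> md K b"
proof (cases "K = 0")
  case True
  then show ?thesis using assms by (intro exI[of _ "sqrt (2 * v)"]) (simp add: md_def)
next
  case False
  define b where "b = (1 + 2 * K * v) / sqrt K"
  have "1 + K * v \<le> exp (sqrt K * b) / 2"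
    using exp_ge_add_one_self[of "sqrt K * b"] False assms by (simp add: b_def)
  also have "\<dots> \<le> cosh (sqrt K * b)" by (simp add: cosh_def)
  finally have "v \<le> md K b" using False assms by (simp add: md_def pos_le_divide_eq mult.commute)
  moreover have "b \<ge> 0" using assms by (simp add: b_def)
  ultimately show ?thesis by blast
qed

lemma md_convex:
  assumes K: "K \<ge> 0" and \<theta>: "0 \<le> \<theta>" "\<theta> \<le> 1"
  shows "md K ((1 - \<theta>) * s + \<theta> * t) \<le> (1 - \<theta>) * md K s + \<theta> * md K t"
proof -
  have "convex_on UNIV (md K)"
  proof (rule f''_ge0_imp_convex)
    show "(md K has_real_derivative sn K t) (at t)" for t
      using K unfolding md_def sn_def
      by (cases "K = 0") (auto intro!: derivative_eq_intros simp: field_simps)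
    show "(sn K has_real_derivative 1 + K * md K t) (at t)" for t
      using K unfolding md_def sn_def
      by (cases "K = 0") (auto intro!: derivative_eq_intros simp: field_simps)
    show "0 \<le> 1 + K * md K t" for t using K md_nonneg[of K t] by simp
  qed simp
  then show ?thesis using convex_onD[of UNIV "md K" \<theta> s t] \<theta> by simp
qed

section \<open>Geodesic hulls and midpoint convexity\<close>

context cn_space
begin

text \<open>Around a parameter outside the preimage of \<open>C\<close> there would be a maximal gap
  with ends in the preimage, but the midpoint of the gap is mapped into \<open>C\<close>.\<close>

lemma geodesic_in_mid_convex:
  assumes \<gamma>: "geodesic_in UNIV dist \<gamma> x y" and C: "closed C" "mid_convex C" "x \<in> C" "y \<in> C"
    and s: "s \<in> {0..dist x y}"
  shows "\<gamma> s \<in> C"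
proof -
  define l where "l = dist x y"
  have iso: "dist (\<gamma> u) (\<gamma> v) = \<bar>u - v\<bar>" if "u \<in> {0..l}" "v \<in> {0..l}" for u v
    using \<gamma> that unfolding geodesic_in_def l_def by blast
  have ends: "\<gamma> 0 = x" "\<gamma> l = y" using \<gamma> by (auto simp: geodesic_in_def l_def)
  have "continuous_on {0..l} \<gamma>"
    unfolding continuous_on_iff
  proof (intro ballI allI impI)
    fix u e :: real assume "u \<in> {0..l}" "e > 0"
    then show "\<exists>d>0. \<forall>v\<in>{0..l}. dist v u < d \<longrightarrow> dist (\<gamma> v) (\<gamma> u) < e"
      by (intro exI[of _ e]) (simp add: iso dist_real_def)
  qed
  then have clT: "closed ({0..l} \<inter> \<gamma> -` C)" by (intro continuous_closed_preimage C) auto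
  define U where "U = {0..l} \<inter> \<gamma> -` C \<inter> {..s}"
  define V where "V = {0..l} \<inter> \<gamma> -` C \<inter> {s..}"
  have sl: "0 \<le> s" "s \<le> l" using s by (auto simp: l_def)
  have U0: "0 \<in> U" and Vl: "l \<in> V" using sl C ends by (auto simp: U_def V_def)
  have bU: "bdd_above U" and bV: "bdd_below V"
    by (auto simp: U_def V_def intro: bdd_aboveI[of _ s] bdd_belowI[of _ s])
  have "closed U" "closed V" unfolding U_def V_def using clT by (auto intro: closed_Int)
  then have SU: "Sup U \<in> U" and IV: "Inf V \<in> V"
    using closed_contains_Sup[OF _ bU] closed_contains_Inf[OF _ bV] U0 Vl by auto
  define a b where "a = Sup U" and "b = Inf V"
  have ab: "a \<in> {0..l}" "\<gamma> a \<in> C" "a \<le> s" "b \<in> {0..l}" "\<gamma> b \<in> C" "s \<le> b"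
    using SU IV by (auto simp: U_def V_def a_def b_def)
  define c where "c = (a + b) / 2"
  have c: "c \<in> {0..l}" "a \<le> c" "c \<le> b" using ab by (auto simp: c_def)
  have "dist (\<gamma> a) (\<gamma> c) \<le> dist (\<gamma> a) (\<gamma> b) / 2" "dist (\<gamma> c) (\<gamma> b) \<le> dist (\<gamma> a) (\<gamma> b) / 2"
    unfolding iso[OF ab(1) c(1)] iso[OF c(1) ab(4)] iso[OF ab(1) ab(4)]
    using ab by (auto simp: c_def abs_if field_simps)
  then have "mid (\<gamma> a) (\<gamma> b) = \<gamma> c" by (rule mid_unique)
  then have "\<gamma> c \<in> C" using mid_convexD[OF C(2)] ab by metis
  then have "c \<in> U \<or> c \<in> V" using c by (auto simp: U_def V_def)
  then have "c \<le> a \<or> b \<le> c"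
    using cSup_upper[OF _ bU] cInf_lower[OF _ bV] by (auto simp: a_def b_def)
  then have "s = a" using ab c by (auto simp: c_def)
  then show ?thesis using ab by simp
qed

lemma co_subset:
  assumes C: "closed C" "mid_convex C" and "A \<subseteq> C"
  shows "co A \<subseteq> C"
proof -
  have G1: "G1 S \<subseteq> C" if "S \<subseteq> C" for S
    unfolding G1_def using geodesic_in_mid_convex[OF _ C] that by blast
  have "(G1 ^^ n) A \<subseteq> C" for n by (induction n) (use assms(3) G1 in auto)
  then show ?thesis unfolding co_def by blast
qed

end

lemma subset_G1: "C \<subseteq> G1 C"
proof
  fix x assume "x \<in> C"
  then show "x \<in> G1 C"
    unfolding G1_def by (intro CollectI exI[of _ "\<lambda>_. x"] exI[of _ x] exI[of _ 0]) (simp add: geodesic_in_def)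
qed

lemma funpow_G1_mono: "n \<le> m \<Longrightarrow> (G1 ^^ n) C \<subseteq> (G1 ^^ m) C"
  by (rule lift_Suc_mono_le) (simp_all add: subset_G1)

lemma subset_co: "C \<subseteq> co C"
  unfolding co_def using subset_G1[of C] by (intro order_trans[OF _ UN_upper[of 0]]) auto

text \<open>The iterates of \<open>G1\<close> increase, so both points lie in a common one, and
  their midpoint lies in the next.\<close>

lemma (in cn_space) mid_convex_co:
  assumes gs: "geodesic_space (UNIV :: 'b set) dist"
  shows "mid_convex (co C)"
  unfolding mid_convex_def
proof (intro ballI)
  fix x y assume "x \<in> co C" "y \<in> co C"
  then obtain n m where "x \<in> (G1 ^^ Suc n) C" "y \<in> (G1 ^^ Suc m) C" unfolding co_def by blast
  then have xy: "x \<in> (G1 ^^ Suc (max n m)) C" "y \<in> (G1 ^^ Suc (max n m)) C"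
    using funpow_G1_mono[of "Suc n" "Suc (max n m)" C] funpow_G1_mono[of "Suc m" "Suc (max n m)" C] by auto
  obtain \<gamma> where \<gamma>: "geodesic_in UNIV dist \<gamma> x y" using gs by (auto simp: geodesic_space_def)
  have iso: "dist (\<gamma> u) (\<gamma> v) = \<bar>u - v\<bar>" if "u \<in> {0..dist x y}" "v \<in> {0..dist x y}" for u v
    using \<gamma> that unfolding geodesic_in_def by blast
  have ends: "\<gamma> 0 = x" "\<gamma> (dist x y) = y" using \<gamma> by (auto simp: geodesic_in_def)
  have "dist x (\<gamma> (dist x y / 2)) \<le> dist x y / 2" "dist (\<gamma> (dist x y / 2)) y \<le> dist x y / 2"
    using iso[of 0 "dist x y / 2"] iso[of "dist x y / 2" "dist x y"] by (simp_all add: ends)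
  then have "mid x y = \<gamma> (dist x y / 2)" by (rule mid_unique)
  then have "mid x y \<in> G1 ((G1 ^^ Suc (max n m)) C)"
    unfolding G1_def[of "(G1 ^^ Suc (max n m)) C"] using xy \<gamma>
    by (intro CollectI exI[of _ \<gamma>] exI[of _ x] exI[of _ y] exI[of _ "dist x y / 2"]) auto
  then have "mid x y \<in> (G1 ^^ Suc (Suc (max n m))) C" by simp
  then show "mid x y \<in> co C" unfolding co_def by blast
qed

section \<open>Kirszbraun's theorem for gauged distances\<close>

locale cat_space = cn_space mid for mid :: "'b::complete_space \<Rightarrow> 'b \<Rightarrow> 'b" +
  fixes K :: real
  assumes K: "K \<ge> 0"
    and expand: "0 \<le> \<nu> \<Longrightarrow> \<nu> \<le> 1 \<Longrightarrow>
      \<exists>w :: 'b. sn K (dist p w) = \<nu> * sn K (dist p z) \<and> (\<forall>y. \<nu> * gip K p z y \<le> gip K p w y)"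
begin

sublocale cat_gauge K "\<lambda>x y :: 'b. md K (dist x y)" "gip K" "\<lambda>p x. sn K (dist p x)"
proof unfold_locales
  show "gip K \<equiv> \<lambda>p x y. md K (dist p x) + md K (dist p y) + K * md K (dist p x) * md K (dist p y) - md K (dist x y)"
    by (intro eq_reflection ext) (simp add: gip_def)
  show "(\<lambda>p x. sn K (dist p x)) \<equiv> \<lambda>p x. sqrt (2 * md K (dist p x) + K * (md K (dist p x))\<^sup>2)"
    using K by (intro eq_reflection ext) (simp add: sqrt_md)
  show "0 \<le> md K (dist x y)" for x y :: 'b by (rule md_nonneg[OF K])
qed (use K expand in \<open>simp_all add: sqrt_md flip: gip_def\<close>)

text \<open>Passes from finitely many slightly enlarged balls to all balls by weak
  compactness.\<close>

theorem ball_intersection: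
  fixes J :: "'i set" and F :: "'i \<Rightarrow> 'b" and a :: "'i \<Rightarrow> real"
  assumes J: "J \<noteq> {}" and a: "\<And>i. i \<in> J \<Longrightarrow> a i \<ge> 0"
    and d: "\<And>i j. i \<in> J \<Longrightarrow> j \<in> J \<Longrightarrow> md K (dist (F i) (F j)) \<le> d i j"
    and LS: "\<And>S l. finite S \<Longrightarrow> S \<subseteq> J \<Longrightarrow> (\<And>i. i \<in> S \<Longrightarrow> l i \<ge> 0) \<Longrightarrow>
      0 \<le> (\<Sum>i\<in>S. \<Sum>j\<in>S. l i * l j * (a i + a j + K * a i * a j - d i j))"
  shows "\<exists>q. \<forall>i\<in>J. md K (dist q (F i)) \<le> a i"
proof -
  define E where "E = (\<lambda>S n. {q. \<forall>i\<in>S. md K (dist q (F i)) \<le> a i + 1 / real (Suc n)})"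
  obtain i0 where i0: "i0 \<in> J" using J by auto
  \<comment> \<open>Requiring \<open>i0 \<in> S\<close> keeps every set of the family within bounded
    distance of \<open>F i0\<close>.\<close>
  define \<C> where "\<C> = {E S n | S n. finite S \<and> S \<subseteq> J \<and> i0 \<in> S}"
  obtain b where b: "b \<ge> 0" "a i0 + 1 \<le> md K b"
    using md_unbounded[OF K, of "a i0 + 1"] a[OF i0] by auto
  have ne: "E S n \<noteq> {}" if "finite S" "S \<subseteq> J" for S n
  proof -
    have "\<exists>q. \<forall>i\<in>S. md K (dist q (F i)) \<le> a i + 1 / real (Suc n)"
      using that a d LS by (intro finite_ball_intersection[where d = d]) (auto simp: subset_iff)
    then show ?thesis by (auto simp: E_def)
  qed
  have "\<Inter>\<C> \<noteq> {}"
  proof (rule directed_Inter_nonempty[where o' = "F i0" and b = b])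
    show "\<C> \<noteq> {}" unfolding \<C>_def using i0 by blast
    fix C assume "C \<in> \<C>"
    then obtain S n where S: "finite S" "S \<subseteq> J" "i0 \<in> S" and C: "C = E S n" by (auto simp: \<C>_def)
    show "C \<noteq> {}" unfolding C by (rule ne[OF S(1,2)])
    show "closed C"
      unfolding C E_def
    proof -
      have "closed {q. md K (dist q (F i)) \<le> a i + 1 / real (Suc n)}" for i
        by (intro closed_Collect_le continuous_on_compose2[OF continuous_md] continuous_intros) auto
      then have "closed (\<Inter>i\<in>S. {q. md K (dist q (F i)) \<le> a i + 1 / real (Suc n)})" by blast
      also have "(\<Inter>i\<in>S. {q. md K (dist q (F i)) \<le> a i + 1 / real (Suc n)})
          = {q. \<forall>i\<in>S. md K (dist q (F i)) \<le> a i + 1 / real (Suc n)}" by blast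
      finally show "closed {q. \<forall>i\<in>S. md K (dist q (F i)) \<le> a i + 1 / real (Suc n)}" .
    qed
    show "mid_convex C"
      unfolding mid_convex_def C E_def
    proof (intro ballI CollectI)
      fix x y i assume *: "x \<in> {q. \<forall>i\<in>S. md K (dist q (F i)) \<le> a i + 1 / real (Suc n)}"
        "y \<in> {q. \<forall>i\<in>S. md K (dist q (F i)) \<le> a i + 1 / real (Suc n)}" "i \<in> S"
      have "md K (dist (mid x y) (F i)) \<le> md K (max (dist x (F i)) (dist y (F i)))"
        using dist_mid_le_max[of "F i" x y] K by (subst md_le_iff) (auto simp: dist_commute le_max_iff_disj)
      then show "md K (dist (mid x y) (F i)) \<le> a i + 1 / real (Suc n)"
        using * by (auto simp: max_def split: if_splits)
    qed
    obtain q where q: "q \<in> C" using \<open>C \<noteq> {}\<close> by auto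
    then have "md K (dist q (F i0)) \<le> a i0 + 1 / real (Suc n)" using S by (auto simp: C E_def)
    also have "\<dots> \<le> a i0 + 1" by simp
    also have "\<dots> \<le> md K b" by (rule b)
    finally have "dist (F i0) q \<le> b" using b K by (simp add: md_le_iff dist_commute)
    then show "infdist (F i0) C \<le> b" using infdist_le[OF q, of "F i0"] by linarith
  next
    fix C D assume "C \<in> \<C>" "D \<in> \<C>"
    then obtain S n S' n' where S: "finite S" "S \<subseteq> J" "i0 \<in> S" "C = E S n"
      and S': "finite S'" "S' \<subseteq> J" "i0 \<in> S'" "D = E S' n'" by (auto simp: \<C>_def)
    have mono: "E (S \<union> S') (max n n') \<subseteq> E T k" if "T \<subseteq> S \<union> S'" "k \<le> max n n'" for T k
    proof -
      have *: "1 / real (Suc (max n n')) \<le> 1 / real (Suc k)" using that by (intro frac_le) auto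
      show ?thesis
      proof
        fix q assume "q \<in> E (S \<union> S') (max n n')"
        then have "md K (dist q (F i)) \<le> a i + 1 / real (Suc (max n n'))" if "i \<in> T" for i
          using that \<open>T \<subseteq> S \<union> S'\<close> unfolding E_def by blast
        then show "q \<in> E T k" unfolding E_def using add_left_mono[OF *] order_trans by blast
      qed
    qed
    show "\<exists>E'\<in>\<C>. E' \<subseteq> C \<inter> D"
    proof (intro bexI[of _ "E (S \<union> S') (max n n')"])
      show "E (S \<union> S') (max n n') \<subseteq> C \<inter> D" unfolding S(4) S'(4) by (intro Int_greatest mono) auto
      show "E (S \<union> S') (max n n') \<in> \<C>" unfolding \<C>_def using S S' by blast
    qed
  qed
  then obtain q where q: "\<And>C. C \<in> \<C> \<Longrightarrow> q \<in> C" by blast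
  have "md K (dist q (F i)) \<le> a i" if i: "i \<in> J" for i
  proof (rule LIMSEQ_le_const)
    show "(\<lambda>n. a i + 1 / real (Suc n)) \<longlonglongrightarrow> a i"
      using tendsto_add[OF tendsto_const LIMSEQ_inverse_real_of_nat, of "a i"] by (simp add: inverse_eq_divide)
    have "E {i0, i} n \<in> \<C>" for n unfolding \<C>_def using i i0 by blast
    then have "q \<in> E {i0, i} n" for n using q by blast
    then show "\<exists>N. \<forall>n\<ge>N. md K (dist q (F i)) \<le> a i + 1 / real (Suc n)" by (auto simp: E_def)
  qed
  then show ?thesis by blast
qed

text \<open>A maximal partial extension is total, since \<open>ball_intersection\<close> supplies a
  value at any missing index. Partial extensions are graphs, hence \<open>LS\<close> sums over
  pairs. \<open>LS\<close> is asked only at base points outside \<open>J\<close>, which admits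
  auxiliary indices in \<open>J\<close> at which it may fail.\<close>

theorem kirszbraun:
  fixes I J :: "'i set" and F :: "'i \<Rightarrow> 'b" and e :: "'i \<Rightarrow> 'i \<Rightarrow> real"
  assumes J: "J \<noteq> {}" "J \<subseteq> I" and e: "\<And>i. e i i = 0" "\<And>i j. e i j = e j i" "\<And>i j. i \<in> I \<Longrightarrow> j \<in> I \<Longrightarrow> e i j \<ge> 0"
    and F: "\<And>i j. i \<in> J \<Longrightarrow> j \<in> J \<Longrightarrow> md K (dist (F i) (F j)) \<le> e i j"
    and LS: "\<And>p (S :: ('i \<times> 'b) set) l. p \<in> I \<Longrightarrow> p \<notin> J \<Longrightarrow> finite S \<Longrightarrow> fst ` S \<subseteq> I \<Longrightarrow>
      (\<And>s. s \<in> S \<Longrightarrow> l s \<ge> 0) \<Longrightarrow> 0 \<le> (\<Sum>s\<in>S. \<Sum>t\<in>S. l s * l t *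
        (e p (fst s) + e p (fst t) + K * e p (fst s) * e p (fst t) - e (fst s) (fst t)))"
  shows "\<exists>F'. (\<forall>i\<in>J. F' i = F i) \<and> (\<forall>i\<in>I. \<forall>j\<in>I. md K (dist (F' i) (F' j)) \<le> e i j)"
proof -
  define G0 where "G0 = (\<lambda>i. (i, F i)) ` J"
  define \<G> where "\<G> = {G. G0 \<subseteq> G \<and> fst ` G \<subseteq> I \<and> (\<forall>s\<in>G. \<forall>t\<in>G. md K (dist (snd s) (snd t)) \<le> e (fst s) (fst t))}"
  have "\<exists>M\<in>\<G>. \<forall>G\<in>\<G>. M \<subseteq> G \<longrightarrow> G = M"
  proof (rule subset_Zorn_nonempty)
    have "G0 \<in> \<G>" using J F by (auto simp: \<G>_def G0_def)
    then show "\<G> \<noteq> {}" by blast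
    fix C assume C: "C \<noteq> {}" "subset.chain \<G> C"
    then have sub: "C \<subseteq> \<G>" and lin: "\<And>G H. G \<in> C \<Longrightarrow> H \<in> C \<Longrightarrow> G \<subseteq> H \<or> H \<subseteq> G"
      by (auto simp: subset.chain_def)
    have "md K (dist (snd s) (snd t)) \<le> e (fst s) (fst t)" if "s \<in> \<Union>C" "t \<in> \<Union>C" for s t
    proof -
      obtain G H where GH: "s \<in> G" "G \<in> C" "t \<in> H" "H \<in> C" using \<open>s \<in> \<Union>C\<close> \<open>t \<in> \<Union>C\<close> by blast
      then have "\<exists>H'\<in>\<G>. s \<in> H' \<and> t \<in> H'" using lin[of G H] sub by blast
      then show ?thesis by (auto simp: \<G>_def)
    qed
    moreover have "G0 \<subseteq> \<Union>C" "fst ` \<Union>C \<subseteq> I" using C(1) sub by (fastforce simp: \<G>_def)+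
    ultimately show "\<Union>C \<in> \<G>" unfolding \<G>_def by blast
  qed
  then obtain M where M: "M \<in> \<G>" and max: "\<And>G. G \<in> \<G> \<Longrightarrow> M \<subseteq> G \<Longrightarrow> G = M" by blast
  have M': "G0 \<subseteq> M" "fst ` M \<subseteq> I" "\<And>s t. s \<in> M \<Longrightarrow> t \<in> M \<Longrightarrow> md K (dist (snd s) (snd t)) \<le> e (fst s) (fst t)"
    using M by (auto simp: \<G>_def)
  have "I \<subseteq> fst ` M"
  proof (rule ccontr)
    assume "\<not> ?thesis"
    then obtain p where p: "p \<in> I" "p \<notin> fst ` M" by blast
    then have pJ: "p \<notin> J" using M'(1) by (force simp: G0_def)
    have "\<exists>q. \<forall>s\<in>M. md K (dist q (snd s)) \<le> e p (fst s)"
    proof (rule ball_intersection[where d = "\<lambda>s t. e (fst s) (fst t)"])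
      show "M \<noteq> {}" using M'(1) J by (auto simp: G0_def)
      show "0 \<le> e p (fst s)" if "s \<in> M" for s using that M'(2) p by (intro e(3)) auto
      show "md K (dist (snd s) (snd t)) \<le> e (fst s) (fst t)" if "s \<in> M" "t \<in> M" for s t
        using that by (rule M'(3))
      show "0 \<le> (\<Sum>s\<in>S. \<Sum>t\<in>S. l s * l t * (e p (fst s) + e p (fst t) + K * e p (fst s) * e p (fst t) - e (fst s) (fst t)))"
        if "finite S" "S \<subseteq> M" "\<And>s. s \<in> S \<Longrightarrow> 0 \<le> l s" for S l
        using that p(1) pJ order_trans[OF image_mono[OF that(2)] M'(2)] by (intro LS)
    qed
    then obtain q where q: "\<And>s. s \<in> M \<Longrightarrow> md K (dist q (snd s)) \<le> e p (fst s)" by blast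
    have "insert (p, q) M \<in> \<G>"
      using M' q p e(1,2) by (auto simp: \<G>_def dist_commute)
    then have "insert (p, q) M = M" using max by blast
    then show False using p(2) by force
  qed
  then have "\<forall>i\<in>I. \<exists>x. (i, x) \<in> M" by force
  then obtain F' where F': "\<And>i. i \<in> I \<Longrightarrow> (i, F' i) \<in> M" by metis
  have "F' i = F i" if "i \<in> J" for i
  proof -
    have "(i, F i) \<in> M" "(i, F' i) \<in> M" using that M'(1) F' J by (auto simp: G0_def)
    then have "md K (dist (F' i) (F i)) \<le> md K 0" using M'(3)[of "(i, F' i)" "(i, F i)"] e(1) by simp
    then show ?thesis using K by (simp add: md_le_iff del: md_0)
  qed
  moreover have "md K (dist (F' i) (F' j)) \<le> e i j" if "i \<in> I" "j \<in> I" for i j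
    using M'(3)[OF F'[OF that(1)] F'[OF that(2)]] by simp
  ultimately show ?thesis by blast
qed

end

section \<open>Extending all maps at once\<close>

lemma NE_bdd_above:
  assumes "g \<in> NE A" "h \<in> NE A"
  shows "bdd_above ((\<lambda>a. dist (g a) (h a)) ` A)"
proof -
  obtain x e y r where "\<forall>a\<in>A. dist x (g a) \<le> e" "\<forall>a\<in>A. dist y (h a) \<le> r"
    using assms by (auto simp: NE_def bounded_def)
  then have "dist (g a) (h a) \<le> e + dist x y + r" if "a \<in> A" for a
    using dist_triangle[of "g a" "h a" x] dist_triangle[of x "h a" y] that
    by (smt (verit) dist_commute)
  then show ?thesis by (rule bdd_aboveI2)
qed

lemma dist_le_supdist: "g \<in> NE A \<Longrightarrow> h \<in> NE A \<Longrightarrow> a \<in> A \<Longrightarrow> dist (g a) (h a) \<le> supdist A g h"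
  unfolding supdist_def by (intro cSUP_upper NE_bdd_above)

lemma supdist_le: "A \<noteq> {} \<Longrightarrow> (\<And>a. a \<in> A \<Longrightarrow> dist (g a) (h a) \<le> r) \<Longrightarrow> supdist A g h \<le> r"
  unfolding supdist_def by (rule cSUP_least)

lemma supdist_commute: "supdist A g h = supdist A h g"
  by (simp add: supdist_def dist_commute)

lemma supdist_self: "A \<noteq> {} \<Longrightarrow> supdist A g g = 0"
  by (simp add: supdist_def)

lemma supdist_nonneg:
  assumes "A \<noteq> {}" "g \<in> NE A" "h \<in> NE A"
  shows "0 \<le> supdist A g h"
proof -
  obtain a where "a \<in> A" using assms(1) by blast
  then show ?thesis using dist_le_supdist[OF assms(2,3)] zero_le_dist order_trans by blast
qed

lemma supdist_triangle:
  assumes "A \<noteq> {}" "g \<in> NE A" "h \<in> NE A" "k \<in> NE A"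
  shows "supdist A g h \<le> supdist A g k + supdist A k h"
proof (rule supdist_le[OF assms(1)])
  fix a assume "a \<in> A"
  then show "dist (g a) (h a) \<le> supdist A g k + supdist A k h"
    using dist_le_supdist[OF assms(2,4)] dist_le_supdist[OF assms(4,3)] dist_triangle[of "g a" "h a" "k a"]
    by (meson add_mono order_trans)
qed

lemma const_NE: "(\<lambda>_. y) \<in> NE A"
  unfolding NE_def by (cases "A = {}") (simp_all add: image_constant_conv)

text \<open>A metric on \<open>NE A\<close>, topologically equivalent to \<open>supdist A\<close>, in which \<open>g\<close> and \<open>h\<close> are so far
  apart that evaluation \<open>(a, g) \<mapsto> g a\<close> becomes nonexpansive for \<open>md (dist a b) + weight g h\<close>; here \<open>y\<close> is a
  base point and \<open>supdist A g (\<lambda>_. y)\<close> measures the size of \<open>g\<close>.\<close>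

definition growth :: "real \<Rightarrow> real \<Rightarrow> real" where
  "growth K r = md K (2 * r + 1) + md K r"

definition weight :: "real \<Rightarrow> 'a::metric_space set \<Rightarrow> 'b::metric_space \<Rightarrow> ('a \<Rightarrow> 'b) \<Rightarrow> ('a \<Rightarrow> 'b) \<Rightarrow> real" where
  "weight K A y g h = min 1 (supdist A g h) * growth K (min (supdist A g (\<lambda>_. y)) (supdist A h (\<lambda>_. y)))
    + \<bar>growth K (supdist A g (\<lambda>_. y)) - growth K (supdist A h (\<lambda>_. y))\<bar>"

lemma growth_nonneg: "K \<ge> 0 \<Longrightarrow> growth K r \<ge> 0"
  by (simp add: growth_def md_nonneg)

text \<open>The summand \<open>md K (2 * r + 1)\<close> of \<open>growth\<close> is monotone and may
  be dropped; \<open>weight_ge_rad\<close> rests on the other summand.\<close>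

lemma growth_diff: "K \<ge> 0 \<Longrightarrow> 0 \<le> r \<Longrightarrow> r \<le> s \<Longrightarrow> md K s - md K r \<le> growth K s - growth K r"
  by (simp add: growth_def md_le_iff)

lemma growth_mono: "K \<ge> 0 \<Longrightarrow> 0 \<le> r \<Longrightarrow> r \<le> s \<Longrightarrow> growth K r \<le> growth K s"
  using growth_diff[of K r s] md_le_iff[of K r s] by simp

context
  fixes K :: real and A :: "'a::metric_space set" and y :: "'b::metric_space"
  assumes K: "K \<ge> 0" and A: "A \<noteq> {}"
begin

abbreviation (input) rad :: "('a \<Rightarrow> 'b) \<Rightarrow> real" where "rad g \<equiv> supdist A g (\<lambda>_. y)"

lemma rad_nonneg: "g \<in> NE A \<Longrightarrow> rad g \<ge> 0"
  by (rule supdist_nonneg[OF A _ const_NE])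

lemma rad_diff: "g \<in> NE A \<Longrightarrow> h \<in> NE A \<Longrightarrow> \<bar>rad g - rad h\<bar> \<le> supdist A g h"
  using supdist_triangle[OF A, of g "\<lambda>_. y" h] supdist_triangle[OF A, of h "\<lambda>_. y" g] const_NE[of y A]
  by (auto simp: supdist_commute[of A h g] abs_le_iff)

lemma weight_self: "weight K A y g g = 0"
  by (simp add: weight_def supdist_self[OF A])

lemma weight_commute: "weight K A y g h = weight K A y h g"
  by (simp add: weight_def supdist_commute[of A g h] min.commute abs_minus_commute)

lemma weight_nonneg: "g \<in> NE A \<Longrightarrow> h \<in> NE A \<Longrightarrow> weight K A y g h \<ge> 0"
  unfolding weight_def
  by (intro add_nonneg_nonneg mult_nonneg_nonneg growth_nonneg K abs_ge_zero) (simp add: supdist_nonneg[OF A])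

text \<open>The product term alone could be undercut by a detour through a map \<open>k\<close> of
  small growth. The truncation at 1 limits this gain to \<open>m - u k\<close>, which the
  differences of growth along the detour pay for.\<close>

lemma weight_triangle:
  assumes "g \<in> NE A" "h \<in> NE A" "k \<in> NE A"
  shows "weight K A y g h \<le> weight K A y g k + weight K A y k h"
proof -
  define u where "u = (\<lambda>f :: 'a \<Rightarrow> 'b. growth K (rad f))"
  have min_u: "growth K (min (rad f) (rad f')) = min (u f) (u f')" if "f \<in> NE A" "f' \<in> NE A" for f f'
    unfolding u_def using growth_mono[OF K] rad_nonneg that by (auto simp: min_def intro: antisym)
  define \<delta> where "\<delta> = (\<lambda>(f :: 'a \<Rightarrow> 'b) f'. min 1 (supdist A f f'))"
  have w: "weight K A y f f' = \<delta> f f' * min (u f) (u f') + \<bar>u f - u f'\<bar>" if "f \<in> NE A" "f' \<in> NE A" for f f'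
    unfolding weight_def min_u[OF that] by (simp add: \<delta>_def u_def)
  have \<delta>: "0 \<le> \<delta> f f'" "\<delta> f f' \<le> 1" if "f \<in> NE A" "f' \<in> NE A" for f f'
    using supdist_nonneg[OF A that] by (auto simp: \<delta>_def)
  have tri: "\<delta> g h \<le> \<delta> g k + \<delta> k h"
    using supdist_triangle[OF A assms(1,2,3)] supdist_nonneg[OF A] assms
    by (auto simp: \<delta>_def min_def intro: add_increasing add_increasing2)
  have u0: "u f \<ge> 0" for f unfolding u_def by (rule growth_nonneg[OF K])
  define m where "m = min (u g) (u h)"
  show ?thesis
  proof (cases "m \<le> u k")
    case True
    then have "min (u g) (u k) \<ge> m" "min (u k) (u h) \<ge> m" by (auto simp: m_def)
    then have "\<delta> g k * m \<le> \<delta> g k * min (u g) (u k)" "\<delta> k h * m \<le> \<delta> k h * min (u k) (u h)"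
      using \<delta> assms by (auto intro: mult_left_mono)
    moreover have "\<delta> g h * m \<le> (\<delta> g k + \<delta> k h) * m"
      using tri u0 by (intro mult_right_mono) (auto simp: m_def)
    moreover have "\<bar>u g - u h\<bar> \<le> \<bar>u g - u k\<bar> + \<bar>u k - u h\<bar>" by simp
    ultimately show ?thesis using assms by (simp add: w m_def[symmetric] distrib_right)
  next
    case False
    then have k: "u k \<le> u g" "u k \<le> u h" by (auto simp: m_def)
    have "\<delta> g h * m = \<delta> g h * u k + \<delta> g h * (m - u k)" by (simp add: algebra_simps)
    also have "\<delta> g h * (m - u k) \<le> 1 * (m - u k)" using \<delta> assms False by (intro mult_right_mono) auto
    also have "\<delta> g h * u k \<le> (\<delta> g k + \<delta> k h) * u k" using tri u0 by (intro mult_right_mono)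
    finally have "\<delta> g h * m \<le> \<delta> g k * u k + \<delta> k h * u k + (m - u k)" by (simp add: distrib_right)
    moreover have "\<bar>u g - u h\<bar> + (m - u k) \<le> \<bar>u g - u k\<bar> + \<bar>u k - u h\<bar>" using k by (auto simp: m_def)
    ultimately show ?thesis using assms k by (simp add: w m_def[symmetric] min_absorb1 min_absorb2)
  qed
qed

text \<open>Needed for the index \<open>None\<close>: seen from \<open>(x, g)\<close>, its gauge has
  to compensate for the radius of any other map \<open>h\<close>.\<close>

lemma weight_ge_rad:
  assumes "g \<in> NE A" "h \<in> NE A"
  shows "md K (rad h) - md K (rad g) \<le> weight K A y g h"
proof -
  have "md K (rad h) - md K (rad g) \<le> \<bar>growth K (rad g) - growth K (rad h)\<bar>"
  proof (cases "rad g \<le> rad h")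
    case True
    then show ?thesis using growth_diff[OF K rad_nonneg[OF assms(1)]] by fastforce
  next
    case False
    then have "md K (rad h) \<le> md K (rad g)" using K rad_nonneg assms by (simp add: md_le_iff)
    then show ?thesis by linarith
  qed
  then show ?thesis
    unfolding weight_def using supdist_nonneg[OF A assms] growth_nonneg[OF K] by (simp add: add_increasing)
qed

text \<open>Since the first factor is at most 1, passing from the smaller to the larger growth costs
  no more than their difference, the second summand of \<open>weight\<close>.\<close>

lemma weight_ge_max:
  assumes "g \<in> NE A" "h \<in> NE A"
  shows "min 1 (supdist A g h) * growth K (max (rad g) (rad h)) \<le> weight K A y g h"
proof -
  have *: "\<mu> * b \<le> \<mu> * a + \<bar>a - b\<bar> \<and> \<mu> * b \<le> \<mu> * a + \<bar>b - a\<bar>" if "\<mu> \<le> 1" "a \<le> b" for \<mu> a b :: real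
  proof -
    have "\<mu> * (b - a) \<le> 1 * (b - a)" using that by (intro mult_right_mono) auto
    then show ?thesis using that by (simp add: algebra_simps)
  qed
  show ?thesis
    unfolding weight_def using *[of "min 1 (supdist A g h)"] growth_mono[OF K] rad_nonneg assms
    by (cases "rad g \<le> rad h") (simp_all add: max_def min_def)
qed

lemma eval_weight:
  assumes g: "g \<in> NE A" and h: "h \<in> NE A" and ab: "a \<in> A" "b \<in> A"
  shows "md K (dist (g a) (h b)) \<le> md K (dist a b) + weight K A y g h"
proof -
  define R where "R = max (rad g) (rad h)"
  define D where "D = dist (g a) (h b)"
  define t where "t = dist a b"
  define \<delta> where "\<delta> = supdist A g h"
  have \<delta>0: "\<delta> \<ge> 0" unfolding \<delta>_def by (rule supdist_nonneg[OF A g h])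
  have R0: "R \<ge> 0" using rad_nonneg[OF g] by (simp add: R_def)
  have "dist (g a) y \<le> rad g" "dist (h b) y \<le> rad h"
    using dist_le_supdist[OF g const_NE ab(1)] dist_le_supdist[OF h const_NE ab(2)] by auto
  then have D2R: "D \<le> 2 * R" using dist_triangle2[of "g a" "h b" y] by (simp add: D_def R_def)
  have "dist (g a) (g b) \<le> t" using g ab by (auto simp: NE_def t_def)
  then have Dt: "D \<le> t + \<delta>"
    using dist_triangle[of "g a" "h b" "g b"] dist_le_supdist[OF g h ab(2)] by (simp add: D_def \<delta>_def)
  have "md K D \<le> md K t + min 1 \<delta> * md K (2 * R + 1)"
  proof (cases "D \<le> t")
    case True
    then have "md K D \<le> md K t" using K by (simp add: md_le_iff D_def t_def)
    then show ?thesis using \<delta>0 md_nonneg[OF K] by (simp add: add_increasing2)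
  next
    case False
    show ?thesis
    proof (cases "\<delta> \<ge> 1")
      case True
      have "md K D \<le> md K (2 * R + 1)" using K D2R R0 by (subst md_le_iff) (auto simp: D_def)
      then show ?thesis using True md_nonneg[OF K, of t] by (simp add: add_increasing)
    next
      case \<delta>1: False
      define \<theta> where "\<theta> = D - t"
      have \<theta>: "0 \<le> \<theta>" "\<theta> \<le> \<delta>" "\<theta> \<le> 1" using False Dt \<delta>1 by (auto simp: \<theta>_def)
      \<comment> \<open>Convexity on the unit interval from \<open>t\<close> to \<open>t + 1\<close>
        bounds the increment linearly in \<theta>. As \<open>t < D \<le> 2 * R\<close>, that
        interval ends below \<open>2 * R + 1\<close>, which explains the argument of
        \<open>md\<close> in \<open>growth\<close>.\<close>
      have "md K D = md K ((1 - \<theta>) * t + \<theta> * (t + 1))" by (simp add: \<theta>_def algebra_simps)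
      also have "\<dots> \<le> (1 - \<theta>) * md K t + \<theta> * md K (t + 1)" using \<theta> by (intro md_convex K)
      also have "\<dots> \<le> 1 * md K t + \<delta> * md K (2 * R + 1)"
      proof (intro add_mono mult_mono)
        show "md K (t + 1) \<le> md K (2 * R + 1)"
          using K D2R R0 False by (subst md_le_iff) (auto simp: t_def)
      qed (use \<theta> \<delta>0 md_nonneg[OF K] in auto)
      finally show ?thesis using \<delta>1 by simp
    qed
  qed
  also have "min 1 \<delta> * md K (2 * R + 1) \<le> min 1 \<delta> * growth K R"
    using \<delta>0 md_nonneg[OF K] by (intro mult_left_mono) (auto simp: growth_def)
  also have "\<dots> \<le> weight K A y g h" using weight_ge_max[OF g h] by (simp add: \<delta>_def R_def)
  finally show ?thesis by (simp add: D_def t_def)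
qed

lemma weight_small:
  assumes g: "g \<in> NE A" and e: "e > 0"
  shows "\<exists>d>0. \<forall>h\<in>NE A. supdist A g h < d \<longrightarrow> weight K A y g h < e"
proof -
  define G where "G = growth K (rad g)"
  define c where "c = G + 1"
  have G: "G \<ge> 0" "c > 0" "G \<le> c" unfolding G_def c_def using growth_nonneg[OF K, of "rad g"] by auto
  have "continuous_on UNIV (growth K)"
    unfolding growth_def
    by (intro continuous_on_add continuous_on_compose2[OF continuous_md] continuous_intros) auto
  then obtain d where d: "d > 0" "\<And>r. dist r (rad g) < d \<Longrightarrow> dist (growth K r) G < e / 2"
    unfolding continuous_on_iff G_def using e by (metis UNIV_I half_gt_zero)
  show ?thesis
  proof (intro exI[of _ "min d (e / (2 * c))"] conjI ballI impI)
    show "0 < min d (e / (2 * c))" using d e G by simp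
    fix h assume h: "h \<in> NE A" and lt: "supdist A g h < min d (e / (2 * c))"
    have "dist (rad h) (rad g) < d" using rad_diff[OF g h] lt by (simp add: dist_real_def abs_minus_commute)
    then have 1: "\<bar>G - growth K (rad h)\<bar> < e / 2" using d(2) by (simp add: dist_real_def abs_minus_commute)
    have "growth K (min (rad g) (rad h)) \<le> G"
      unfolding G_def using rad_nonneg[OF g] rad_nonneg[OF h] by (intro growth_mono K) auto
    then have "min 1 (supdist A g h) * growth K (min (rad g) (rad h)) \<le> supdist A g h * c"
      using supdist_nonneg[OF A g h] growth_nonneg[OF K] G by (intro mult_mono) auto
    also have "\<dots> \<le> (e / (2 * c)) * c" using lt G by (intro mult_right_mono) auto
    also have "\<dots> = e / 2" using G(2) by (simp add: field_simps)
    finally show "weight K A y g h < e" using 1 unfolding weight_def G_def[symmetric] by linarith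
  qed
qed

end

text \<open>The index space of the extension problem: \<open>Some (x, g)\<close> carries the value at \<open>x\<close> of the extension
  of \<open>g\<close>, and \<open>None\<close> is an additional point, mapped to \<open>y\<close>, which keeps these values in the ball of
  radius \<open>supdist A g (\<lambda>_. y)\<close> around \<open>y\<close>.\<close>
fun index_gauge :: "real \<Rightarrow> 'a::metric_space set \<Rightarrow> 'b::metric_space \<Rightarrow>
    ('a \<times> ('a \<Rightarrow> 'b)) option \<Rightarrow> ('a \<times> ('a \<Rightarrow> 'b)) option \<Rightarrow> real" where
  "index_gauge K A y None None = 0"
| "index_gauge K A y None (Some (x, g)) = md K (supdist A g (\<lambda>_. y))"
| "index_gauge K A y (Some (x, g)) None = md K (supdist A g (\<lambda>_. y))"
| "index_gauge K A y (Some (x, g)) (Some (x', h)) = md K (dist x x') + weight K A y g h"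

section \<open>Extension over the product index set\<close>

lemma CBB_cbb_gauge:
  assumes \<kappa>: "\<kappa> \<le> 0" and X: "CBB \<kappa> (UNIV :: 'a::metric_space set) dist"
  shows "cbb_gauge (- \<kappa>) (\<lambda>x y :: 'a. md (- \<kappa>) (dist x y))"
proof -
  define K where "K = - \<kappa>"
  have K: "K \<ge> 0" using \<kappa> by (simp add: K_def)
  show ?thesis unfolding K_def[symmetric]
  proof (unfold_locales)
    show "0 \<le> K" by (rule K)
    show "0 \<le> md K (dist x y)" for x y :: 'a by (rule md_nonneg[OF K])
    show "md K (dist x y) = 0 \<Longrightarrow> x = y" for x y :: 'a
      using md_eq_iff[OF K, of "dist x y" 0] by simp
    show "- sqrt (2 * md K (dist p x) + K * (md K (dist p x))\<^sup>2) * sqrt (2 * md K (dist p y) + K * (md K (dist p y))\<^sup>2)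
      \<le> md K (dist p x) + md K (dist p y) + K * md K (dist p x) * md K (dist p y) - md K (dist x y)" for p x y :: 'a
      using gip_lower[OF K, of p x y] K by (simp add: sqrt_md gip_def)
    show "\<exists>w. sqrt (2 * md K (dist p w) + K * (md K (dist p w))\<^sup>2) = \<nu> * sqrt (2 * md K (dist p z) + K * (md K (dist p z))\<^sup>2) \<and>
        md K (dist p w) + md K (dist p z) + K * md K (dist p w) * md K (dist p z) - md K (dist w z) =
        \<nu> * (sqrt (2 * md K (dist p z) + K * (md K (dist p z))\<^sup>2))\<^sup>2 \<and>
        (\<forall>y. md K (dist p w) + md K (dist p y) + K * md K (dist p w) * md K (dist p y) - md K (dist w y)
          \<le> \<nu> * (md K (dist p z) + md K (dist p y) + K * md K (dist p z) * md K (dist p y) - md K (dist z y)))"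
      if "0 \<le> \<nu>" "\<nu> \<le> 1" for \<nu> and p z :: 'a
      using CBB_contract[OF \<kappa> X that, of p z] K by (simp add: sqrt_md gip_def flip: K_def)
  qed (simp_all add: dist_commute)
qed

lemma CBB_lang_schroeder:
  fixes x :: "'i \<Rightarrow> 'a::metric_space"
  assumes "\<kappa> \<le> 0" "CBB \<kappa> (UNIV :: 'a set) dist" "finite S" "\<And>i. i \<in> S \<Longrightarrow> l i \<ge> 0"
  shows "0 \<le> (\<Sum>i\<in>S. \<Sum>j\<in>S. l i * l j * gip (- \<kappa>) p (x i) (x j))"
proof -
  interpret cbb_gauge "- \<kappa>" "\<lambda>x y :: 'a. md (- \<kappa>) (dist x y)"
    "\<lambda>p x y. md (- \<kappa>) (dist p x) + md (- \<kappa>) (dist p y) + - \<kappa> * md (- \<kappa>) (dist p x) * md (- \<kappa>) (dist p y) - md (- \<kappa>) (dist x y)"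
    "\<lambda>p x. sqrt (2 * md (- \<kappa>) (dist p x) + - \<kappa> * (md (- \<kappa>) (dist p x))\<^sup>2)"
    by (rule CBB_cbb_gauge[OF assms(1,2)]) simp_all
  show ?thesis using lang_schroeder[OF assms(3,4)] unfolding gip_def .
qed

text \<open>Each index has a shadow in \<open>X\<close>, and every coefficient of the double sum
  dominates \<open>gip\<close> of the two shadows; nonnegative weights preserve this.\<close>

lemma index_gauge_lang_schroeder:
  fixes X :: "'i \<Rightarrow> ('a::metric_space \<times> ('a \<Rightarrow> 'b::metric_space)) option" and y :: 'b
  assumes \<kappa>: "\<kappa> \<le> 0" and CBB: "CBB \<kappa> (UNIV :: 'a set) dist" and A: "A \<noteq> {}"
    and S: "finite S" and l: "\<And>i. i \<in> S \<Longrightarrow> l i \<ge> 0"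
    and X: "\<And>i. i \<in> S \<Longrightarrow> X i = None \<or> (\<exists>x g. X i = Some (x, g) \<and> g \<in> NE A)" and g: "g \<in> NE A"
  defines "K \<equiv> - \<kappa>"
  defines "e \<equiv> index_gauge K A y"
  shows "0 \<le> (\<Sum>i\<in>S. \<Sum>j\<in>S. l i * l j *
    (e (Some (x, g)) (X i) + e (Some (x, g)) (X j) + K * e (Some (x, g)) (X i) * e (Some (x, g)) (X j) - e (X i) (X j)))"
proof -
  have K: "K \<ge> 0" using \<kappa> by (simp add: K_def)
  \<comment> \<open>\<open>None\<close> is sent to the base point \<open>x\<close>, where
    \<open>gip\<close> vanishes.\<close>
  define P where "P = (\<lambda>i. case X i of None \<Rightarrow> x | Some (x', h) \<Rightarrow> x')"
  have "gip K x (P i) (P j) \<le>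
    e (Some (x, g)) (X i) + e (Some (x, g)) (X j) + K * e (Some (x, g)) (X i) * e (Some (x, g)) (X j) - e (X i) (X j)"
    if ij: "i \<in> S" "j \<in> S" for i j
  proof -
    have w0: "0 \<le> weight K A y g h" if "h \<in> NE A" for h by (rule weight_nonneg[OF K A g that])
    have m0: "0 \<le> md K t" for t by (rule md_nonneg[OF K])
    note wr = weight_ge_rad[OF K A g, where y = y]
    consider "X i = None" "X j = None"
      | x' h where "X i = None" "X j = Some (x', h)" "h \<in> NE A"
      | x' h where "X i = Some (x', h)" "h \<in> NE A" "X j = None"
      | x' h x'' h' where "X i = Some (x', h)" "h \<in> NE A" "X j = Some (x'', h')" "h' \<in> NE A"
      using X[OF ij(1)] X[OF ij(2)] by (elim disjE exE conjE) simp_all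
    then show ?thesis
    proof cases
      case 1
      then show ?thesis using K m0 by (simp add: P_def e_def gip_def)
    next
      case 2
      have "0 \<le> K * md K (supdist A g (\<lambda>_. y)) * (md K (dist x x') + weight K A y g h)"
        using K m0 w0[OF 2(3)] by simp
      then show ?thesis using 2 wr[OF 2(3)] m0[of "dist x x'"] by (simp add: P_def e_def gip_def)
    next
      case 3
      have "0 \<le> K * (md K (dist x x') + weight K A y g h) * md K (supdist A g (\<lambda>_. y))"
        using K m0 w0[OF 3(2)] by simp
      then show ?thesis using 3 wr[OF 3(2)] m0[of "dist x x'"] by (simp add: P_def e_def gip_def dist_commute)
    next
      case 4
      have "weight K A y h h' \<le> weight K A y g h + weight K A y g h'"
        using weight_triangle[OF K A 4(2,4) g, of y] by (simp add: weight_commute[OF K A, of y h g])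
      moreover have "K * md K (dist x x') * md K (dist x x'')
          \<le> K * (md K (dist x x') + weight K A y g h) * (md K (dist x x'') + weight K A y g h')"
        using K m0 w0 4 by (intro mult_mono mult_left_mono) auto
      ultimately show ?thesis using 4 by (simp add: P_def e_def gip_def)
    qed
  qed
  then have "(\<Sum>i\<in>S. \<Sum>j\<in>S. l i * l j * gip K x (P i) (P j)) \<le> (\<Sum>i\<in>S. \<Sum>j\<in>S. l i * l j *
    (e (Some (x, g)) (X i) + e (Some (x, g)) (X j) + K * e (Some (x, g)) (X i) * e (Some (x, g)) (X j) - e (X i) (X j)))"
    by (intro sum_mono mult_left_mono mult_nonneg_nonneg l)
  then show ?thesis using CBB_lang_schroeder[where p = x and x = P and l = l, OF \<kappa> CBB S l] unfolding K_def by linarith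
qed

lemma (in cat_space) equicontinuous_extension:
  fixes A :: "'a::metric_space set" and y :: 'b
  assumes \<kappa>: "K = - \<kappa>" and X: "CBB \<kappa> (UNIV :: 'a set) dist" and A: "A \<noteq> {}"
  shows "\<exists>F. (\<forall>g\<in>NE A. \<forall>a\<in>A. F (a, g) = g a) \<and>
    (\<forall>g\<in>NE A. \<forall>x. dist y (F (x, g)) \<le> supdist A g (\<lambda>_. y)) \<and>
    (\<forall>g\<in>NE A. \<forall>h\<in>NE A. \<forall>x x'. md K (dist (F (x, g)) (F (x', h))) \<le> md K (dist x x') + weight K A y g h)"
proof -
  have \<kappa>0: "\<kappa> \<le> 0" using K \<kappa> by simp
  define e where "e = index_gauge K A y"
  define I where "I = insert None (Some ` ((UNIV :: 'a set) \<times> (NE A :: ('a \<Rightarrow> 'b) set)))"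
  define J where "J = insert None (Some ` (A \<times> (NE A :: ('a \<Rightarrow> 'b) set)))"
  define F0 where "F0 = case_option y (\<lambda>(a :: 'a, g). g a)"
  have Icases: "X = None \<or> (\<exists>x g. X = Some (x, g) \<and> g \<in> NE A)" if "X \<in> I" for X
    using that by (auto simp: I_def)
  have radm: "md K (dist y (g a)) \<le> md K (supdist A g (\<lambda>_. y))" if "a \<in> A" "g \<in> NE A" for a g
    using dist_le_supdist[OF that(2) const_NE that(1), of y] K supdist_nonneg[OF A that(2) const_NE, of y]
    by (simp add: md_le_iff dist_commute)
  have "\<exists>F. (\<forall>i\<in>J. F i = F0 i) \<and> (\<forall>i\<in>I. \<forall>j\<in>I. md K (dist (F i) (F j)) \<le> e i j)"
  proof (rule kirszbraun)
    show "J \<noteq> {}" "J \<subseteq> I" by (auto simp: I_def J_def)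
    show "e i i = 0" for i
      unfolding e_def by (cases i) (auto simp: weight_self[OF K A])
    show sym: "e i j = e j i" for i j
      unfolding e_def by (cases i; cases j) (auto simp: dist_commute weight_commute[OF K A])
    show "0 \<le> e i j" if "i \<in> I" "j \<in> I" for i j
      using Icases[OF that(1)] Icases[OF that(2)] 
      by (auto simp: e_def intro!: add_nonneg_nonneg md_nonneg[OF K] weight_nonneg[OF K A])
    show "md K (dist (F0 i) (F0 j)) \<le> e i j" if "i \<in> J" "j \<in> J" for i j
      using that radm eval_weight[OF K A] by (auto simp: J_def F0_def e_def dist_commute[of _ y])
    show "0 \<le> (\<Sum>s\<in>S. \<Sum>t\<in>S. l s * l t *
        (e p (fst s) + e p (fst t) + K * e p (fst s) * e p (fst t) - e (fst s) (fst t)))"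
      if p: "p \<in> I" "p \<notin> J" and S: "finite S" "fst ` S \<subseteq> I" "\<And>s. s \<in> S \<Longrightarrow> 0 \<le> l s"
      for p and S :: "(('a \<times> ('a \<Rightarrow> 'b)) option \<times> 'b) set" and l
    proof -
      \<comment> \<open>As \<open>None \<in> J\<close>, the base point is of the form
        \<open>Some (x, g)\<close>. At \<open>None\<close> the inequality could fail:
        \<open>dist x x'\<close> is not controlled by the radii of the maps.\<close>
      from p obtain x g where "p = Some (x, g)" "g \<in> NE A" by (auto simp: I_def J_def)
      moreover have "fst s = None \<or> (\<exists>x g. fst s = Some (x, g) \<and> g \<in> NE A)" if "s \<in> S" for s
        using that S(2) by (intro Icases) blast
      ultimately show ?thesis
        unfolding e_def \<kappa>
        using index_gauge_lang_schroeder[where X = fst and l = l and g = g and y = y and x = x, OF \<kappa>0 X A S(1,3)]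
        by simp
    qed
  qed
  then obtain F where F: "\<And>i. i \<in> J \<Longrightarrow> F i = F0 i" "\<And>i j. i \<in> I \<Longrightarrow> j \<in> I \<Longrightarrow> md K (dist (F i) (F j)) \<le> e i j"
    by blast
  have inI: "Some (x, g) \<in> I" if "g \<in> NE A" for x g using that by (auto simp: I_def)
  have N: "None \<in> I" "F None = y" using F(1)[of None] by (auto simp: I_def J_def F0_def)
  show ?thesis
  proof (intro exI[of _ "\<lambda>i. F (Some i)"] conjI ballI allI)
    fix g :: "'a \<Rightarrow> 'b" and a assume "g \<in> NE A" "a \<in> A"
    then show "F (Some (a, g)) = g a" by (subst F(1)) (auto simp: J_def F0_def)
  next
    fix g :: "'a \<Rightarrow> 'b" and x assume g: "g \<in> NE A"
    have "md K (dist y (F (Some (x, g)))) \<le> md K (supdist A g (\<lambda>_. y))"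
      using F(2)[OF N(1) inI[OF g], of x] N(2) by (simp add: e_def)
    then show "dist y (F (Some (x, g))) \<le> supdist A g (\<lambda>_. y)"
      using K supdist_nonneg[OF A g const_NE, of y] by (simp add: md_le_iff)
  next
    fix g h :: "'a \<Rightarrow> 'b" and x x' assume gh: "g \<in> NE A" "h \<in> NE A"
    show "md K (dist (F (Some (x, g))) (F (Some (x', h)))) \<le> md K (dist x x') + weight K A y g h"
      using F(2)[OF inI[OF gh(1)] inI[OF gh(2)], of x x'] by (simp add: e_def)
  qed
qed

lemma (in cn_space) infdist_hull_le:
  fixes A :: "'a::metric_space set" and g h :: "'a \<Rightarrow> 'b"
  assumes gs: "geodesic_space (UNIV :: 'b set) dist" and A: "A \<noteq> {}" and gh: "g \<in> NE A" "h \<in> NE A"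
    and z: "z \<in> closure (co (g ` A))"
  shows "infdist z (closure (co (h ` A))) \<le> supdist A g h"
proof -
  let ?D = "closure (co (h ` A))"
  let ?N = "{z. infdist z ?D \<le> supdist A g h}"
  have hD: "h ` A \<subseteq> ?D" by (rule order_trans[OF subset_co closure_subset])
  have D: "mid_convex ?D" by (intro mid_convex_closure mid_convex_co gs)
  have D': "?D \<noteq> {}" using A hD unfolding image_is_empty[of h A, symmetric] by (metis subset_empty)
  have "g ` A \<subseteq> ?N"
  proof
    fix u assume "u \<in> g ` A"
    then obtain a where a: "a \<in> A" "u = g a" by blast
    then have "infdist u ?D \<le> dist u (h a)" using hD by (intro infdist_le) auto
    also have "\<dots> \<le> supdist A g h" using a dist_le_supdist[OF gh] by simp
    finally show "u \<in> ?N" by simp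
  qed
  moreover have "closed ?N" by (intro closed_Collect_le continuous_intros)
  ultimately have "closure (co (g ` A)) \<subseteq> ?N"
    by (intro closure_minimal co_subset mid_convex_infdist_le D D')
  then show ?thesis using z by blast
qed

theorem theorem4p4:
  fixes \<kappa> :: real and A :: "'a::metric_space set"
  assumes "\<kappa> \<le> 0"
    and "CBB \<kappa> (UNIV :: 'a set) dist"
    and "CAT \<kappa> (UNIV :: 'b::complete_space set) dist"
    and "A \<noteq> {}"
  shows "\<exists>\<alpha> :: ('a \<Rightarrow> 'b) \<Rightarrow> ('a \<Rightarrow> 'b).
           (\<forall>g\<in>NE A. \<alpha> g \<in> NE UNIV \<and> (\<forall>a\<in>A. \<alpha> g a = g a) \<and>
                       \<alpha> g ` UNIV \<subseteq> closure (co (g ` A))) \<and>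
           (\<forall>g\<in>NE A. \<forall>\<epsilon>>0. \<exists>\<delta>>0. \<forall>h\<in>NE A.
                supdist A g h < \<delta> \<longrightarrow> supdist UNIV (\<alpha> g) (\<alpha> h) < \<epsilon>)"
proof -
  define K where "K = - \<kappa>"
  have "\<forall>x z. \<exists>m. \<forall>y :: 'b. (dist y m)\<^sup>2 \<le> (dist y x)\<^sup>2 / 2 + (dist y z)\<^sup>2 / 2 - (dist x z)\<^sup>2 / 4"
    using CAT_midpoint[OF assms(1,3)] by blast
  then obtain mid where mid: "\<And>x z y :: 'b. (dist y (mid x z))\<^sup>2 \<le> (dist y x)\<^sup>2 / 2 + (dist y z)\<^sup>2 / 2 - (dist x z)\<^sup>2 / 4"
    by metis
  interpret cat_space mid K
    using mid assms(1) CAT_expand[OF assms(1,3)] by unfold_locales (auto simp: K_def)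
  have gs: "geodesic_space (UNIV :: 'b set) dist" using assms(3) by (simp add: CAT_def)
  obtain y :: 'b where True by blast
  define R where "R = (\<lambda>g. supdist A g (\<lambda>_. y))"
  obtain F where F: "\<And>g a. g \<in> NE A \<Longrightarrow> a \<in> A \<Longrightarrow> F (a, g) = g a"
      "\<And>g x. g \<in> NE A \<Longrightarrow> dist y (F (x, g)) \<le> R g"
      "\<And>g h x x'. g \<in> NE A \<Longrightarrow> h \<in> NE A \<Longrightarrow> md K (dist (F (x, g)) (F (x', h))) \<le> md K (dist x x') + weight K A y g h"
    using equicontinuous_extension[OF K_def assms(2,4), of y] unfolding R_def by blast
  define H where "H = (\<lambda>g :: 'a \<Rightarrow> 'b. closure (co (g ` A)))"
  have gH: "g ` A \<subseteq> H g" for g unfolding H_def by (rule order_trans[OF subset_co closure_subset])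
  have H: "H g \<noteq> {}" "closed (H g)" "mid_convex (H g)" for g
  proof -
    show "H g \<noteq> {}" using assms(4) gH[of g] unfolding image_is_empty[of g A, symmetric] by (metis subset_empty)
    show "closed (H g)" by (simp add: H_def)
    show "mid_convex (H g)" unfolding H_def by (intro mid_convex_closure mid_convex_co gs)
  qed
  have Hball: "H g \<subseteq> cball y (R g)" if g: "g \<in> NE A" for g
    unfolding H_def
  proof (intro closure_minimal co_subset mid_convex_cball closed_cball)
    show "g ` A \<subseteq> cball y (R g)"
      using dist_le_supdist[OF g const_NE, of _ y] by (auto simp: R_def dist_commute)
  qed
  define \<alpha> where "\<alpha> = (\<lambda>g x. proj (H g) (F (x, g)))"
  have \<alpha>H: "\<alpha> g x \<in> H g" for g x unfolding \<alpha>_def by (rule proj(1)[OF H])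
  have Fx: "dist (F (x, g)) (F (x', g)) \<le> dist x x'" if "g \<in> NE A" for g x x'
    using F(3)[OF that that, of x x'] K by (simp add: weight_self[OF K assms(4)] md_le_iff)
  have ext: "\<alpha> g \<in> NE UNIV \<and> (\<forall>a\<in>A. \<alpha> g a = g a) \<and> \<alpha> g ` UNIV \<subseteq> closure (co (g ` A))" if g: "g \<in> NE A" for g
  proof (intro conjI ballI)
    have "dist (\<alpha> g x) (\<alpha> g x') \<le> dist x x'" for x x'
      unfolding \<alpha>_def using proj_nonexpansive[OF H] Fx[OF g] order_trans by blast
    moreover have "bounded (range (\<alpha> g))"
      using bounded_subset[OF bounded_cball] \<alpha>H Hball[OF g] by blast
    ultimately show "\<alpha> g \<in> NE UNIV" by (simp add: NE_def)
    show "\<alpha> g a = g a" if "a \<in> A" for a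
      unfolding \<alpha>_def F(1)[OF g that] using gH that by (intro proj_fixed[OF H]) auto
    show "\<alpha> g ` UNIV \<subseteq> closure (co (g ` A))" using \<alpha>H by (auto simp: H_def)
  qed
  have "\<exists>\<delta>>0. \<forall>h\<in>NE A. supdist A g h < \<delta> \<longrightarrow> supdist UNIV (\<alpha> g) (\<alpha> h) < \<epsilon>"
    if g: "g \<in> NE A" and \<epsilon>: "\<epsilon> > 0" for g \<epsilon>
  proof -
    have "md K 0 < md K (\<epsilon> / 4)" using K \<epsilon> by (intro md_strict_mono) auto
    then obtain d1 where d1: "d1 > 0" "\<And>h. h \<in> NE A \<Longrightarrow> supdist A g h < d1 \<Longrightarrow> weight K A y g h < md K (\<epsilon> / 4)"
      using weight_small[OF K assms(4) g, of "md K (\<epsilon> / 4)" y] by auto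
    \<comment> \<open>Bounds the distance from \<open>F (x, h)\<close> to its projection onto
      \<open>H g\<close>, uniformly in \<open>x\<close>: it is at most \<open>R h + R g\<close>, and
      \<open>R h \<le> R g + 1\<close> once \<open>supdist A g h < 1\<close>.\<close>
    define r where "r = 2 * R g + 1"
    have R0: "R g \<ge> 0" unfolding R_def by (rule supdist_nonneg[OF assms(4) g const_NE])
    have "((\<lambda>t. t + 2 * sqrt (t * r + t\<^sup>2)) \<longlongrightarrow> 0 + 2 * sqrt (0 * r + 0\<^sup>2)) (at_right 0)"
      by (intro tendsto_intros)
    then have "\<forall>\<^sub>F t in at_right 0. t + 2 * sqrt (t * r + t\<^sup>2) < \<epsilon> / 4"
      using \<epsilon> by (intro order_tendstoD(2)) auto
    then obtain b where b: "b > 0" "\<And>t. 0 < t \<Longrightarrow> t < b \<Longrightarrow> t + 2 * sqrt (t * r + t\<^sup>2) < \<epsilon> / 4"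
      unfolding eventually_at_right_field by auto
    show ?thesis
    proof (intro exI[of _ "min d1 (min 1 (b / 2))"] conjI ballI impI)
      show "0 < min d1 (min 1 (b / 2))" using d1 b by simp
      fix h assume h: "h \<in> NE A" and "supdist A g h < min d1 (min 1 (b / 2))"
      then have lt: "supdist A g h < d1" "supdist A g h < 1" "supdist A g h < b / 2" by auto
      have s0: "supdist A g h \<ge> 0" by (rule supdist_nonneg[OF assms(4) g h])
      have "dist (\<alpha> g x) (\<alpha> h x) \<le> \<epsilon> / 2" for x
      proof -
        have "md K (dist (F (x, g)) (F (x, h))) \<le> md K (\<epsilon> / 4)"
          using F(3)[OF g h, of x x] d1(2)[OF h lt(1)] by simp
        then have 1: "dist (F (x, g)) (F (x, h)) \<le> \<epsilon> / 4" using K \<epsilon> by (simp add: md_le_iff)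
        have "R h \<le> R g + 1"
          using rad_diff[OF K assms(4) g h, of y] lt(2) unfolding R_def by linarith
        then have "dist (F (x, h)) (proj (H g) (F (x, h))) \<le> r"
          using F(2)[OF h, of x] Hball[OF g] proj(1)[OF H[of g], of "F (x, h)"]
            dist_triangle3[of "F (x, h)" "proj (H g) (F (x, h))" y] by (auto simp: r_def subset_iff)
        then have "dist (proj (H g) (F (x, h))) (proj (H h) (F (x, h)))
            \<le> supdist A g h + 2 * sqrt (supdist A g h * r + (supdist A g h)\<^sup>2)"
          using infdist_hull_le[OF gs assms(4) g h] infdist_hull_le[OF gs assms(4) h g] s0
          by (intro proj_perturb H) (auto simp: H_def supdist_commute[of A h g])
        also have "\<dots> \<le> b / 2 + 2 * sqrt (b / 2 * r + (b / 2)\<^sup>2)"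
          using lt(3) s0 R0 by (intro add_mono mult_left_mono real_sqrt_le_mono mult_right_mono power_mono)
            (auto simp: r_def)
        also have "\<dots> < \<epsilon> / 4" by (rule b(2)) (use b(1) in auto)
        finally have 2: "dist (proj (H g) (F (x, h))) (proj (H h) (F (x, h))) < \<epsilon> / 4" .
        \<comment> \<open>The intermediate point \<open>proj (H g) (F (x, h))\<close> separates the
          change of the projected point from the change of the convex set.\<close>
        have "dist (\<alpha> g x) (proj (H g) (F (x, h))) \<le> \<epsilon> / 4"
          unfolding \<alpha>_def using proj_nonexpansive[OF H] 1 order_trans by blast
        then show ?thesis
          using 2 dist_triangle[of "\<alpha> g x" "\<alpha> h x" "proj (H g) (F (x, h))"] by (simp add: \<alpha>_def)
      qed
      then have "supdist UNIV (\<alpha> g) (\<alpha> h) \<le> \<epsilon> / 2" by (intro supdist_le) auto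
      then show "supdist UNIV (\<alpha> g) (\<alpha> h) < \<epsilon>" using \<epsilon> by linarith
    qed
  qed
  then show ?thesis using ext by blast
qed

end
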